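(* There exists a universal constant $C>0$ such that the following holds. Let $f\in L^2(\mathbb{R})$, $f\neq 0$, let $\mathcal{Q}$ be a finite nonempty family of squares in $\mathbb{R}^2$ of side length $1$, and let $\Omega=\bigcup_{Q\in\mathcal{Q}}Q$. Let $h=h_{\mathfrak{G}}$ be the Cheeger constant of the weighted graph $\mathfrak{G}=\mathfrak{G}_{f,\mathcal{Q}}$ associated with $(f,\mathcal{Q})$, and let $\delta_0=\max_{v\in\mathfrak{V}}\deg(v)/w(v)$. Then for all $g\in L^2(\mathbb{R})$, $$\min_{\tau\in\mathbb{T}} \|\mathcal{G} g- \tau\, \mathcal{G} f\|_{L^2(\Omega)} \le C \left(KM^{1/2}L^{1/2} + h^{-2}\delta_0 K\nu^{3/2}L^{1/2}+ \operatorname{vol}(\Omega)^{1/2}\right)^{1/2} \|\mathcal{S} f - \mathcal{S} g\|_{L^2(\Omega)}^{1/2},$$ where $\nu=|\mathcal{Q}|$, $M=\sum_{Q\in\mathcal{Q}}\|\mathcal{S}f\|_{L^1(Q)}^{-2}$, $L=\big\|\sum_{Q\in\mathcal{Q}}\mathbf{1}_Q\big\|_{L^\infty(\mathbb{R}^2)}$, and $K=\|\mathcal{S}f\|_{L^\infty(\mathbb{R}^2)}+\|\mathcal{S}g\|_{L^\infty(\mathbb{R}^2)}$.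
   Context: $\mathbb{T}=\{\tau\in\mathbb{C}:|\tau|=1\}$. For $f\in L^2(\mathbb{R})$ the Gabor transform is $\mathcal{G}f(x,y)=\int_{\mathbb{R}} f(t)e^{-\pi(t-x)^2}e^{-2\pi i t y}\,dt$, and the spectrogram is $\mathcal{S}f=|\mathcal{G}f|^2$. $\mathbf{1}_Q$ is the indicator function of $Q$ and $\operatorname{vol}$ is Lebesgue measure on $\mathbb{R}^2$. Associated weighted graph: $\mathfrak{G}_{f,\mathcal{Q}}=(\mathfrak{V},\mathfrak{E})$ has vertex set $\mathfrak{V}$ identified with $\mathcal{Q}$ and edge set $\mathfrak{E}=\mathfrak{V}\times\mathfrak{V}$. The vertex weights are $w(v)=\|\mathcal{G}f\|_{L^2(Q)}^2=\|\mathcal{S}f\|_{L^1(Q)}$ for $v\simeq Q$, and the edge weights are $\sigma((v,v'))=\|\mathcal{G}f\|_{L^2(Q\cap Q')}^4=\|\mathcal{S}f\|_{L^1(Q\cap Q')}^2$ for $v\simeq Q$, $v'\simeq Q'$. The degree of $v$ is $\deg(v)=\sum_{u\in\mathfrak{V}}\sigma((u,v))$. Cheeger constant: $h_{\mathfrak{G}}=\inf_{S}\dfrac{\sigma(\partial S)}{\min\{w(S),w(\mathfrak{V}\setminus S)\}}$, the infimum being over nonempty proper subsets $S\subsetneq\mathfrak{V}$. Here $\partial S$ is the set of edges with one endpoint in $S$ and the other in $\mathfrak{V}\setminus S$, so $\sigma(\partial S)=\sum_{u\in S,\,v\in\mathfrak{V}\setminus S}\sigma((u,v))$, and $w(S)=\sum_{v\in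 S}w(v)$. Conventions: if $h=0$ the right-hand side is read as $+\infty$ (nothing is claimed); if $|\mathcal{Q}|=1$ then $h=+\infty$ and $h^{-2}=0$. *)

theory Defs
  imports "HOL-Analysis.Analysis" "HOL-Probability.Essential_Supremum"
begin

section \<open>Function spaces\<close>

text \<open>Elements of \<open>L\<^sup>2(\<real>)\<close> are represented by functions; two representatives of the same class have
  the same Gabor transform, and the zero element is \<open>AE t in lebesgue. f t = 0\<close>.\<close>

definition square_integrable :: "(real \<Rightarrow> complex) \<Rightarrow> bool" where
  "square_integrable f \<longleftrightarrow>
     f \<in> borel_measurable lebesgue \<and> integrable lebesgue (\<lambda>t. (cmod (f t))\<^sup>2)"

text \<open>The next three norms are real-valued. They agree with the usual norms only where those are
  finite, because a divergent Bochner integral and \<^term>\<open>real_of_ereal \<infinity>\<close> are both \<open>0\<close>. Here they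
  are applied only to bounded continuous functions on bounded sets
  (\<open>\<parallel>\<cdot>\<parallel>\<^bsub>L\<^sup>1(A)\<^esub>\<close>, \<open>\<parallel>\<cdot>\<parallel>\<^bsub>L\<^sup>2(A)\<^esub>\<close>) and to bounded Borel functions (\<open>\<parallel>\<cdot>\<parallel>\<^bsub>L\<^sup>\<infinity>\<^esub>\<close>): by Cauchy-Schwarz,
  the Gabor transform of a square integrable function is bounded and continuous.\<close>

definition L1_norm_on :: "(real \<times> real) set \<Rightarrow> (real \<times> real \<Rightarrow> 'b::real_normed_vector) \<Rightarrow> real" where
  "L1_norm_on A F = (LINT z:A|lebesgue. norm (F z))"

definition L2_norm_on :: "(real \<times> real) set \<Rightarrow> (real \<times> real \<Rightarrow> 'b::real_normed_vector) \<Rightarrow> real" where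
  "L2_norm_on A F = sqrt (LINT z:A|lebesgue. (norm (F z))\<^sup>2)"

definition Linf_norm :: "(real \<times> real \<Rightarrow> 'b::real_normed_vector) \<Rightarrow> real" where
  "Linf_norm F = real_of_ereal (esssup lebesgue (\<lambda>z. ereal (norm (F z))))"

section \<open>Gabor transform and spectrogram\<close>

definition gabor :: "(real \<Rightarrow> complex) \<Rightarrow> real \<times> real \<Rightarrow> complex" where
  "gabor f = (\<lambda>(x, y). LINT t|lebesgue.
     f t * of_real (exp (- pi * (t - x)\<^sup>2)) * exp (- 2 * of_real pi * \<i> * of_real t * of_real y))"

definition spectrogram :: "(real \<Rightarrow> complex) \<Rightarrow> real \<times> real \<Rightarrow> real" where
  "spectrogram f z = (cmod (gabor f z))\<^sup>2"

section \<open>Squares and weighted graphs\<close>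

text \<open>A closed square of side length 1 with corner \<open>p\<close>, in arbitrary position: the sides need not be
  parallel to the coordinate axes.\<close>

definition unit_square :: "(real \<times> real) set \<Rightarrow> bool" where
  "unit_square Q \<longleftrightarrow> (\<exists>p u v. norm u = 1 \<and> norm v = 1 \<and> u \<bullet> v = 0 \<and>
     Q = {p + s *\<^sub>R u + t *\<^sub>R v | s t. s \<in> {0..1} \<and> t \<in> {0..1}})"

text \<open>In a graph with vertex set \<open>V\<close> all of \<open>V \<times> V\<close> are edges; in particular the loop at \<open>v\<close>
  contributes to the degree of \<open>v\<close>.\<close>

definition weighted_degree :: "'v set \<Rightarrow> ('v \<times> 'v \<Rightarrow> real) \<Rightarrow> 'v \<Rightarrow> real" where
  "weighted_degree V \<sigma> v = (\<Sum>u\<in>V. \<sigma> (u, v))"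

text \<open>The value is \<open>\<infinity>\<close> if \<open>V\<close> is a singleton, as the infimum is then taken over the empty set.\<close>

definition cheeger_constant :: "'v set \<Rightarrow> ('v \<Rightarrow> real) \<Rightarrow> ('v \<times> 'v \<Rightarrow> real) \<Rightarrow> ereal" where
  "cheeger_constant V w \<sigma> =
     (INF S \<in> {S. S \<noteq> {} \<and> S \<subset> V}.
        ereal ((\<Sum>u\<in>S. \<Sum>v\<in>V - S. \<sigma> (u, v)) / min (\<Sum>v\<in>S. w v) (\<Sum>v\<in>V - S. w v)))"

definition vertex_weight :: "(real \<Rightarrow> complex) \<Rightarrow> (real \<times> real) set \<Rightarrow> real" where
  "vertex_weight f Q = (L2_norm_on Q (gabor f))\<^sup>2"

definition edge_weight :: "(real \<Rightarrow> complex) \<Rightarrow> (real \<times> real) set \<times> (real \<times> real) set \<Rightarrow> real" where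
  "edge_weight f = (\<lambda>(Q, Q'). (L2_norm_on (Q \<inter> Q') (gabor f)) ^ 4)"

end

theory Submission
  imports Defs "HOL-Complex_Analysis.Complex_Analysis" "HOL-Probability.Distributions"
begin

text \<open>Write \<open>F\<close>, \<open>G\<close> for the Gabor transforms of \<open>f\<close>, \<open>g\<close> and \<open>u = |F|\<^sup>2 - |G|\<^sup>2\<close>.

\<^emph>\<open>One square.\<close> Up to the weight \<open>exp (- \<pi> x\<^sup>2)\<close> the function \<open>F (x, y)\<close> is an entire function of \<open>x - i y\<close>.
Hence \<open>u\<close> extends from the real plane to an entire function of two complex variables. At a suitable
complex point the modulus of this extension dominates
\<open>|H (z, z')|\<close> with \<open>H (z, z') = F z * cnj (F z') - G z * cnj (G z')\<close>, for any two points of a square \<open>Q\<close>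
(\<open>norm_polarized\<close>): the phaseless data determine the rank one kernel of \<open>F\<close> by analytic continuation
off the diagonal. On a fixed bidisc the extension is at most a constant times \<open>K\<close>, so an
inequality of two-constants type (\<open>interval_to_disc_bound\<close>, applied in each variable) interpolates between
this bound and the size of \<open>u\<close> on \<open>Q\<close>. The bidisc may be as large as one likes because \<open>K\<close> is a supremum over the
whole plane; this makes room for the exponent \<open>1/2\<close>, that is \<open>|H|\<^sup>2 \<le> C K \<parallel>u\<parallel>\<close> on
\<open>Q \<times> Q\<close>, with the norm of \<open>L\<^sup>2(Q)\<close>. Two functions with almost equal rank one kernels are close up to a
phase \<open>\<tau>\<^sub>Q\<close>, and one gets \<open>w(Q) |G - \<tau>\<^sub>Q F|\<^sup>2 \<le> C K \<parallel>u\<parallel>\<close> on \<open>Q\<close> (\<open>local_stability\<close>).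

\<^emph>\<open>All squares.\<close> On \<open>Q \<inter> Q'\<close> both \<open>\<tau>\<^sub>Q F\<close> and \<open>\<tau>\<^sub>Q\<^sub>' F\<close> are close to \<open>G\<close>, which bounds
\<open>\<sigma>(Q, Q') |\<tau>\<^sub>Q - \<tau>\<^sub>Q\<^sub>'|\<^sup>2\<close> (\<open>overlap_phase_bound\<close>). Cheeger's inequality on the weighted graph turns these
estimates along the edges into one phase \<open>\<tau>\<close> with small \<open>\<Sum> w(Q) |\<tau>\<^sub>Q - \<tau>|\<^sup>2\<close>, at the price of the factor
\<open>h\<^sup>-\<^sup>2 \<delta>\<^sub>0\<close> (\<open>cheeger_constant_synchronization\<close>). Summing the local errors with the Cauchy-Schwarz inequality gives
\<open>K M\<^sup>1\<^sup>/\<^sup>2 L\<^sup>1\<^sup>/\<^sup>2\<close>, and summing the edge terms gives \<open>K \<nu>\<^sup>3\<^sup>/\<^sup>2 L\<^sup>1\<^sup>/\<^sup>2\<close>; here \<open>L\<close> bounds how often the squares cover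
a point. If some \<open>w(Q)\<close> vanishes, a nonzero Cheeger constant forces \<open>Q\<close> to be the only square; then
\<open>|G|\<^sup>2 = |u|\<close> almost everywhere on it, and the volume term absorbs the estimate.\<close>

section \<open>From an interval to a disc\<close>

text \<open>The Chebyshev polynomials of the second kind. They are the coefficients in the expansion of the Cauchy kernel
\<open>1 / (x - s)\<close> in powers of \<open>1/z\<close>, where \<open>x = (z + 1/z) / 2\<close>.\<close>

fun chebU :: "nat \<Rightarrow> complex \<Rightarrow> complex" where
  "chebU 0 s = 1"
| "chebU (Suc 0) s = 2 * s"
| "chebU (Suc (Suc n)) s = 2 * s * chebU (Suc n) s - chebU n s"

lemma norm_chebU_le:
  assumes "cmod s \<le> 2" shows "cmod (chebU n s) \<le> 5 ^ n"
  using assms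
proof (induction n s rule: chebU.induct)
  case (3 n s)
  have "cmod (chebU (Suc (Suc n)) s) \<le> cmod (2 * s * chebU (Suc n) s) + cmod (chebU n s)"
    by (simp only: chebU.simps norm_triangle_ineq4)
  also have "cmod (2 * s * chebU (Suc n) s) \<le> 4 * 5 ^ Suc n"
    unfolding norm_mult using 3 by (intro mult_mono) (auto simp: norm_mult)
  also have "cmod (chebU n s) \<le> 5 ^ n" using 3 by simp
  finally have "cmod (chebU (Suc (Suc n)) s) \<le> 21 * 5 ^ n" by simp
  also have "\<dots> \<le> 5 ^ Suc (Suc n)" by simp
  finally show ?case .
qed (auto simp: norm_mult)

text \<open>The truncated generating function of the \<open>chebU n s\<close> with its exact remainder. Keeping the remainder explicit
makes all expansions below finite.\<close>

lemma chebU_generating: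
  "(\<Sum>n\<le>N. chebU n s * w ^ n) * (1 - 2 * s * w + w\<^sup>2)
     = 1 - chebU (Suc N) s * w ^ (N + 1) + chebU N s * w ^ (N + 2)"
proof (induction N)
  case (Suc N)
  then show ?case by (simp add: distrib_right algebra_simps power2_eq_square)
qed (simp add: algebra_simps power2_eq_square)

text \<open>The unit circle covers \<open>[-1, 1]\<close> twice under \<open>z \<mapsto> (z + 1/z) / 2 = cos\<close>, whence the factor 2.\<close>

lemma cos_substitution_integral:
  fixes \<phi> :: "real \<Rightarrow> real"
  assumes \<phi>: "continuous_on {-1..1} \<phi>"
  shows "((\<lambda>t. \<phi> (cos (2 * pi * t)) * \<bar>sin (2 * pi * t)\<bar> * (2 * pi)) has_integral 2 * integral {-1..1} \<phi>) {0..1}"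
proof -
  let ?f = "\<lambda>t. \<phi> (cos (2 * pi * t)) * \<bar>sin (2 * pi * t)\<bar> * (2 * pi)"
  let ?d = "\<lambda>t. - sin (2 * pi * t) * (2 * pi)"
  have D: "((\<lambda>t. cos (2 * pi * t)) has_field_derivative ?d t) (at t within A)" for t A
    by (auto intro!: derivative_eq_intros)
  have c: "continuous_on A (\<lambda>t. cos (2 * pi * t))" for A by (intro continuous_intros)
  have sub: "(\<lambda>t. cos (2 * pi * t)) ` A \<subseteq> {-1..1}" for A by auto
  have "((\<lambda>t. ?d t *\<^sub>R \<phi> (cos (2 * pi * t))) has_integral
      (integral {cos (2 * pi * 0)..cos (2 * pi * (1/2))} \<phi> - integral {cos (2 * pi * (1/2))..cos (2 * pi * 0)} \<phi>)) {0..1/2}"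
    by (rule has_integral_substitution_general[where s = "{}" and c = "-1" and d = 1 and f = \<phi> and g = "\<lambda>t. cos (2 * pi * t)" and g' = ?d])
      (rule finite.emptyI sub \<phi> c D | simp)+
  from has_integral_neg[OF this]
  have "((\<lambda>t. - (?d t *\<^sub>R \<phi> (cos (2 * pi * t)))) has_integral integral {-1..1} \<phi>) {0..1/2}" by simp
  then have 1: "(?f has_integral integral {-1..1} \<phi>) {0..1/2}"
  proof (rule has_integral_eq[rotated])
    fix t :: real assume "t \<in> {0..1/2}"
    then have "sin (2 * pi * t) \<ge> 0" by (intro sin_ge_zero) (simp_all add: field_simps)
    then show "- (?d t *\<^sub>R \<phi> (cos (2 * pi * t))) = ?f t" by simp
  qed
  have "((\<lambda>t. ?d t *\<^sub>R \<phi> (cos (2 * pi * t))) has_integral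
      (integral {cos (2 * pi * (1/2))..cos (2 * pi * 1)} \<phi> - integral {cos (2 * pi * 1)..cos (2 * pi * (1/2))} \<phi>)) {1/2..1}"
    by (rule has_integral_substitution_general[where s = "{}" and c = "-1" and d = 1 and f = \<phi> and g = "\<lambda>t. cos (2 * pi * t)" and g' = ?d])
      (rule finite.emptyI sub \<phi> c D | simp)+
  then have "((\<lambda>t. ?d t *\<^sub>R \<phi> (cos (2 * pi * t))) has_integral integral {-1..1} \<phi>) {1/2..1}" by simp
  then have 2: "(?f has_integral integral {-1..1} \<phi>) {1/2..1}"
  proof (rule has_integral_eq[rotated])
    fix t :: real assume "t \<in> {1/2..1}"
    then have "sin (2 * pi * (1 - t)) \<ge> 0" by (intro sin_ge_zero) (simp_all add: field_simps)
    then have "sin (2 * pi * t) \<le> 0" by (simp add: right_diff_distrib sin_diff)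
    then show "?d t *\<^sub>R \<phi> (cos (2 * pi * t)) = ?f t" by simp
  qed
  show ?thesis using has_integral_combine[OF _ _ 1 2] by simp
qed

text \<open>The integrand is the logarithmic derivative of \<open>z + 1/z - 2 s\<close>, so the integral counts zeros minus
poles in the disc: the two zeros have product 1 and modulus at most 5, and the pole is at 0.\<close>

lemma circle_root_integral:
  assumes "cmod s \<le> 2"
  shows "((\<lambda>z. (1 - (inverse z)\<^sup>2) * inverse z / (1 - 2 * s * inverse z + (inverse z)\<^sup>2))
     has_contour_integral 2 * pi * \<i>) (circlepath 0 625)"
proof -
  define \<eta> where "\<eta> = s + csqrt (s\<^sup>2 - 1)"
  define \<eta>' where "\<eta>' = s - csqrt (s\<^sup>2 - 1)"
  have prod: "\<eta> * \<eta>' = 1" and sum: "\<eta> + \<eta>' = 2 * s"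
    by (simp_all add: \<eta>_def \<eta>'_def square_diff_square_factored[symmetric] flip: power2_eq_square)
  have "cmod (s\<^sup>2 - 1) \<le> cmod (s\<^sup>2) + 1" using norm_triangle_ineq4[of "s\<^sup>2" 1] by simp
  also have "\<dots> \<le> 2\<^sup>2 + 1" unfolding norm_power using assms by (intro add_right_mono power_mono) auto
  finally have "(cmod (csqrt (s\<^sup>2 - 1)))\<^sup>2 \<le> 3\<^sup>2" by (simp flip: norm_power)
  then have "cmod (csqrt (s\<^sup>2 - 1)) \<le> 3" by (rule power2_le_imp_le) simp
  then have b: "cmod \<eta> \<le> 5" "cmod \<eta>' \<le> 5"
    unfolding \<eta>_def \<eta>'_def using assms norm_triangle_ineq norm_triangle_ineq4
    by (smt (verit))+
  have I: "((\<lambda>z. 1 / (z - a)) has_contour_integral 2 * pi * \<i>) (circlepath 0 625)" if "cmod a \<le> 5" for a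
    using Cauchy_integral_circlepath_simple[of "\<lambda>_. 1" 0 625 a] that by simp
  have "((\<lambda>z. 1 / (z - \<eta>) + 1 / (z - \<eta>') - 1 / (z - 0)) has_contour_integral
      (2 * pi * \<i> + 2 * pi * \<i> - 2 * pi * \<i>)) (circlepath 0 625)"
    by (intro has_contour_integral_add has_contour_integral_diff I b) simp
  then have "((\<lambda>z. 1 / (z - \<eta>) + 1 / (z - \<eta>') - 1 / (z - 0)) has_contour_integral 2 * pi * \<i>) (circlepath 0 625)"
    by (simp only: add_diff_cancel_right')
  then show ?thesis
  proof (rule has_contour_integral_eq)
    fix z assume "z \<in> path_image (circlepath 0 625)"
    then have z: "cmod z = 625" by simp
    then have nz: "z \<noteq> 0" "z - \<eta> \<noteq> 0" "z - \<eta>' \<noteq> 0" using b by auto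
    have q: "1 - 2 * s * inverse z + (inverse z)\<^sup>2 = (z - \<eta>) * (z - \<eta>') / z\<^sup>2"
      using nz(1) sum[symmetric] prod by (simp add: field_simps power2_eq_square)
    have "1 / (z - \<eta>) + 1 / (z - \<eta>') - 1 / z = (z\<^sup>2 - \<eta> * \<eta>') / (z * ((z - \<eta>) * (z - \<eta>')))"
    proof -
      have pf: "1 / a + 1 / b - 1 / c = (b * c + a * c - a * b) / (c * (a * b))"
        if "a \<noteq> 0" "b \<noteq> 0" "c \<noteq> 0" for a b c :: complex
        using that by (simp add: field_simps)
      show ?thesis unfolding pf[OF nz(2,3,1)] by (simp add: algebra_simps power2_eq_square)
    qed
    note fractions = this
    have clear: "(c\<^sup>2 - 1) / (c * p) = (1 - (inverse c)\<^sup>2) * inverse c / (p / c\<^sup>2)"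
      if "c \<noteq> 0" "p \<noteq> 0" for c p :: complex
      using that by (simp add: field_simps power2_eq_square)
    show "1 / (z - \<eta>) + 1 / (z - \<eta>') - 1 / (z - 0)
        = (1 - (inverse z)\<^sup>2) * inverse z / (1 - 2 * s * inverse z + (inverse z)\<^sup>2)"
      using fractions clear[OF nz(1), of "(z - \<eta>) * (z - \<eta>')"] nz unfolding q prod by simp
  qed
qed

text \<open>The factor \<open>1 - 1/z\<^sup>2\<close> becomes \<open>2 |sin|\<close> in modulus on the unit circle and is the Jacobian of
\<open>x = cos\<close>. This is why polynomials of the second kind are used: the coefficients of \<open>g\<close> are bounded by the
unweighted integral of \<open>|g|\<close> over the interval.\<close>

lemma unit_circle_moment_bound:
  assumes g: "g holomorphic_on UNIV"
  shows "cmod (contour_integral (circlepath 0 1) (\<lambda>z. g ((z + inverse z) / 2) * ((1 - (inverse z)\<^sup>2) * inverse z ^ Suc n)))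
    \<le> 4 * integral {-1..1} (\<lambda>x. cmod (g (of_real x)))"
proof -
  let ?F = "\<lambda>z. g ((z + inverse z) / 2) * ((1 - (inverse z)\<^sup>2) * inverse z ^ Suc n)"
  have gc: "continuous_on A g" for A using g holomorphic_on_imp_continuous_on holomorphic_on_subset by blast
  have \<phi>: "continuous_on {-1..1} (\<lambda>x. cmod (g (of_real x)))"
    by (intro continuous_intros continuous_on_compose2[OF gc[of UNIV]]) auto
  have "continuous_on (path_image (circlepath 0 1)) ?F"
    by (intro continuous_intros continuous_on_compose2[OF gc[of UNIV]]) auto
  then have ci: "?F contour_integrable_on circlepath 0 1"
    by (rule contour_integrable_continuous_circlepath)
  have "cmod (contour_integral (circlepath 0 1) ?F)
     = cmod (integral {0..1} (\<lambda>t. ?F (circlepath 0 1 t) * vector_derivative (circlepath 0 1) (at t)))"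
    by (simp only: contour_integral_integral)
  also have "\<dots> \<le> integral {0..1} (\<lambda>t. 2 * (cmod (g (of_real (cos (2 * pi * t)))) * \<bar>sin (2 * pi * t)\<bar> * (2 * pi)))"
  proof (rule integral_norm_bound_integral)
    show "(\<lambda>t. ?F (circlepath 0 1 t) * vector_derivative (circlepath 0 1) (at t)) integrable_on {0..1}"
      by (rule contour_integrable_on[THEN iffD1, OF ci])
    show "(\<lambda>t. 2 * (cmod (g (of_real (cos (2 * pi * t)))) * \<bar>sin (2 * pi * t)\<bar> * (2 * pi))) integrable_on {0..1}"
      using has_integral_mult_right[OF cos_substitution_integral[OF \<phi>], of 2] by (rule has_integral_integrable)
    fix t :: real
    let ?z = "circlepath 0 1 t"
    have z: "?z = cis (2 * pi * t)" by (simp add: circlepath cis_conv_exp mult_ac)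
    have iz: "inverse ?z = cis (- (2 * pi * t))" by (simp add: z cis_inverse)
    have nz: "cmod (inverse ?z) = 1" by (simp add: iz)
    have x: "(?z + inverse ?z) / 2 = of_real (cos (2 * pi * t))"
      unfolding z cis_inverse by (simp add: complex_eq_iff)
    have "(1 - (inverse ?z)\<^sup>2) = inverse ?z * (?z - inverse ?z)"
    proof -
      have "inverse ?z * ?z = 1" unfolding z cis_inverse by (simp add: cis_mult)
      then show ?thesis by (simp only: right_diff_distrib power2_eq_square)
    qed
    moreover have "?z - inverse ?z = of_real (2 * sin (2 * pi * t)) * \<i>"
      unfolding z cis_inverse by (simp add: complex_eq_iff)
    ultimately have s: "cmod (1 - (inverse ?z)\<^sup>2) = 2 * \<bar>sin (2 * pi * t)\<bar>"
      by (simp only: norm_mult nz norm_of_real) (simp add: abs_mult)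
    have d: "cmod (vector_derivative (circlepath 0 1) (at t)) = 2 * pi"
      by (simp add: vector_derivative_circlepath norm_mult)
    show "cmod (?F ?z * vector_derivative (circlepath 0 1) (at t))
      \<le> 2 * (cmod (g (of_real (cos (2 * pi * t)))) * \<bar>sin (2 * pi * t)\<bar> * (2 * pi))"
      unfolding norm_mult norm_power s d x nz by simp
  qed
  also have "\<dots> = 4 * integral {-1..1} (\<lambda>x. cmod (g (of_real x)))"
    using integral_unique[OF has_integral_mult_right[OF cos_substitution_integral[OF \<phi>], of 2]] by (simp only: mult.assoc)
  finally show ?thesis .
qed

text \<open>A quantitative form of the two-constants theorem for an interval. With \<open>x = (z + 1/z) / 2\<close>, Cauchy's formula on
the ellipse \<open>|z| = 625\<close> expands \<open>g s\<close> into the polynomials \<open>chebU n s\<close>. Each of the first \<open>N + 1\<close> coefficients is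
computed on the unit circle, so it is bounded by the integral of \<open>|g|\<close> over \<open>[-1, 1]\<close>; the remainder is estimated on the large
circle by \<open>K\<close>. As \<open>chebU n\<close> grows like \<open>5\<^sup>n\<close> and \<open>625 = 5\<^sup>4\<close>, the remainder is of order
\<open>(5/625)\<^sup>N\<close>: the loss \<open>5\<^sup>N\<close> is beaten by its third power. The bound is linear in the two
quantities and \<open>N\<close> is free, so it can be integrated and iterated before \<open>N\<close> is chosen.\<close>

lemma interval_to_disc_bound:
  assumes g: "g holomorphic_on UNIV" and K: "\<And>x. cmod x \<le> 625 \<Longrightarrow> cmod (g x) \<le> K" and s: "cmod s \<le> 2"
  shows "cmod (g s) \<le> 5 ^ Suc N * integral {-1..1} (\<lambda>x. cmod (g (of_real x))) + K / 125 ^ N"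
proof -
  define X where "X = (\<lambda>z::complex. (z + inverse z) / 2)"
  define k where "k = (\<lambda>z::complex. (1 - (inverse z)\<^sup>2) * inverse z / (1 - 2 * s * inverse z + (inverse z)\<^sup>2))"
  define F where "F = (\<lambda>n z. g (X z) * ((1 - (inverse z)\<^sup>2) * inverse z ^ Suc n))"
  define I where "I = integral {-1..1} (\<lambda>x. cmod (g (of_real x)))"
  let ?C = "circlepath 0 (625::real)"
  have K0: "K \<ge> 0" using order_trans[OF norm_ge_zero K[of 0]] by simp
  have X': "(X has_field_derivative (1 - (inverse z)\<^sup>2) / 2) (at z within A)" if "z \<noteq> 0" for z A
    unfolding X_def using that by (auto intro!: derivative_eq_intros simp: power2_eq_square)
  have Xb: "cmod (X z) \<le> 625" if "cmod z = 625" for z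
  proof -
    have "cmod (z + inverse z) \<le> 625 + 1/625"
      using norm_triangle_ineq[of z "inverse z"] that by (simp add: norm_inverse)
    then show ?thesis by (simp add: X_def norm_divide)
  qed
  have den: "cmod (1 - 2 * s * inverse z + (inverse z)\<^sup>2) \<ge> 1/2" if "cmod z = 625" for z
  proof -
    have "cmod (2 * s * inverse z - (inverse z)\<^sup>2) \<le> cmod (2 * s * inverse z) + cmod ((inverse z)\<^sup>2)"
      by (rule norm_triangle_ineq4)
    also have "\<dots> \<le> 4/625 + (1/625)\<^sup>2"
      using s that by (simp add: norm_mult norm_inverse norm_power)
    also have "\<dots> \<le> 1/2" by (simp add: power2_eq_square)
    finally have "cmod (2 * s * inverse z - (inverse z)\<^sup>2) \<le> 1/2" .
    then show ?thesis
      using norm_triangle_ineq2[of 1 "2 * s * inverse z - (inverse z)\<^sup>2"] by (simp add: algebra_simps)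
  qed
  have XN: "(X z - s) * (2 * z) = z\<^sup>2 * (1 - 2 * s * inverse z + (inverse z)\<^sup>2)" if "z \<noteq> 0" for z
    using that by (simp add: X_def field_simps power2_eq_square)
  \<comment> \<open>The kernel integrates to \<open>2 \<pi> i\<close>, so the Cauchy formula reduces to a vanishing integral of the difference quotient, which is a derivative in \<open>z\<close>.\<close>
  define G where "G = (\<lambda>z. if z = s then deriv g s else (g z - g s) / (z - s))"
  have G: "G holomorphic_on UNIV" unfolding G_def by (rule pole_lemma_open[OF g]) simp
  then obtain P where P: "\<And>z. (P has_field_derivative G z) (at z)"
    using holomorphic_convex_primitive'[OF convex_UNIV open_UNIV G] by auto
  have "((\<lambda>z. G (X z) * ((1 - (inverse z)\<^sup>2) / 2)) has_contour_integral 0) ?C"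
  proof (rule Cauchy_theorem_primitive[where f = "\<lambda>z. P (X z)" and S = "-{0}"])
    fix z :: complex assume "z \<in> -{0}"
    then show "((\<lambda>z. P (X z)) has_field_derivative G (X z) * ((1 - (inverse z)\<^sup>2) / 2)) (at z within -{0})"
      by (intro DERIV_chain2[OF P X']) auto
  qed auto
  then have z0: "((\<lambda>z. g (X z) * k z - g s * k z) has_contour_integral 0) ?C"
  proof (rule has_contour_integral_eq)
    fix z assume "z \<in> path_image ?C"
    then have z: "cmod z = 625" by simp
    have nz: "z \<noteq> 0" using z by auto
    have dn: "1 - 2 * s * inverse z + (inverse z)\<^sup>2 \<noteq> 0" using den[OF z] by auto
    have ne: "X z - s \<noteq> 0" using XN[OF nz] nz dn by auto
    have kz: "k z = (1 - (inverse z)\<^sup>2) / 2 / (X z - s)"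
    proof -
      have "1 - 2 * s * inverse z + (inverse z)\<^sup>2 = (X z - s) * (2 * inverse z)"
      proof -
        have "z\<^sup>2 * (1 - 2 * s * inverse z + (inverse z)\<^sup>2) = z\<^sup>2 * ((X z - s) * (2 * inverse z))"
          unfolding XN[OF nz, symmetric] using nz by (simp add: power2_eq_square)
        then show ?thesis using nz by simp
      qed
      note D = this
      have cancel: "m * c / (a * (2 * c)) = m / 2 / a" if "c \<noteq> 0" for a c m :: complex
        using that by simp
      show ?thesis unfolding k_def D by (rule cancel) (use nz in simp)
    qed
    have Gz: "G (X z) = (g (X z) - g s) / (X z - s)" using ne by (simp add: G_def)
    show "G (X z) * ((1 - (inverse z)\<^sup>2) / 2) = g (X z) * k z - g s * k z"
      unfolding Gz kz left_diff_distrib[symmetric] by simp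
  qed
  have "((\<lambda>z. g s * k z) has_contour_integral g s * (2 * pi * \<i>)) ?C"
    unfolding k_def by (rule has_contour_integral_lmul[OF circle_root_integral[OF s]])
  from has_contour_integral_add[OF z0 this]
  have main: "((\<lambda>z. g (X z) * k z) has_contour_integral g s * (2 * pi * \<i>)) ?C" by simp
  \<comment> \<open>Each coefficient integral may be moved to the unit circle, as its integrand is holomorphic away from 0.\<close>
  have hol: "F n holomorphic_on (UNIV - {0})" for n
    unfolding F_def X_def
    by (intro holomorphic_intros holomorphic_on_compose_gen[OF _ g, unfolded o_def]) auto
  have ci: "F n contour_integrable_on ?C" and ceq: "contour_integral ?C (F n) = contour_integral (circlepath 0 1) (F n)" for n
    using contour_integral_circlepath_eq[OF open_UNIV hol, of 1 625] by auto
  have Jb: "cmod (contour_integral ?C (F n)) \<le> 4 * I" for n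
    unfolding ceq unfolding F_def X_def I_def by (rule unit_circle_moment_bound[OF g])
  have I0: "I \<ge> 0" using Jb[of 0] norm_ge_zero[of "contour_integral ?C (F 0)"] by linarith
  have Sci: "((\<lambda>z. \<Sum>n\<le>N. chebU n s * F n z) has_contour_integral (\<Sum>n\<le>N. chebU n s * contour_integral ?C (F n))) ?C"
    by (intro has_contour_integral_sum has_contour_integral_lmul has_contour_integral_integral ci) auto
  have rem: "cmod (g (X z) * k z - (\<Sum>n\<le>N. chebU n s * F n z)) \<le> K / 125 ^ N / 625" if z: "cmod z = 625" for z
  proof -
    let ?w = "inverse z" let ?D = "1 - 2 * s * inverse z + (inverse z)\<^sup>2"
    have D: "?D \<noteq> 0" using den[OF z] by auto
    let ?r = "chebU (Suc N) s * ?w ^ (N + 1) - chebU N s * ?w ^ (N + 2)"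
    have "1 / ?D - (\<Sum>n\<le>N. chebU n s * ?w ^ n) = ?r / ?D"
      using chebU_generating[of s ?w N] D by (simp add: field_simps)
    moreover have "g (X z) * k z - (\<Sum>n\<le>N. chebU n s * F n z)
        = g (X z) * (1 - ?w\<^sup>2) * ?w * (1 / ?D - (\<Sum>n\<le>N. chebU n s * ?w ^ n))"
    proof -
      have "(\<Sum>n\<le>N. chebU n s * F n z) = g (X z) * (1 - ?w\<^sup>2) * ?w * (\<Sum>n\<le>N. chebU n s * ?w ^ n)"
        by (simp add: F_def sum_distrib_left mult_ac)
      moreover have "g (X z) * k z = g (X z) * (1 - ?w\<^sup>2) * ?w * (1 / ?D)" by (simp add: k_def)
      ultimately show ?thesis by (simp only: right_diff_distrib)
    qed
    ultimately have e: "g (X z) * k z - (\<Sum>n\<le>N. chebU n s * F n z) = g (X z) * (1 - ?w\<^sup>2) * ?w * (?r / ?D)" by simp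
    have w: "cmod ?w = 1/625" by (simp add: norm_inverse z)
    have "cmod ?r \<le> cmod (chebU (Suc N) s * ?w ^ (N + 1)) + cmod (chebU N s * ?w ^ (N + 2))"
      by (rule norm_triangle_ineq4)
    also have "\<dots> \<le> 5 ^ Suc N * (1/625) ^ (N + 1) + 5 ^ N * (1/625) ^ (N + 2)"
      unfolding norm_mult norm_power w by (intro add_mono mult_right_mono norm_chebU_le s) auto
    also have "\<dots> = (1/125) ^ N * (1/125 + 1/625\<^sup>2)"
      by (simp add: power_add power_divide power_mult_distrib[symmetric] field_simps flip: power_mult_distrib)
    also have "\<dots> \<le> (1/125) ^ N * (1/8)" by (intro mult_left_mono) auto
    finally have r: "cmod ?r \<le> (1/125) ^ N * (1/8)" .
    have "cmod ?r / cmod ?D \<le> ((1/125) ^ N * (1/8)) / (1/2)"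
      using r den[OF z] by (intro frac_le) auto
    then have rD: "cmod (?r / ?D) \<le> (1/125) ^ N * (1/4)" by (simp add: norm_divide)
    have o: "cmod (1 - ?w\<^sup>2) \<le> 2" using norm_triangle_ineq4[of 1 "?w\<^sup>2"]
      unfolding norm_power w by (simp add: power2_eq_square)
    have "cmod (g (X z) * (1 - ?w\<^sup>2) * ?w * (?r / ?D)) \<le> K * 2 * (1/625) * ((1/125) ^ N * (1/4))"
      unfolding norm_mult[of _ "?r / ?D"] norm_mult[of _ ?w] norm_mult[of _ "1 - ?w\<^sup>2"]
      using K[OF Xb[OF z]] o rD K0 w by (intro mult_mono) auto
    also have "\<dots> \<le> K / 125 ^ N / 625" using K0 by (simp add: power_divide field_simps)
    finally show ?thesis unfolding e .
  qed
  let ?S = "\<Sum>n\<le>N. chebU n s * contour_integral ?C (F n)"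
  have R: "cmod (g s * (2 * pi * \<i>) - ?S) \<le> K / 125 ^ N / 625 * (2 * pi * 625)"
    by (rule has_contour_integral_bound_circlepath[OF has_contour_integral_diff[OF main Sci]])
      (use K0 rem in auto)
  have "cmod ?S \<le> (\<Sum>n\<le>N. 5 ^ n * (4 * I))"
    by (rule sum_norm_le) (auto simp: norm_mult intro!: mult_mono norm_chebU_le s Jb)
  also have "\<dots> = (\<Sum>n\<le>N. 5 ^ n) * (4 * I)" by (simp add: sum_distrib_right)
  also have "(\<Sum>n\<le>N. 5 ^ n :: real) \<le> 5 ^ Suc N"
  proof (induction N)
    case (Suc N)
    have "(0::real) \<le> 5 ^ N" by simp
    then show ?case using Suc unfolding sum.atMost_Suc power_Suc by linarith
  qed simp
  finally have S: "cmod ?S \<le> 5 ^ Suc N * (4 * I)" using I0 by (simp add: mult_right_mono)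
  have "2 * pi * cmod (g s) = cmod (g s * (2 * pi * \<i>))" by (simp add: norm_mult)
  also have "\<dots> \<le> cmod (g s * (2 * pi * \<i>) - ?S) + cmod ?S" using norm_triangle_ineq[of "g s * (2 * pi * \<i>) - ?S" ?S] by simp
  also have "\<dots> \<le> 2 * pi * (K / 125 ^ N) + 5 ^ Suc N * (4 * I)" using add_mono[OF R S] by (simp add: mult_ac)
  also have "5 ^ Suc N * (4 * I) \<le> 2 * pi * (5 ^ Suc N * I)"
    using pi_gt3 I0 mult_right_mono[of 4 "2 * pi" "5 ^ Suc N * I"] by (simp add: mult_ac)
  finally have "2 * pi * cmod (g s) \<le> 2 * pi * (5 ^ Suc N * I + K / 125 ^ N)" by (simp add: algebra_simps)
  then show ?thesis unfolding I_def by simp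
qed

section \<open>From a square to a bidisc\<close>

lemma nn_integral_continuous_interval:
  fixes \<phi> :: "real \<Rightarrow> real"
  assumes "continuous_on {-1..1} \<phi>" "\<And>x. \<phi> x \<ge> 0"
  shows "(\<integral>\<^sup>+x. indicator {-1..1} x * ennreal (\<phi> x) \<partial>lborel) = ennreal (integral {-1..1} \<phi>)"
proof -
  have "(\<phi> has_integral integral {-1..1} \<phi>) {-1..1}"
    using assms(1) by (intro integrable_integral integrable_continuous_interval)
  from nn_integral_has_integral_lebesgue[OF _ this] assms(2) show ?thesis by (simp add: ennreal_mult ennreal_indicator)
qed

text \<open>The one-variable bound is applied in the second variable for each real \<open>x\<close>, integrated over \<open>x\<close>, and applied
in the first variable. The losses multiply to \<open>25\<^sup>N\<close>, and the gain is still \<open>25\<^sup>-\<^sup>N\<close> because \<open>5\<^sup>N\<close> times \<open>125\<^sup>-\<^sup>N\<close> remains.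
This balance of loss and gain produces the exponent \<open>1/2\<close>, see \<open>balance_powers\<close>.\<close>

lemma square_to_bidisc_bound:
  fixes V :: "complex \<Rightarrow> complex \<Rightarrow> complex"
  assumes hs: "\<And>t. (\<lambda>s. V s t) holomorphic_on UNIV" and ht: "\<And>s. (\<lambda>t. V s t) holomorphic_on UNIV"
    and K: "\<And>s t. cmod s \<le> 625 \<Longrightarrow> cmod t \<le> 625 \<Longrightarrow> cmod (V s t) \<le> K"
    and cont: "continuous_on UNIV (\<lambda>z::real \<times> real. V (of_real (fst z)) (of_real (snd z)))"
    and eps: "(\<integral>\<^sup>+x. \<integral>\<^sup>+y. indicator {-1..1} x * (indicator {-1..1} y * ennreal (cmod (V (of_real x) (of_real y)))) \<partial>lborel \<partial>lborel) \<le> ennreal \<epsilon>"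
    and \<epsilon>: "\<epsilon> \<ge> 0" and s: "cmod s \<le> 2" and t: "cmod t \<le> 2"
  shows "cmod (V s t) \<le> 25 * (25 ^ N * \<epsilon>) + 11 * K / 25 ^ N"
proof -
  have K0: "K \<ge> 0" using order_trans[OF norm_ge_zero K[of 0 0]] by simp
  define J where "J x = (\<integral>\<^sup>+y. indicator {-1..1} y * ennreal (cmod (V (of_real x) (of_real y))) \<partial>lborel)" for x :: real
  have "(\<lambda>z::real \<times> real. V (of_real (fst z)) (of_real (snd z))) \<in> borel_measurable borel"
    using cont by (rule borel_measurable_continuous_onI)
  then have [measurable]: "(\<lambda>z::real \<times> real. V (of_real (fst z)) (of_real (snd z))) \<in> borel_measurable (lborel \<Otimes>\<^sub>M lborel)"
    by (simp add: lborel_prod)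
  then have [measurable]: "J \<in> borel_measurable lborel"
    unfolding J_def by (intro sigma_finite_measure.borel_measurable_nn_integral lborel.sigma_finite_measure_axioms)
      (simp add: case_prod_beta)
  have slice: "continuous_on A (\<lambda>y::real. V x (of_real y))" "continuous_on A (\<lambda>y::real. V (of_real y) x)" for A x
    by (rule continuous_on_compose2[OF holomorphic_on_imp_continuous_on[OF ht]]
          continuous_on_compose2[OF holomorphic_on_imp_continuous_on[OF hs]], intro continuous_intros, simp)+
  have J: "J x = ennreal (integral {-1..1} (\<lambda>y. cmod (V (of_real x) (of_real y))))" for x
    unfolding J_def by (intro nn_integral_continuous_interval continuous_intros slice) simp
  have Jle: "(\<integral>\<^sup>+x. indicator {-1..1} x * J x \<partial>lborel) \<le> ennreal \<epsilon>"
  proof -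
    have "indicator {-1..1} x * J x
      = (\<integral>\<^sup>+y. indicator {-1..1} x * (indicator {-1..1} y * ennreal (cmod (V (of_real x) (of_real y)))) \<partial>lborel)" for x
      by (cases "x \<in> {-1..1}") (auto simp: J_def)
    then show ?thesis using eps by simp
  qed
  have "ennreal (integral {-1..1} (\<lambda>x. cmod (V (of_real x) t)))
     = (\<integral>\<^sup>+x. indicator {-1..1} x * ennreal (cmod (V (of_real x) t)) \<partial>lborel)"
    by (intro nn_integral_continuous_interval[symmetric] continuous_intros slice) simp
  also have "\<dots> \<le> (\<integral>\<^sup>+x. ennreal (5 ^ Suc N) * (indicator {-1..1} x * J x) + ennreal (K / 125 ^ N) * indicator {-1..1} x \<partial>lborel)"
  proof (intro nn_integral_mono)
    fix x :: real
    show "indicator {-1..1} x * ennreal (cmod (V (of_real x) t))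
      \<le> ennreal (5 ^ Suc N) * (indicator {-1..1} x * J x) + ennreal (K / 125 ^ N) * indicator {-1..1} x"
    proof (cases "x \<in> {-1..1}")
      case True
      have I0: "0 \<le> integral {-1..1} (\<lambda>y. cmod (V (of_real x) (of_real y)))"
        by (intro integral_nonneg integrable_continuous_interval continuous_intros slice) auto
      have "cmod (V (of_real x) t) \<le> 5 ^ Suc N * integral {-1..1} (\<lambda>y. cmod (V (of_real x) (of_real y))) + K / 125 ^ N"
        by (rule interval_to_disc_bound[OF ht _ t]) (rule K, use True in auto)
      then show ?thesis using True K0 I0 unfolding J
        by (simp add: ennreal_mult[symmetric] ennreal_plus[symmetric] del: ennreal_plus power_Suc)
    qed simp
  qed
  also have "\<dots> = ennreal (5 ^ Suc N) * (\<integral>\<^sup>+x. indicator {-1..1} x * J x \<partial>lborel) + ennreal (K / 125 ^ N) * 2"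
    by (subst nn_integral_add) (auto simp: nn_integral_cmult)
  also have "\<dots> \<le> ennreal (5 ^ Suc N) * ennreal \<epsilon> + ennreal (K / 125 ^ N) * 2"
    by (intro add_mono mult_left_mono Jle) auto
  also have "\<dots> = ennreal (5 ^ Suc N * \<epsilon> + K / 125 ^ N * 2)"
  proof -
    have "ennreal (K / 125 ^ N) * 2 = ennreal (K / 125 ^ N * 2)"
      using K0 ennreal_mult[of "K / 125 ^ N" 2] by simp
    moreover have "ennreal (5 ^ Suc N) * ennreal \<epsilon> = ennreal (5 ^ Suc N * \<epsilon>)"
      using \<epsilon> by (intro ennreal_mult[symmetric]) auto
    ultimately show ?thesis using K0 \<epsilon> by (simp only:) (intro ennreal_plus[symmetric], auto)
  qed
  finally have E: "integral {-1..1} (\<lambda>x. cmod (V (of_real x) t)) \<le> 5 ^ Suc N * \<epsilon> + K / 125 ^ N * 2"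
    using K0 \<epsilon> by (subst (asm) ennreal_le_iff) auto
  have "cmod (V s t) \<le> 5 ^ Suc N * integral {-1..1} (\<lambda>x. cmod (V (of_real x) t)) + K / 125 ^ N"
    by (rule interval_to_disc_bound[OF hs _ s]) (rule K, use t in auto)
  also have "\<dots> \<le> 5 ^ Suc N * (5 ^ Suc N * \<epsilon> + K / 125 ^ N * 2) + K / 125 ^ N"
    using E by (intro add_right_mono mult_left_mono) auto
  also have "\<dots> = 25 * (25 ^ N * \<epsilon>) + 10 * (K * (5 ^ N / 125 ^ N)) + K / 125 ^ N"
    by (simp add: algebra_simps flip: power_mult_distrib)
  also have "(5::real) ^ N / 125 ^ N = 1 / 25 ^ N" by (simp flip: power_divide) (simp add: power_divide)
  also have "K / 125 ^ N \<le> K / 25 ^ N" using K0 by (intro divide_left_mono power_mono) auto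
  finally show ?thesis by simp
qed

text \<open>A rotation followed by halving has Jacobian \<open>1/4\<close>. If \<open>c \<noteq> 0\<close>, the map is a composition of
two one-dimensional affine substitutions, first in \<open>x\<close> with slope \<open>c/2\<close>, then in \<open>y\<close> with slope \<open>1/(2c)\<close>.\<close>

lemma nn_integral_rotation:
  fixes \<phi> :: "real \<times> real \<Rightarrow> ennreal"
  assumes [measurable]: "\<phi> \<in> borel_measurable borel" and cd: "c\<^sup>2 + d\<^sup>2 = 1"
  shows "(\<integral>\<^sup>+x. \<integral>\<^sup>+y. \<phi> (a + (x * c - y * d) / 2, b + (x * d + y * c) / 2) \<partial>lborel \<partial>lborel) = 4 * (\<integral>\<^sup>+z. \<phi> z \<partial>lborel)"
proof -
  have [measurable]: "\<phi> \<in> borel_measurable (borel \<Otimes>\<^sub>M borel)"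
    using assms(1) by (simp add: borel_prod)
  have total: "(\<integral>\<^sup>+z. \<phi> z \<partial>lborel) = (\<integral>\<^sup>+x. \<integral>\<^sup>+y. \<phi> (x, y) \<partial>lborel \<partial>lborel)"
    using lborel.nn_integral_fst[of \<phi> lborel] by (simp add: lborel_prod)
  have swap: "(\<integral>\<^sup>+x. \<integral>\<^sup>+y. h x y \<partial>lborel \<partial>lborel) = (\<integral>\<^sup>+y. \<integral>\<^sup>+x. h x y \<partial>lborel \<partial>lborel)"
    if [measurable]: "(\<lambda>(x, y). h x y) \<in> borel_measurable (borel \<Otimes>\<^sub>M borel)" for h :: "real \<Rightarrow> real \<Rightarrow> ennreal"
    by (rule lborel_pair.Fubini'[symmetric]) simp
  have aff: "(\<integral>\<^sup>+x. f (k + m * x) \<partial>lborel) = ennreal (1 / \<bar>m\<bar>) * (\<integral>\<^sup>+x. f x \<partial>lborel)"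
    if "m \<noteq> 0" and [measurable]: "f \<in> borel_measurable borel" for f :: "real \<Rightarrow> ennreal" and k m
    unfolding nn_integral_real_affine[OF that(2,1), of k] mult.assoc[symmetric]
    using that(1) by (simp add: ennreal_mult[symmetric] field_simps)
  show ?thesis
  proof (cases "c = 0")
    case True
    then have d: "\<bar>d\<bar> = 1" "d \<noteq> 0" using cd by (auto simp: power2_eq_1_iff)
    have 4: "ennreal 2 * ennreal 2 = 4" by (simp add: ennreal_mult[symmetric])
    have "(\<integral>\<^sup>+x. \<integral>\<^sup>+y. \<phi> (a + (x * c - y * d) / 2, b + (x * d + y * c) / 2) \<partial>lborel \<partial>lborel)
      = (\<integral>\<^sup>+x. \<integral>\<^sup>+y. \<phi> (a + (- d / 2) * y, b + (d / 2) * x) \<partial>lborel \<partial>lborel)"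
      by (simp add: True mult.commute)
    also have "\<dots> = (\<integral>\<^sup>+x. ennreal 2 * (\<integral>\<^sup>+y. \<phi> (y, b + (d / 2) * x) \<partial>lborel) \<partial>lborel)"
      by (subst aff[where f = "\<lambda>y. \<phi> (y, b + (d / 2) * x)" for x]) (use d in auto)
    also have "\<dots> = ennreal 2 * (\<integral>\<^sup>+y. \<integral>\<^sup>+x. \<phi> (y, b + (d / 2) * x) \<partial>lborel \<partial>lborel)"
    proof -
      have "(\<integral>\<^sup>+x. \<integral>\<^sup>+y. \<phi> (y, b + (d / 2) * x) \<partial>lborel \<partial>lborel) = (\<integral>\<^sup>+y. \<integral>\<^sup>+x. \<phi> (y, b + (d / 2) * x) \<partial>lborel \<partial>lborel)"
        by (rule swap) measurable
      then show ?thesis by (subst nn_integral_cmult) simp_all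
    qed
    also have "\<dots> = ennreal 2 * (\<integral>\<^sup>+y. ennreal 2 * (\<integral>\<^sup>+x. \<phi> (y, x) \<partial>lborel) \<partial>lborel)"
      by (subst aff[where f = "\<lambda>x. \<phi> (y, x)" for y]) (use d in auto)
    also have "\<dots> = 4 * (\<integral>\<^sup>+z. \<phi> z \<partial>lborel)"
      by (subst nn_integral_cmult) (auto simp: total 4 mult.assoc[symmetric])
    finally show ?thesis .
  next
    case False
    define f where "f y x = \<phi> (x, b + y * c / 2 + (d / c) * (x - (a - y * d / 2)))" for x y
    have [measurable]: "(\<lambda>(x, y). f x y) \<in> borel_measurable (borel \<Otimes>\<^sub>M borel)" unfolding f_def by measurable
    have f1: "\<phi> (a + (x * c - y * d) / 2, b + (x * d + y * c) / 2) = f y ((a - y * d / 2) + (c / 2) * x)" for x y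
      unfolding f_def using False by (intro arg_cong[where f = \<phi>]) (simp add: field_simps)
    have f2: "f y x = \<phi> (x, (b + (d / c) * (x - a)) + (1 / (2 * c)) * y)" for x y
    proof -
      have "y * c / 2 + d / c * (y * d / 2) = (c\<^sup>2 + d\<^sup>2) / (2 * c) * y"
        using False by (simp add: field_simps power2_eq_square)
      then show ?thesis unfolding f_def cd by (intro arg_cong[where f = \<phi>]) (simp add: algebra_simps diff_divide_distrib)
    qed
    have "(\<integral>\<^sup>+x. \<integral>\<^sup>+y. \<phi> (a + (x * c - y * d) / 2, b + (x * d + y * c) / 2) \<partial>lborel \<partial>lborel)
       = (\<integral>\<^sup>+y. \<integral>\<^sup>+x. f y ((a - y * d / 2) + (c / 2) * x) \<partial>lborel \<partial>lborel)"
      unfolding f1 by (rule swap) measurable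
    also have "\<dots> = (\<integral>\<^sup>+y. ennreal (1 / \<bar>c / 2\<bar>) * (\<integral>\<^sup>+x. f y x \<partial>lborel) \<partial>lborel)"
      by (subst aff) (use False in auto)
    also have "\<dots> = ennreal (1 / \<bar>c / 2\<bar>) * (\<integral>\<^sup>+x. \<integral>\<^sup>+y. f y x \<partial>lborel \<partial>lborel)"
    proof -
      have "(\<integral>\<^sup>+y. \<integral>\<^sup>+x. f y x \<partial>lborel \<partial>lborel) = (\<integral>\<^sup>+x. \<integral>\<^sup>+y. f y x \<partial>lborel \<partial>lborel)"
        by (rule swap) measurable
      then show ?thesis by (subst nn_integral_cmult) simp_all
    qed
    also have "(\<integral>\<^sup>+x. \<integral>\<^sup>+y. f y x \<partial>lborel \<partial>lborel) = (\<integral>\<^sup>+x. ennreal (1 / \<bar>1 / (2 * c)\<bar>) * (\<integral>\<^sup>+y. \<phi> (x, y) \<partial>lborel) \<partial>lborel)"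
      unfolding f2 by (subst aff[where f = "\<lambda>y. \<phi> (x, y)" for x]) (use False in auto)
    also have "\<dots> = ennreal (1 / \<bar>1 / (2 * c)\<bar>) * (\<integral>\<^sup>+z. \<phi> z \<partial>lborel)"
      by (subst nn_integral_cmult) (auto simp: total)
    also have "ennreal (1 / \<bar>c / 2\<bar>) * \<dots> = ennreal ((1 / \<bar>c / 2\<bar>) * (1 / \<bar>1 / (2 * c)\<bar>)) * (\<integral>\<^sup>+z. \<phi> z \<partial>lborel)"
      by (subst ennreal_mult) (auto simp: mult.assoc)
    also have "(1 / \<bar>c / 2\<bar>) * (1 / \<bar>1 / (2 * c)\<bar>) = 4" using False by (simp add: abs_mult)
    finally show ?thesis by simp
  qed
qed

section \<open>The Gabor transform as a weighted entire function\<close>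

text \<open>The Bargmann transform, up to normalisation.\<close>

definition gabor_entire :: "(real \<Rightarrow> complex) \<Rightarrow> complex \<Rightarrow> complex" where
  "gabor_entire f z = (LINT t|lebesgue. f t * of_real (exp (- pi * t\<^sup>2)) * exp (2 * of_real pi * of_real t * z))"

text \<open>The window \<open>exp (- \<pi> t\<^sup>2)\<close> is a normal density, namely the one with variance \<open>1/(2 \<pi>)\<close>.\<close>

lemma gaussian_density: "normal_density x (sqrt (1 / (2 * pi))) t = exp (- pi * (t - x)\<^sup>2)"
  by (simp add: normal_density_def real_sqrt_divide field_simps)

lemma gaussian_integrable: "integrable lebesgue (\<lambda>t. exp (- pi * (t - x)\<^sup>2))"
  and gaussian_integral: "(LINT t|lebesgue. exp (- pi * (t - x)\<^sup>2)) = 1"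
proof -
  have "integrable lborel (\<lambda>t. exp (- pi * (t - x)\<^sup>2))"
    using integrable_normal_density[of "sqrt (1 / (2 * pi))" x] by (simp add: gaussian_density[abs_def])
  then show "integrable lebesgue (\<lambda>t. exp (- pi * (t - x)\<^sup>2))"
    by (simp add: integrable_completion)
  show "(LINT t|lebesgue. exp (- pi * (t - x)\<^sup>2)) = 1"
    using integral_normal_density[of "sqrt (1 / (2 * pi))" x]
    by (subst integral_completion) (simp_all add: gaussian_density[abs_def])
qed

text \<open>The common majorant for all the integrals below: \<open>a e \<le> a\<^sup>2 + e\<^sup>2\<close>, and completing the square shows that the square
of the weight is again at most a multiple of a Gaussian.\<close>

lemma square_integrable_weighted:
  assumes f: "square_integrable f" and r: "r \<ge> 0"
  shows "integrable lebesgue (\<lambda>t. cmod (f t) * exp (- pi * t\<^sup>2) * exp (2 * pi * \<bar>t\<bar> * r))"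
proof (rule Bochner_Integration.integrable_bound)
  have fm: "f \<in> borel_measurable lebesgue" and fi: "integrable lebesgue (\<lambda>t. (cmod (f t))\<^sup>2)"
    using f by (auto simp: square_integrable_def)
  show "integrable lebesgue (\<lambda>t. (cmod (f t))\<^sup>2 + exp (4 * pi * r\<^sup>2) * exp (- pi * (t - 0)\<^sup>2))"
    by (intro Bochner_Integration.integrable_add fi integrable_mult_right gaussian_integrable)
  have m: "(\<lambda>t::real. exp (- pi * t\<^sup>2) * exp (2 * pi * \<bar>t\<bar> * r)) \<in> borel_measurable lebesgue"
    by (intro measurable_completion) simp
  have "(\<lambda>t. cmod (f t) * (exp (- pi * t\<^sup>2) * exp (2 * pi * \<bar>t\<bar> * r))) \<in> borel_measurable lebesgue"
    by (rule borel_measurable_times[OF measurable_compose[OF fm borel_measurable_norm] m])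
  then show "(\<lambda>t. cmod (f t) * exp (- pi * t\<^sup>2) * exp (2 * pi * \<bar>t\<bar> * r)) \<in> borel_measurable lebesgue"
    by (simp add: mult.assoc)
  show "AE t in lebesgue. norm (cmod (f t) * exp (- pi * t\<^sup>2) * exp (2 * pi * \<bar>t\<bar> * r))
     \<le> norm ((cmod (f t))\<^sup>2 + exp (4 * pi * r\<^sup>2) * exp (- pi * (t - 0)\<^sup>2))"
  proof (intro AE_I2)
    fix t :: real
    let ?e = "exp (- pi * t\<^sup>2) * exp (2 * pi * \<bar>t\<bar> * r)"
    have "0 \<le> pi * (\<bar>t\<bar> - 2 * r)\<^sup>2" by simp
    then have "2 * (- pi * t\<^sup>2 + 2 * pi * \<bar>t\<bar> * r) \<le> 4 * pi * r\<^sup>2 - pi * t\<^sup>2"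
      by (simp add: power2_diff algebra_simps)
    then have "exp (2 * (- pi * t\<^sup>2 + 2 * pi * \<bar>t\<bar> * r)) \<le> exp (4 * pi * r\<^sup>2 + - pi * t\<^sup>2)" by simp
    then have e2: "?e\<^sup>2 \<le> exp (4 * pi * r\<^sup>2) * exp (- pi * t\<^sup>2)"
      by (simp only: mult_exp_exp exp_double[symmetric])
    have "cmod (f t) * ?e \<le> (cmod (f t))\<^sup>2 + ?e\<^sup>2"
      using sum_squares_bound[of "cmod (f t)" ?e] zero_le_power2[of "cmod (f t)"] zero_le_power2[of ?e]
      by linarith
    then show "norm (cmod (f t) * exp (- pi * t\<^sup>2) * exp (2 * pi * \<bar>t\<bar> * r))
       \<le> norm ((cmod (f t))\<^sup>2 + exp (4 * pi * r\<^sup>2) * exp (- pi * (t - 0)\<^sup>2))"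
      using e2 by (simp add: mult.assoc)
  qed
qed

text \<open>Expanding \<open>exp (2 \<pi> t z)\<close> and integrating term by term gives a power series with infinite radius of convergence.\<close>

lemma gabor_entire_holomorphic:
  assumes f: "square_integrable f"
  shows "gabor_entire f holomorphic_on UNIV"
proof -
  have fm: "f \<in> borel_measurable lebesgue" using f by (auto simp: square_integrable_def)
  let ?T = "\<lambda>n z t. f t * of_real (exp (- pi * t\<^sup>2)) * ((2 * of_real pi * of_real t * z) ^ n /\<^sub>R fact n)"
  define a where "a n = (LINT t|lebesgue. ?T n 1 t)" for n
  have sums: "(\<lambda>n. a n * (z - 0) ^ n) sums gabor_entire f z" for z
  proof -
    let ?b = "\<lambda>t. cmod (f t) * exp (- pi * t\<^sup>2) * exp (2 * pi * \<bar>t\<bar> * cmod z)"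
    have bi: "integrable lebesgue ?b" by (rule square_integrable_weighted[OF f]) simp
    have nT: "norm (?T n z t) = cmod (f t) * exp (- pi * t\<^sup>2) * ((2 * pi * \<bar>t\<bar> * cmod z) ^ n / fact n)" for n t
      by (simp add: norm_mult norm_power divide_inverse mult_ac)
    have expS: "(\<lambda>n. (2 * pi * \<bar>t\<bar> * cmod z) ^ n / fact n) sums exp (2 * pi * \<bar>t\<bar> * cmod z)" for t
      using exp_converges[of "2 * pi * \<bar>t\<bar> * cmod z"] by (simp add: divide_inverse mult.commute)
    have part: "(\<Sum>i<n. norm (?T i z t)) \<le> ?b t" for n t
    proof -
      have "(\<Sum>i<n. (2 * pi * \<bar>t\<bar> * cmod z) ^ i / fact i) \<le> exp (2 * pi * \<bar>t\<bar> * cmod z)"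
        using sum_le_suminf[OF sums_summable[OF expS], of "{..<n}"] sums_unique[OF expS] by simp
      then show ?thesis unfolding nT sum_distrib_left[symmetric] by (intro mult_left_mono) auto
    qed
    have m: "?T n z \<in> borel_measurable lebesgue" for n
    proof -
      have "(\<lambda>t. of_real (exp (- pi * t\<^sup>2)) * ((2 * of_real pi * of_real t * z) ^ n /\<^sub>R fact n)) \<in> borel_measurable lebesgue"
        by (intro measurable_completion) (simp add: borel_measurable_continuous_onI continuous_intros)
      then have "(\<lambda>t. f t * (of_real (exp (- pi * t\<^sup>2)) * ((2 * of_real pi * of_real t * z) ^ n /\<^sub>R fact n))) \<in> borel_measurable lebesgue"
        by (rule borel_measurable_times[OF fm])
      then show ?thesis by (simp only: mult.assoc)
    qed
    have Ti: "integrable lebesgue (?T n z)" for n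
    proof (rule Bochner_Integration.integrable_bound[OF bi m], intro AE_I2)
      fix t
      have "norm (?T n z t) \<le> (\<Sum>i<Suc n. norm (?T i z t))"
        using sum_nonneg[of "{..<n}" "\<lambda>i. norm (?T i z t)"] by simp
      also have "\<dots> \<le> ?b t" by (rule part)
      finally show "norm (?T n z t) \<le> norm (?b t)" by simp
    qed
    have "(\<lambda>n. LINT t|lebesgue. ?T n z t) sums (LINT t|lebesgue. (\<Sum>n. ?T n z t))"
    proof (rule sums_integral[OF Ti])
      show "AE t in lebesgue. summable (\<lambda>n. norm (?T n z t))"
        unfolding nT by (intro AE_I2 summable_mult sums_summable[OF expS])
      show "summable (\<lambda>n. LINT t|lebesgue. norm (?T n z t))"
      proof (rule summableI_nonneg_bounded)
        fix n
        have "(\<Sum>i<n. LINT t|lebesgue. norm (?T i z t)) = (LINT t|lebesgue. (\<Sum>i<n. norm (?T i z t)))"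
          by (rule Bochner_Integration.integral_sum[symmetric]) (rule integrable_norm[OF Ti])
        also have "\<dots> \<le> (LINT t|lebesgue. ?b t)"
          by (intro integral_mono Bochner_Integration.integrable_sum integrable_norm Ti bi part)
        finally show "(\<Sum>i<n. LINT t|lebesgue. norm (?T i z t)) \<le> (LINT t|lebesgue. ?b t)" .
      qed auto
    qed
    also have "(LINT t|lebesgue. (\<Sum>n. ?T n z t)) = gabor_entire f z"
      unfolding gabor_entire_def
    proof (intro Bochner_Integration.integral_cong refl)
      fix t
      have "(\<lambda>n. ?T n z t) sums (f t * of_real (exp (- pi * t\<^sup>2)) * exp (2 * of_real pi * of_real t * z))"
        by (intro sums_mult exp_converges)
      then show "(\<Sum>n. ?T n z t) = f t * of_real (exp (- pi * t\<^sup>2)) * exp (2 * of_real pi * of_real t * z)"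
        by (rule sums_unique[symmetric])
    qed
    also have "(\<lambda>n. LINT t|lebesgue. ?T n z t) = (\<lambda>n. a n * (z - 0) ^ n)"
    proof
      fix n
      have "(LINT t|lebesgue. ?T n z t) = (LINT t|lebesgue. ?T n 1 t * z ^ n)"
        by (simp add: power_mult_distrib mult_ac scaleR_conv_of_real)
      then show "(LINT t|lebesgue. ?T n z t) = a n * (z - 0) ^ n" by (simp add: a_def)
    qed
    finally show ?thesis .
  qed
  have "gabor_entire f holomorphic_on ball 0 (cmod z + 1)" for z
    by (rule power_series_holomorphic[OF sums])
  then show ?thesis
    by (auto simp: holomorphic_on_def intro!: exI elim!: allE dest: bspec)
      (metis (no_types, lifting) at_within_open centre_in_ball dist_0_norm field_differentiable_at_within less_add_one mem_ball open_ball)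
qed

lemma gabor_eq_entire:
  "gabor f (x, y) = of_real (exp (- pi * x\<^sup>2)) * gabor_entire f (Complex x (- y))"
proof -
  have "f t * of_real (exp (- pi * (t - x)\<^sup>2)) * exp (- 2 * of_real pi * \<i> * of_real t * of_real y)
     = of_real (exp (- pi * x\<^sup>2)) * (f t * of_real (exp (- pi * t\<^sup>2)) * exp (2 * of_real pi * of_real t * Complex x (- y)))" for t
  proof -
    have "exp (complex_of_real (- pi * (t - x)\<^sup>2)) * exp (- 2 * of_real pi * \<i> * of_real t * of_real y)
      = exp (complex_of_real (- pi * x\<^sup>2)) * exp (complex_of_real (- pi * t\<^sup>2)) * exp (2 * of_real pi * of_real t * Complex x (- y))"
      unfolding exp_add[symmetric]
      by (rule arg_cong[where f = exp]) (simp add: Complex_eq power2_diff algebra_simps)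
    from arg_cong[OF this[unfolded exp_of_real], of "\<lambda>c. f t * c"] show ?thesis by (simp only: mult_ac)
  qed
  note eq = this
  show ?thesis unfolding gabor_def prod.case eq gabor_entire_def by (rule integral_mult_right_zero)
qed

lemma continuous_on_gabor:
  assumes "square_integrable f" shows "continuous_on A (gabor f)"
proof -
  have "continuous_on UNIV (gabor_entire f)"
    by (rule holomorphic_on_imp_continuous_on[OF gabor_entire_holomorphic[OF assms]])
  then have "continuous_on A (\<lambda>z. of_real (exp (- pi * (fst z)\<^sup>2)) * gabor_entire f (Complex (fst z) (- snd z)))"
    by (intro continuous_intros continuous_on_compose2[where f = "\<lambda>z. Complex (fst z) (- snd z)"]) auto
  moreover have "gabor f = (\<lambda>z. of_real (exp (- pi * (fst z)\<^sup>2)) * gabor_entire f (Complex (fst z) (- snd z)))"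
    by (rule ext) (metis gabor_eq_entire prod.collapse)
  ultimately show ?thesis by simp
qed

lemma gabor_bounded:
  assumes f: "square_integrable f" obtains B where "\<And>z. cmod (gabor f z) \<le> B"
proof
  fix z :: "real \<times> real"
  obtain x y where z: "z = (x, y)" by force
  have fi: "integrable lebesgue (\<lambda>t. (cmod (f t))\<^sup>2)" using f by (auto simp: square_integrable_def)
  let ?b = "\<lambda>t. (cmod (f t))\<^sup>2 + exp (- pi * (t - x)\<^sup>2)"
  let ?g = "\<lambda>t. f t * of_real (exp (- pi * (t - x)\<^sup>2)) * exp (- 2 * of_real pi * \<i> * of_real t * of_real y)"
  have "cmod (gabor f z) \<le> (LINT t|lebesgue. norm (?g t))"
    unfolding gabor_def z prod.case by (rule integral_norm_bound)
  also have "\<dots> \<le> (LINT t|lebesgue. ?b t)"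
  proof (rule integral_mono')
    show "integrable lebesgue ?b" using fi gaussian_integrable by (rule Bochner_Integration.integrable_add)
    fix t :: real
    let ?e = "exp (- pi * (t - x)\<^sup>2)"
    have "norm (?g t) = cmod (f t) * ?e"
      by (simp add: norm_mult)
    also have "\<dots> \<le> (cmod (f t))\<^sup>2 + ?e\<^sup>2"
      using sum_squares_bound[of "cmod (f t)" ?e] zero_le_power2[of "cmod (f t)"] zero_le_power2[of ?e]
      by linarith
    also have "?e\<^sup>2 \<le> ?e" by (simp add: power2_eq_square mult_le_cancel_left1)
    finally show "norm (?g t) \<le> ?b t" by simp
    show "0 \<le> ?b t" by simp
  qed
  also have "\<dots> = (LINT t|lebesgue. (cmod (f t))\<^sup>2) + 1"
    using fi gaussian_integrable[of x] gaussian_integral[of x] by simp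
  finally show "cmod (gabor f z) \<le> (LINT t|lebesgue. (cmod (f t))\<^sup>2) + 1" .
qed

lemma AE_le_Linf_norm:
  fixes F :: "real \<times> real \<Rightarrow> 'b::real_normed_vector"
  assumes m: "F \<in> borel_measurable lebesgue" and B: "\<And>z. norm (F z) \<le> B"
  shows "AE z in lebesgue. norm (F z) \<le> Linf_norm F"
proof -
  let ?e = "esssup lebesgue (\<lambda>z. ereal (norm (F z)))"
  have AE: "AE z in lebesgue. ereal (norm (F z)) \<le> ?e" by (rule esssup_AE)
  have "?e \<le> ereal B" using m B by (intro esssup_I AE_I2) auto
  then have 1: "?e \<noteq> \<infinity>" by auto
  have 2: "?e \<noteq> -\<infinity>"
  proof
    assume "?e = -\<infinity>"
    with AE have "AE z in lebesgue. (\<lambda>_::real \<times> real. False) z" by simp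
    then have "emeasure lebesgue (UNIV :: (real \<times> real) set) = 0"
      by (simp add: AE_iff_measurable[OF _ refl])
    then show False by simp
  qed
  from 1 2 have "?e = ereal (Linf_norm F)" unfolding Linf_norm_def by (cases ?e) auto
  with AE show ?thesis by simp
qed

text \<open>For a continuous function the essential supremum bounds every value, as a nonempty open set is not a null set.
Pointwise bounds are needed because the entire extension is estimated at individual points.\<close>

lemma le_Linf_norm:
  fixes F :: "real \<times> real \<Rightarrow> 'b::real_normed_vector"
  assumes c: "continuous_on UNIV F" and B: "\<And>z. norm (F z) \<le> B"
  shows "norm (F z) \<le> Linf_norm F"
proof (rule ccontr)
  assume "\<not> ?thesis"
  then have ne: "{z. norm (F z) > Linf_norm F} \<noteq> {}" unfolding not_le by blast
  have op: "open {z. norm (F z) > Linf_norm F}"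
    using c by (intro open_Collect_less continuous_intros) auto
  have "F \<in> borel_measurable lebesgue"
    using c by (intro measurable_completion) (simp add: borel_measurable_continuous_onI)
  from AE_le_Linf_norm[OF this B]
  have "{z. norm (F z) > Linf_norm F} \<in> null_sets lebesgue"
    using op by (simp add: AE_iff_null_sets not_less sets_completionI_sets)
  then show False using open_not_negligible[OF op ne] by (simp add: negligible_iff_null_sets)
qed

section \<open>Polarisation of the spectrogram\<close>

text \<open>The extension of \<open>spectrogram f - spectrogram g\<close> to complex arguments: on the diagonal \<open>W = x - i y\<close>, \<open>W' = x + i y\<close> the
exponential is \<open>exp (- 2 \<pi> x\<^sup>2)\<close>, and for independent \<open>W\<close> and \<open>W'\<close> all factors remain holomorphic.\<close>

definition polarized :: "(real \<Rightarrow> complex) \<Rightarrow> (real \<Rightarrow> complex) \<Rightarrow> complex \<Rightarrow> complex \<Rightarrow> complex" where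
  "polarized f g W W' = exp (- of_real (pi / 2) * (W + W')\<^sup>2) *
     (gabor_entire f W * cnj (gabor_entire f (cnj W')) - gabor_entire g W * cnj (gabor_entire g (cnj W')))"

lemma gabor_entire_eq:
  "gabor_entire f W = of_real (exp (pi * (Re W)\<^sup>2)) * gabor f (Re W, - Im W)"
  by (simp add: gabor_eq_entire flip: of_real_mult exp_add mult.assoc)

text \<open>The key identity. The weights of the two Gabor transforms combine with the exponential to a factor that depends only on the
distance from the diagonal. It is at least 1, so the extension dominates the
polarised difference, and it is bounded on bounded sets, so the extension is bounded by the suprema of the spectrograms.\<close>

lemma norm_polarized:
  "cmod (polarized f g W W') = exp (pi / 2 * (cmod (W - cnj W'))\<^sup>2) *
     cmod (gabor f (Re W, - Im W) * cnj (gabor f (Re W', Im W')) - gabor g (Re W, - Im W) * cnj (gabor g (Re W', Im W')))"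
    (is "_ = _ * cmod ?H")
proof -
  have "polarized f g W W' = exp (- of_real (pi / 2) * (W + W')\<^sup>2) *
      (of_real (exp (pi * (Re W)\<^sup>2) * exp (pi * (Re W')\<^sup>2)) * ?H)"
    by (simp add: polarized_def gabor_entire_eq algebra_simps)
  then have "cmod (polarized f g W W') = exp (Re (- of_real (pi / 2) * (W + W')\<^sup>2)) *
      (exp (pi * (Re W)\<^sup>2) * exp (pi * (Re W')\<^sup>2)) * cmod ?H"
    by (simp only: norm_mult norm_exp_eq_Re norm_of_real abs_mult abs_exp_cancel mult.assoc)
  also have "exp (Re (- of_real (pi / 2) * (W + W')\<^sup>2)) * (exp (pi * (Re W)\<^sup>2) * exp (pi * (Re W')\<^sup>2))
     = exp (pi / 2 * (cmod (W - cnj W'))\<^sup>2)"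
    unfolding mult_exp_exp cmod_power2
    by (rule arg_cong[where f = exp]) (simp add: power2_eq_square field_simps)
  finally show ?thesis .
qed

lemma polarized_holomorphic:
  assumes f: "square_integrable f" and g: "square_integrable g"
    and "p holomorphic_on UNIV" "p' holomorphic_on UNIV"
  shows "(\<lambda>s. polarized f g (p s) (p' s)) holomorphic_on UNIV"
proof -
  have 1: "(\<lambda>s. gabor_entire h (p s)) holomorphic_on UNIV" if "square_integrable h" for h
    using holomorphic_on_compose_gen[OF assms(3) gabor_entire_holomorphic[OF that]] by (simp add: o_def)
  have 2: "(\<lambda>s. cnj (gabor_entire h (cnj (p' s)))) holomorphic_on UNIV" if "square_integrable h" for h
  proof -
    have "(cnj \<circ> gabor_entire h \<circ> cnj) holomorphic_on UNIV"
      by (rule holomorphic_on_compose_cnj_cnj) (auto intro: holomorphic_on_subset[OF gabor_entire_holomorphic[OF that]])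
    from holomorphic_on_compose_gen[OF assms(4) this] show ?thesis by (simp add: o_def)
  qed
  show ?thesis unfolding polarized_def
    by (intro holomorphic_intros 1 2 f g assms)
qed

text \<open>Maps \<open>[-1, 1]\<^sup>2\<close> onto the unit square with centre \<open>(a, b)\<close> and sides along \<open>(c, d)\<close> and \<open>(- d, c)\<close>, when \<open>c\<^sup>2 + d\<^sup>2 = 1\<close>.\<close>

definition square_chart :: "real \<Rightarrow> real \<Rightarrow> real \<Rightarrow> real \<Rightarrow> real \<Rightarrow> real \<Rightarrow> real \<times> real" where
  "square_chart a b c d x y = (a + (x * c - y * d) / 2, b + (x * d + y * c) / 2)"

text \<open>In the coordinates of the square the diagonal of \<open>polarized\<close> is the set of real \<open>(s, t)\<close>. A pair of points with
coordinates \<open>(s\<^sub>1, t\<^sub>1)\<close> and \<open>(s\<^sub>2, t\<^sub>2)\<close> corresponds to the complex \<open>(s, t)\<close> with \<open>s - i t = s\<^sub>1 - i t\<^sub>1\<close> and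
\<open>s + i t = s\<^sub>2 + i t\<^sub>2\<close>. These lie in the bidisc of radius 2, where the continuation from the real square applies.\<close>

lemma cross_difference_bound:
  fixes a b c d :: real
  assumes f: "square_integrable f" and g: "square_integrable g" and cd: "c\<^sup>2 + d\<^sup>2 = 1"
    and K: "\<And>z. (cmod (gabor f z))\<^sup>2 + (cmod (gabor g z))\<^sup>2 \<le> K"
  defines "T \<equiv> square_chart a b c d"
  assumes eps: "(\<integral>\<^sup>+x. \<integral>\<^sup>+y. indicator {-1..1} x * (indicator {-1..1} y *
        ennreal \<bar>spectrogram f (T x y) - spectrogram g (T x y)\<bar>) \<partial>lborel \<partial>lborel) \<le> ennreal \<epsilon>"
    and \<epsilon>: "\<epsilon> \<ge> 0"
    and st: "s1 \<in> {-1..1}" "t1 \<in> {-1..1}" "s2 \<in> {-1..1}" "t2 \<in> {-1..1}"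
  shows "cmod (gabor f (T s1 t1) * cnj (gabor f (T s2 t2)) - gabor g (T s1 t1) * cnj (gabor g (T s2 t2)))
    \<le> 25 * (25 ^ N * \<epsilon>) + 11 * (exp (pi / 2 * 1250\<^sup>2) * K) / 25 ^ N"
proof -
  define q where "q = Complex a (- b)"
  define \<omega> where "\<omega> = Complex c (- d)"
  define W where "W s t = q + \<omega> * (s - \<i> * t) / 2" for s t
  define W' where "W' s t = cnj q + cnj \<omega> * (s + \<i> * t) / 2" for s t
  define V where "V s t = polarized f g (W s t) (W' s t)" for s t
  define H where "H z z' = gabor f z * cnj (gabor f z') - gabor g z * cnj (gabor g z')" for z z'
  have \<omega>1: "cmod \<omega> = 1" using cd by (simp add: \<omega>_def cmod_def)
  have V: "cmod (V s t) = exp (pi / 2 * (cmod (W s t - cnj (W' s t)))\<^sup>2) *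
     cmod (H (Re (W s t), - Im (W s t)) (Re (W' s t), Im (W' s t)))" for s t
    unfolding V_def H_def by (rule norm_polarized)
  have H: "cmod (H z z') \<le> K" for z z'
  proof -
    have "cmod (H z z') \<le> cmod (gabor f z) * cmod (gabor f z') + cmod (gabor g z) * cmod (gabor g z')"
      unfolding H_def by (rule order_trans[OF norm_triangle_ineq4]) (simp add: norm_mult)
    then show ?thesis
      using sum_squares_bound[of "cmod (gabor f z)" "cmod (gabor f z')"]
        sum_squares_bound[of "cmod (gabor g z)" "cmod (gabor g z')"] K[of z] K[of z']
      by linarith
  qed
  have hs: "(\<lambda>s. V s t) holomorphic_on UNIV" for t
    unfolding V_def W_def W'_def by (intro polarized_holomorphic f g holomorphic_intros) auto
  have ht: "(\<lambda>t. V s t) holomorphic_on UNIV" for s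
    unfolding V_def W_def W'_def by (intro polarized_holomorphic f g holomorphic_intros) auto
  \<comment> \<open>For \<open>|s|, |t| \<le> 625\<close> the distance from the diagonal is at most \<open>625 + 625\<close>.\<close>
  have VK: "cmod (V s t) \<le> exp (pi / 2 * 1250\<^sup>2) * K" if "cmod s \<le> 625" "cmod t \<le> 625" for s t
  proof -
    have "W s t - cnj (W' s t) = \<omega> * ((s - cnj s) + \<i> * (cnj t - t)) / 2"
      by (simp add: W_def W'_def algebra_simps diff_divide_distrib add_divide_distrib)
    then have "cmod (W s t - cnj (W' s t)) = cmod ((s - cnj s) + \<i> * (cnj t - t)) / 2"
      by (simp only: norm_mult norm_divide \<omega>1 norm_numeral mult_1_left)
    also have "cmod ((s - cnj s) + \<i> * (cnj t - t)) \<le> (cmod s + cmod s) + (cmod t + cmod t)"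
      using norm_triangle_ineq4[of s "cnj s"] norm_triangle_ineq4[of "cnj t" t]
        norm_triangle_ineq[of "s - cnj s" "\<i> * (cnj t - t)"] by (simp add: norm_mult)
    finally have "cmod (W s t - cnj (W' s t)) \<le> 1250" using that by simp
    then have "(cmod (W s t - cnj (W' s t)))\<^sup>2 \<le> 1250\<^sup>2" by (intro power_mono) auto
    then show ?thesis unfolding V using H by (intro mult_mono) auto
  qed
  have real: "W (of_real x) (of_real y) = Complex (a + (x * c - y * d) / 2) (- (b + (x * d + y * c) / 2))"
    "W' (of_real x) (of_real y) = Complex (a + (x * c - y * d) / 2) (b + (x * d + y * c) / 2)" for x y
    by (simp_all add: W_def W'_def q_def \<omega>_def complex_eq_iff algebra_simps diff_divide_distrib add_divide_distrib)
  have Vr: "cmod (V (of_real x) (of_real y)) = \<bar>spectrogram f (T x y) - spectrogram g (T x y)\<bar>" for x y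
  proof -
    have "cmod (V (of_real x) (of_real y)) = cmod (H (T x y) (T x y))"
      unfolding V real T_def square_chart_def by (simp only: complex_cnj complex.sel minus_minus diff_self norm_zero power_zero_numeral
          mult_zero_right exp_zero mult_1_left)
    also have "H (T x y) (T x y) = of_real (spectrogram f (T x y) - spectrogram g (T x y))"
      by (simp only: H_def spectrogram_def of_real_diff complex_norm_square)
    finally show ?thesis by (simp only: norm_of_real)
  qed
  have cont: "continuous_on UNIV (\<lambda>z::real \<times> real. V (of_real (fst z)) (of_real (snd z)))"
  proof -
    have c: "continuous_on UNIV (\<lambda>z. gabor_entire h (p z))" if "square_integrable h" "continuous_on UNIV p"
      for h and p :: "real \<times> real \<Rightarrow> complex"
      by (rule continuous_on_compose2[OF holomorphic_on_imp_continuous_on[OF gabor_entire_holomorphic[OF that(1)]] that(2)]) simp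
    show ?thesis
      unfolding V_def polarized_def W_def W'_def by (intro continuous_intros c f g) auto
  qed
  define s where "s = (Complex s1 (- t1) + Complex s2 t2) / 2"
  define t where "t = (Complex s2 t2 - Complex s1 (- t1)) / (2 * \<i>)"
  have n: "cmod (Complex x y) \<le> 2" if "x \<in> {-1..1}" "y \<in> {-1..1}" for x y
    using that cmod_le[of "Complex x y"] by (auto simp: abs_le_iff)
  have n1: "cmod (Complex s1 (- t1)) \<le> 2" and n2: "cmod (Complex s2 t2) \<le> 2" using st by (auto intro!: n)
  have s2: "cmod s \<le> 2"
    using norm_triangle_ineq[of "Complex s1 (- t1)" "Complex s2 t2"] n1 n2 by (simp add: s_def norm_divide)
  have t2: "cmod t \<le> 2"
    using norm_triangle_ineq4[of "Complex s2 t2" "Complex s1 (- t1)"] n1 n2 by (simp add: t_def norm_divide norm_mult)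
  have "s - \<i> * t = Complex s1 (- t1)" "s + \<i> * t = Complex s2 t2"
    by (simp_all add: s_def t_def field_simps)
  then have "(Re (W s t), - Im (W s t)) = T s1 t1" "(Re (W' s t), Im (W' s t)) = T s2 t2"
    by (simp_all add: W_def W'_def q_def \<omega>_def T_def square_chart_def algebra_simps
        diff_divide_distrib add_divide_distrib)
  then have "cmod (H (T s1 t1) (T s2 t2)) \<le> cmod (V s t)"
    unfolding V by (simp add: mult_le_cancel_right1)
  also have "\<dots> \<le> 25 * (25 ^ N * \<epsilon>) + 11 * (exp (pi / 2 * 1250\<^sup>2) * K) / 25 ^ N"
    by (rule square_to_bidisc_bound[OF hs ht VK cont _ \<epsilon> s2 t2]) (simp_all only: Vr eps)
  finally show ?thesis unfolding H_def .
qed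

text \<open>Choosing \<open>N\<close> so that \<open>25\<^sup>N\<close> is about the square root of \<open>K / \<eta>\<close> makes both terms of the order of the
geometric mean of \<open>K\<close> and \<open>\<eta>\<close>.\<close>

lemma balance_powers:
  fixes H \<eta> K \<alpha> :: real
  assumes H: "\<And>N. H \<le> \<alpha> * (25 ^ N * \<eta> + K / 25 ^ N)" and H0: "H \<ge> 0" and \<eta>: "0 \<le> \<eta>" "\<eta> \<le> 2 * K"
  shows "H\<^sup>2 \<le> 630 * \<alpha>\<^sup>2 * (K * \<eta>)"
proof (cases "\<eta> = 0")
  case True
  have "(\<lambda>N. \<alpha> * (K * (1 / 25) ^ N)) \<longlonglongrightarrow> \<alpha> * (K * 0)"
    by (intro tendsto_intros LIMSEQ_power_zero) simp
  moreover have "H \<le> \<alpha> * (K * (1 / 25) ^ N)" for N using H[of N] True by (simp add: power_divide)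
  ultimately have "H \<le> 0" using LIMSEQ_le_const by fastforce
  with H0 True show ?thesis by simp
next
  case False
  then have \<eta>p: "\<eta> > 0" using \<eta> by simp
  obtain n where n: "2 * K / \<eta> < 625 ^ n" using real_arch_pow[of 625 "2 * K / \<eta>"] by auto
  define m where "m = (LEAST n. 2 * K / \<eta> < 625 ^ n)"
  have m: "2 * K / \<eta> < 625 ^ m" unfolding m_def using n by (rule LeastI)
  have "m \<noteq> 0"
  proof
    assume "m = 0"
    then show False using m \<eta> \<eta>p by (simp add: field_simps)
  qed
  then obtain N where N: "m = Suc N" by (cases m) auto
  have "\<not> 2 * K / \<eta> < 625 ^ N" using not_less_Least[of N] N m_def by (metis lessI)
  define P :: real where "P = 25 ^ N"
  have P2: "P\<^sup>2 = 625 ^ N" by (simp add: P_def power2_eq_square flip: power_mult_distrib)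
  have Pp: "P > 0" by (simp add: P_def)
  have 1: "P\<^sup>2 * \<eta> \<le> 2 * K" using \<open>\<not> 2 * K / \<eta> < 625 ^ N\<close> \<eta>p by (simp add: P2 not_less field_simps)
  have 2: "2 * K < 625 * (P\<^sup>2 * \<eta>)" using m \<eta>p by (simp add: P2 N field_simps)
  have K0: "K \<ge> 0" using \<eta> by simp
  have "H\<^sup>2 \<le> (\<alpha> * (P * \<eta> + K / P))\<^sup>2" using H[of N] H0 by (intro power_mono) (auto simp: P_def)
  also have "\<dots> = \<alpha>\<^sup>2 * (P * \<eta> + K / P)\<^sup>2" by (simp add: power_mult_distrib)
  also have "\<dots> \<le> \<alpha>\<^sup>2 * (2 * (P * \<eta>)\<^sup>2 + 2 * (K / P)\<^sup>2)"
    using sum_squares_bound[of "P * \<eta>" "K / P"] by (intro mult_left_mono) (auto simp: power2_sum)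
  also have "\<dots> \<le> \<alpha>\<^sup>2 * (630 * (K * \<eta>))"
  proof (intro mult_left_mono)
    have "(P * \<eta>)\<^sup>2 = (P\<^sup>2 * \<eta>) * \<eta>" by (simp add: power2_eq_square)
    also have "\<dots> \<le> 2 * K * \<eta>" using 1 \<eta> by (intro mult_right_mono)
    finally have a: "(P * \<eta>)\<^sup>2 \<le> 2 * K * \<eta>" .
    have "K / P\<^sup>2 \<le> 625 / 2 * \<eta>" using 2 Pp by (simp add: field_simps)
    then have "K * (K / P\<^sup>2) \<le> K * (625 / 2 * \<eta>)" using K0 by (rule mult_left_mono)
    then have "(K / P)\<^sup>2 \<le> 625 / 2 * (K * \<eta>)" by (simp add: power_divide power2_eq_square)
    with a have "2 * (P * \<eta>)\<^sup>2 + 2 * (K / P)\<^sup>2 \<le> 629 * (K * \<eta>)" by (simp add: algebra_simps)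
    also have "\<dots> \<le> 630 * (K * \<eta>)" using K0 \<eta> by (intro mult_right_mono) auto
    finally show "2 * (P * \<eta>)\<^sup>2 + 2 * (K / P)\<^sup>2 \<le> 630 * (K * \<eta>)" .
  qed simp
  finally show ?thesis by simp
qed

text \<open>Fixing \<open>z' = w\<close>, where \<open>|F|\<close> is largest, the hypothesis says that \<open>G\<close> times \<open>cnj (G w)\<close> is almost \<open>F\<close> times
\<open>cnj (F w)\<close>. The two constants have almost the same modulus, by the hypothesis at \<open>(w, w)\<close>, so their
quotient may be replaced by its phase. If \<open>e > |F w|\<^sup>2\<close>, then \<open>F\<close> and \<open>G\<close> are both of the order of the square root of \<open>e\<close>, and any phase works.\<close>

lemma common_phase:
  fixes F G :: "'a \<Rightarrow> complex"
  assumes H: "\<And>z z'. z \<in> Q \<Longrightarrow> z' \<in> Q \<Longrightarrow> cmod (F z * cnj (F z') - G z * cnj (G z')) \<le> e"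
    and w: "w \<in> Q" and max: "\<And>z. z \<in> Q \<Longrightarrow> cmod (F z) \<le> cmod (F w)"
  obtains \<tau> where "cmod \<tau> = 1" "\<And>z. z \<in> Q \<Longrightarrow> cmod (G z - \<tau> * F z) * cmod (F w) \<le> 3 * e"
proof (cases "F w = 0")
  case True
  have "0 \<le> e" using order_trans[OF norm_ge_zero H[OF w w]] .
  then show thesis using True by (intro that[of 1]) auto
next
  case False
  define m where "m = cmod (F w)"
  have mp: "m > 0" using False by (simp add: m_def)
  have e0: "0 \<le> e" using order_trans[OF norm_ge_zero H[OF w w]] .
  have sq: "\<bar>(cmod (F z))\<^sup>2 - (cmod (G z))\<^sup>2\<bar> \<le> e" if "z \<in> Q" for z
  proof -
    have "F z * cnj (F z) - G z * cnj (G z) = of_real ((cmod (F z))\<^sup>2 - (cmod (G z))\<^sup>2)"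
      by (simp only: of_real_diff complex_norm_square)
    with H[OF that that] show ?thesis by (metis norm_of_real)
  qed
  define \<beta> where "\<beta> = cnj (G w)"
  define u where "u = (if \<beta> = 0 then 1 else cnj (sgn \<beta>))"
  have u1: "cmod u = 1" by (simp add: u_def norm_sgn)
  have ub: "u * \<beta> = of_real (cmod \<beta>)"
    by (auto simp: u_def sgn_eq complex_norm_square[symmetric] power2_eq_square divide_simps mult.commute)
  define \<tau> where "\<tau> = u * cnj (F w) / of_real m"
  have \<tau>1: "cmod \<tau> = 1" using mp u1 by (simp add: \<tau>_def norm_mult norm_divide m_def)
  have mb: "\<bar>m - cmod \<beta>\<bar> * m \<le> e"
  proof -
    have "\<bar>m - cmod \<beta>\<bar> * m \<le> \<bar>m - cmod \<beta>\<bar> * (m + cmod \<beta>)" by (intro mult_left_mono) auto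
    also have "\<dots> = \<bar>m\<^sup>2 - (cmod \<beta>)\<^sup>2\<bar>"
      using mp by (simp add: power2_eq_square square_diff_square_factored abs_mult mult.commute)
    also have "\<dots> \<le> e" using sq[OF w] by (simp add: m_def \<beta>_def)
    finally show ?thesis .
  qed
  have "cmod (G z - \<tau> * F z) * m \<le> 3 * e" if z: "z \<in> Q" for z
  proof (cases "e \<le> m\<^sup>2")
    case True
    have Gz: "cmod (G z) \<le> 2 * m"
    proof -
      have "(cmod (G z))\<^sup>2 \<le> (cmod (F z))\<^sup>2 + e" using sq[OF z] by linarith
      also have "(cmod (F z))\<^sup>2 \<le> m\<^sup>2" unfolding m_def using max[OF z] by (intro power_mono) auto
      finally have "(cmod (G z))\<^sup>2 \<le> 4 * m\<^sup>2" using True zero_le_power2[of m] by linarith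
      then have "(cmod (G z))\<^sup>2 \<le> (2 * m)\<^sup>2" by (simp add: power_mult_distrib)
      then show ?thesis by (rule power2_le_imp_le) (use mp in simp)
    qed
    have "(G z - \<tau> * F z) * of_real m = G z * of_real (m - cmod \<beta>) - u * (F z * cnj (F w) - G z * cnj (G w))"
      using mp ub by (simp add: \<tau>_def \<beta>_def field_simps)
    then have "cmod (G z - \<tau> * F z) * m = cmod (G z * of_real (m - cmod \<beta>) - u * (F z * cnj (F w) - G z * cnj (G w)))"
      using mp by (metis abs_of_pos norm_mult norm_of_real)
    also have "\<dots> \<le> cmod (G z) * \<bar>m - cmod \<beta>\<bar> + cmod (F z * cnj (F w) - G z * cnj (G w))"
      by (rule order_trans[OF norm_triangle_ineq4]) (simp add: norm_mult u1 flip: of_real_diff)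
    also have "\<dots> \<le> 2 * m * \<bar>m - cmod \<beta>\<bar> + e"
      using Gz H[OF z w] by (intro add_mono mult_right_mono) auto
    also have "\<dots> \<le> 3 * e" using mb by (simp add: mult_ac)
    finally show ?thesis .
  next
    case False
    have sm: "m \<le> sqrt e" using False mp by (intro real_le_rsqrt) auto
    have "(cmod (F z))\<^sup>2 \<le> m\<^sup>2" unfolding m_def using max[OF z] by (intro power_mono) auto
    then have Fz: "(cmod (F z))\<^sup>2 \<le> e" using False by linarith
    then have F1: "cmod (F z) \<le> sqrt e" by (rule real_le_rsqrt)
    have "(cmod (G z))\<^sup>2 \<le> (2 * sqrt e)\<^sup>2" using sq[OF z] Fz e0 by (simp add: power_mult_distrib)
    then have G1: "cmod (G z) \<le> 2 * sqrt e" by (rule power2_le_imp_le) (use e0 in simp)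
    have "cmod (G z - \<tau> * F z) \<le> cmod (G z) + cmod (F z)"
      using norm_triangle_ineq4[of "G z" "\<tau> * F z"] by (simp add: norm_mult \<tau>1)
    also have "\<dots> \<le> 3 * sqrt e" using F1 G1 by simp
    finally have "cmod (G z - \<tau> * F z) * m \<le> 3 * sqrt e * sqrt e"
      using sm mp e0 by (intro mult_mono) auto
    also have "\<dots> = 3 * e" using e0 by (simp add: mult.assoc)
    finally show ?thesis .
  qed
  then show thesis using \<tau>1 by (intro that[of \<tau>]) (auto simp: m_def)
qed

section \<open>Cheeger's inequality\<close>

text \<open>A discrete co-area formula: \<open>\<phi>\<close> is a sum of multiples of indicators of its superlevel sets, both sides are additive along this
decomposition, and the isoperimetric inequality applies to each set. The induction peels off the largest
superlevel set, the support; since the support carries at most half of the weight, the minimum in the isoperimetric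
inequality is the weight of the support.\<close>

lemma coarea_cheeger:
  fixes \<sigma> :: "'v \<times> 'v \<Rightarrow> real" and w \<phi> :: "'v \<Rightarrow> real"
  assumes V: "finite V" and w: "\<And>v. v \<in> V \<Longrightarrow> w v > 0"
    and sym: "\<And>u v. u \<in> V \<Longrightarrow> v \<in> V \<Longrightarrow> \<sigma> (u, v) = \<sigma> (v, u)"
    and nn: "\<And>v. v \<in> V \<Longrightarrow> \<phi> v \<ge> 0"
    and iso: "\<And>S. S \<noteq> {} \<Longrightarrow> S \<subset> V \<Longrightarrow> 
        h * min (\<Sum>v\<in>S. w v) (\<Sum>v\<in>V - S. w v) \<le> (\<Sum>u\<in>S. \<Sum>v\<in>V - S. \<sigma> (u, v))"
    and half: "(\<Sum>v\<in>{v\<in>V. \<phi> v > 0}. w v) \<le> (\<Sum>v\<in>{v\<in>V. \<phi> v = 0}. w v)"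
  shows "2 * h * (\<Sum>v\<in>V. w v * \<phi> v) \<le> (\<Sum>u\<in>V. \<Sum>v\<in>V. \<sigma> (u, v) * \<bar>\<phi> u - \<phi> v\<bar>)"
  using nn half
proof (induction "card {v\<in>V. \<phi> v > 0}" arbitrary: \<phi> rule: less_induct)
  case less
  define S where "S = {v\<in>V. \<phi> v > 0}"
  have SV: "S \<subseteq> V" and fS: "finite S" using V by (auto simp: S_def)
  have compl: "{v\<in>V. \<phi> v = 0} = V - S" using less.prems(1) by (force simp: S_def)
  show ?case
  proof (cases "S = {}")
    case True
    then have "\<And>v. v \<in> V \<Longrightarrow> \<phi> v = 0" using less.prems(1) by (force simp: S_def)
    then show ?thesis by simp
  next
    case False
    have "S \<noteq> V"
    proof
      assume "S = V"
      then have "sum w S \<le> 0" using less.prems(2) compl by (simp add: S_def[symmetric])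
      moreover have "sum w S > 0" using fS False w SV by (intro sum_pos) auto
      ultimately show False by simp
    qed
    then have SV': "S \<subset> V" using SV by blast
    define m where "m = Min (\<phi> ` S)"
    have mpos: "m > 0" using fS False by (auto simp: m_def S_def)
    have mle: "m \<le> \<phi> v" if "v \<in> S" for v using that fS by (simp add: m_def)
    have "m \<in> \<phi> ` S" unfolding m_def using fS False by (intro Min_in) auto
    then obtain v0 where v0: "v0 \<in> S" "\<phi> v0 = m" by auto
    define \<psi> where "\<psi> v = (if v \<in> S then \<phi> v - m else \<phi> v)" for v
    have nn': "\<psi> v \<ge> 0" if "v \<in> V" for v using mle less.prems(1)[OF that] by (auto simp: \<psi>_def)
    have out: "\<phi> v = 0" if "v \<in> V" "v \<notin> S" for v using that compl by auto
    have supp: "{v\<in>V. \<psi> v > 0} \<subseteq> S - {v0}" using v0 out by (force simp: \<psi>_def split: if_splits)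
    have "card {v\<in>V. \<psi> v > 0} < card S"
      using supp v0(1) fS by (metis Diff_subset card_Diff1_less card_mono finite_Diff order_le_less_trans)
    moreover have "(\<Sum>v\<in>{v\<in>V. \<psi> v > 0}. w v) \<le> (\<Sum>v\<in>{v\<in>V. \<psi> v = 0}. w v)"
    proof -
      have "(\<Sum>v\<in>{v\<in>V. \<psi> v > 0}. w v) \<le> sum w S"
        using supp fS w SV by (intro sum_mono2) (auto intro: less_imp_le)
      also have "\<dots> \<le> sum w (V - S)" using less.prems(2) compl by (simp add: S_def[symmetric])
      also have "\<dots> \<le> (\<Sum>v\<in>{v\<in>V. \<psi> v = 0}. w v)"
        using V out w by (intro sum_mono2) (auto simp: \<psi>_def intro: less_imp_le)
      finally show ?thesis .
    qed
    ultimately have IH: "2 * h * (\<Sum>v\<in>V. w v * \<psi> v) \<le> (\<Sum>u\<in>V. \<Sum>v\<in>V. \<sigma> (u, v) * \<bar>\<psi> u - \<psi> v\<bar>)"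
      using less.hyps[of \<psi>] nn' by (simp add: S_def[symmetric])
    \<comment> \<open>Subtracting \<open>m\<close> on \<open>S\<close> changes the difference along an edge only if the edge leaves \<open>S\<close>.\<close>
    have split: "\<bar>\<phi> u - \<phi> v\<bar> = \<bar>\<psi> u - \<psi> v\<bar> + m * (if u \<in> S \<and> v \<notin> S then 1 else 0)
        + m * (if v \<in> S \<and> u \<notin> S then 1 else 0)" if "u \<in> V" "v \<in> V" for u v
      using out[OF that(1)] out[OF that(2)] mle[of u] mle[of v] mpos by (auto simp: \<psi>_def)
    let ?cut = "\<Sum>u\<in>S. \<Sum>v\<in>V - S. \<sigma> (u, v)"
    have c1: "(\<Sum>u\<in>V. \<Sum>v\<in>V. \<sigma> (u, v) * (if u \<in> S \<and> v \<notin> S then 1 else 0)) = ?cut"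
    proof -
      have "(\<Sum>u\<in>V. \<Sum>v\<in>V. \<sigma> (u, v) * (if u \<in> S \<and> v \<notin> S then 1 else 0))
          = (\<Sum>u\<in>V. if u \<in> S then (\<Sum>v\<in>V. if v \<notin> S then \<sigma> (u, v) else 0) else 0)"
        by (intro sum.cong) (auto intro!: sum.cong)
      also have "\<dots> = (\<Sum>u\<in>S. \<Sum>v\<in>V. if v \<notin> S then \<sigma> (u, v) else 0)"
        using V SV by (intro sum.mono_neutral_cong_right) auto
      also have "\<dots> = ?cut"
        using V SV by (intro sum.cong[OF refl] sum.mono_neutral_cong_right) auto
      finally show ?thesis .
    qed
    have c2: "(\<Sum>u\<in>V. \<Sum>v\<in>V. \<sigma> (u, v) * (if v \<in> S \<and> u \<notin> S then 1 else 0)) = ?cut"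
      unfolding c1[symmetric] by (subst sum.swap) (intro sum.cong refl, simp add: sym)
    have "(\<Sum>u\<in>V. \<Sum>v\<in>V. \<sigma> (u, v) * \<bar>\<phi> u - \<phi> v\<bar>) =
       (\<Sum>u\<in>V. \<Sum>v\<in>V. \<sigma> (u, v) * \<bar>\<psi> u - \<psi> v\<bar> + m * (\<sigma> (u, v) * (if u \<in> S \<and> v \<notin> S then 1 else 0))
        + m * (\<sigma> (u, v) * (if v \<in> S \<and> u \<notin> S then 1 else 0)))"
      by (intro sum.cong refl) (simp add: split algebra_simps)
    also have "\<dots> = (\<Sum>u\<in>V. \<Sum>v\<in>V. \<sigma> (u, v) * \<bar>\<psi> u - \<psi> v\<bar>) + m * ?cut + m * ?cut"
      by (simp only: sum.distrib sum_distrib_left[symmetric] c1 c2)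
    finally have E: "(\<Sum>u\<in>V. \<Sum>v\<in>V. \<sigma> (u, v) * \<bar>\<phi> u - \<phi> v\<bar>) =
       (\<Sum>u\<in>V. \<Sum>v\<in>V. \<sigma> (u, v) * \<bar>\<psi> u - \<psi> v\<bar>) + 2 * m * ?cut" by simp
    have "(\<Sum>v\<in>V. w v * \<phi> v) = (\<Sum>v\<in>V. w v * \<psi> v + (if v \<in> S then m * w v else 0))"
      by (intro sum.cong) (auto simp: \<psi>_def algebra_simps)
    also have "\<dots> = (\<Sum>v\<in>V. w v * \<psi> v) + m * sum w S"
      using V SV by (simp add: sum.distrib sum_distrib_left sum.inter_restrict[symmetric] Int_absorb1)
    finally have W: "(\<Sum>v\<in>V. w v * \<phi> v) = (\<Sum>v\<in>V. w v * \<psi> v) + m * sum w S" .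
    have "h * sum w S \<le> ?cut"
      using iso[OF False SV'] less.prems(2) compl by (simp add: S_def[symmetric] min_absorb1)
    then have "m * (h * sum w S) \<le> m * ?cut" using mpos by simp
    then show ?thesis unfolding E W using IH by (simp add: algebra_simps)
  qed
qed

text \<open>The co-area inequality for \<open>y\<^sup>2\<close>, combined with \<open>|a\<^sup>2 - b\<^sup>2| = |a - b| (a + b)\<close> and the Cauchy-Schwarz inequality. The
sum of the terms \<open>\<sigma>(u, v) (y u + y v)\<^sup>2\<close> is at most \<open>4 \<delta> \<Sum> w y\<^sup>2\<close>, and one factor \<open>\<Sum> w y\<^sup>2\<close> cancels.\<close>

lemma energy_one_sided:
  fixes \<sigma> :: "'v \<times> 'v \<Rightarrow> real" and w y :: "'v \<Rightarrow> real"
  assumes V: "finite V" and w: "\<And>v. v \<in> V \<Longrightarrow> w v > 0"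
    and sym: "\<And>u v. u \<in> V \<Longrightarrow> v \<in> V \<Longrightarrow> \<sigma> (u, v) = \<sigma> (v, u)"
    and \<sigma>: "\<And>u v. u \<in> V \<Longrightarrow> v \<in> V \<Longrightarrow> \<sigma> (u, v) \<ge> 0"
    and nn: "\<And>v. v \<in> V \<Longrightarrow> y v \<ge> 0" and h: "h \<ge> 0"
    and deg: "\<And>v. v \<in> V \<Longrightarrow> (\<Sum>u\<in>V. \<sigma> (u, v)) \<le> \<delta> * w v"
    and iso: "\<And>S. S \<noteq> {} \<Longrightarrow> S \<subset> V \<Longrightarrow> 
        h * min (\<Sum>v\<in>S. w v) (\<Sum>v\<in>V - S. w v) \<le> (\<Sum>u\<in>S. \<Sum>v\<in>V - S. \<sigma> (u, v))"
    and half: "(\<Sum>v\<in>{v\<in>V. y v > 0}. w v) \<le> (\<Sum>v\<in>{v\<in>V. y v = 0}. w v)"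
  shows "h\<^sup>2 * (\<Sum>v\<in>V. w v * (y v)\<^sup>2) \<le> \<delta> * (\<Sum>u\<in>V. \<Sum>v\<in>V. \<sigma> (u, v) * (y u - y v)\<^sup>2)"
proof -
  let ?W = "\<Sum>v\<in>V. w v * (y v)\<^sup>2"
  let ?E = "\<Sum>u\<in>V. \<Sum>v\<in>V. \<sigma> (u, v) * (y u - y v)\<^sup>2"
  let ?P = "\<Sum>u\<in>V. \<Sum>v\<in>V. \<sigma> (u, v) * (y u + y v)\<^sup>2"
  have Wnn: "?W \<ge> 0" by (intro sum_nonneg mult_nonneg_nonneg less_imp_le[OF w]) auto
  have Enn: "?E \<ge> 0" using \<sigma> by (intro sum_nonneg) auto
  have set: "{v\<in>V. (y v)\<^sup>2 > 0} = {v\<in>V. y v > 0}" "{v\<in>V. (y v)\<^sup>2 = 0} = {v\<in>V. y v = 0}"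
    using nn by (auto simp: less_le)
  have 1: "2 * h * ?W \<le> (\<Sum>u\<in>V. \<Sum>v\<in>V. \<sigma> (u, v) * \<bar>(y u)\<^sup>2 - (y v)\<^sup>2\<bar>)"
    by (rule coarea_cheeger[where V = V and w = w and \<sigma> = \<sigma> and \<phi> = "\<lambda>v. (y v)\<^sup>2", OF V w sym]) (assumption | rule iso | simp only: zero_le_power2 set half)+
  have "(\<Sum>u\<in>V. \<Sum>v\<in>V. \<sigma> (u, v) * \<bar>(y u)\<^sup>2 - (y v)\<^sup>2\<bar>)
      = (\<Sum>p\<in>V\<times>V. (sqrt (\<sigma> p) * \<bar>y (fst p) - y (snd p)\<bar>) * (sqrt (\<sigma> p) * (y (fst p) + y (snd p))))"
    unfolding sum.cartesian_product
  proof (intro sum.cong refl, clarify)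
    fix u v assume "u \<in> V" "v \<in> V"
    then have "\<bar>(y u)\<^sup>2 - (y v)\<^sup>2\<bar> = \<bar>y u - y v\<bar> * (y u + y v)"
      using nn[of u] nn[of v] by (simp add: power2_eq_square square_diff_square_factored abs_mult mult.commute)
    moreover have "\<sigma> (u, v) = sqrt (\<sigma> (u, v)) * sqrt (\<sigma> (u, v))" using \<sigma> \<open>u \<in> V\<close> \<open>v \<in> V\<close> by simp
    ultimately show "\<sigma> (u, v) * \<bar>(y u)\<^sup>2 - (y v)\<^sup>2\<bar> =
       sqrt (\<sigma> (u, v)) * \<bar>y (fst (u, v)) - y (snd (u, v))\<bar> * (sqrt (\<sigma> (u, v)) * (y (fst (u, v)) + y (snd (u, v))))"
      by (simp add: mult.assoc mult.left_commute)
  qed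
  also have "(\<dots>)\<^sup>2 \<le> (\<Sum>p\<in>V\<times>V. (sqrt (\<sigma> p) * \<bar>y (fst p) - y (snd p)\<bar>)\<^sup>2) *
      (\<Sum>p\<in>V\<times>V. (sqrt (\<sigma> p) * (y (fst p) + y (snd p)))\<^sup>2)"
    by (rule Cauchy_Schwarz_ineq_sum)
  also have "\<dots> = ?E * ?P"
    unfolding sum.cartesian_product
    by (intro arg_cong2[where f="(*)"] sum.cong refl) (auto simp: power_mult_distrib \<sigma>)
  finally have 2: "(\<Sum>u\<in>V. \<Sum>v\<in>V. \<sigma> (u, v) * \<bar>(y u)\<^sup>2 - (y v)\<^sup>2\<bar>)\<^sup>2 \<le> ?E * ?P" .
  have "?P \<le> (\<Sum>u\<in>V. \<Sum>v\<in>V. 2 * (\<sigma> (v, u) * (y u)\<^sup>2) + 2 * (\<sigma> (u, v) * (y v)\<^sup>2))"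
  proof (intro sum_mono)
    fix u v assume uv: "u \<in> V" "v \<in> V"
    have "(y u + y v)\<^sup>2 \<le> 2 * (y u)\<^sup>2 + 2 * (y v)\<^sup>2"
      using sum_squares_bound[of "y u" "y v"] by (simp add: power2_sum)
    then have "\<sigma> (u, v) * (y u + y v)\<^sup>2 \<le> \<sigma> (u, v) * (2 * (y u)\<^sup>2 + 2 * (y v)\<^sup>2)"
      using \<sigma>[OF uv] by (rule mult_left_mono)
    then show "\<sigma> (u, v) * (y u + y v)\<^sup>2 \<le> 2 * (\<sigma> (v, u) * (y u)\<^sup>2) + 2 * (\<sigma> (u, v) * (y v)\<^sup>2)"
      using sym[OF uv] by (simp add: algebra_simps)
  qed
  also have "\<dots> = 2 * (\<Sum>u\<in>V. \<Sum>v\<in>V. \<sigma> (v, u) * (y u)\<^sup>2) + 2 * (\<Sum>u\<in>V. \<Sum>v\<in>V. \<sigma> (u, v) * (y v)\<^sup>2)"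
    by (simp add: sum.distrib sum_distrib_left)
  also have "(\<Sum>u\<in>V. \<Sum>v\<in>V. \<sigma> (u, v) * (y v)\<^sup>2) = (\<Sum>u\<in>V. \<Sum>v\<in>V. \<sigma> (v, u) * (y u)\<^sup>2)"
    by (rule sum.swap)
  also have "(\<Sum>u\<in>V. \<Sum>v\<in>V. \<sigma> (v, u) * (y u)\<^sup>2) = (\<Sum>u\<in>V. (\<Sum>v\<in>V. \<sigma> (v, u)) * (y u)\<^sup>2)"
    by (simp add: sum_distrib_right)
  also have "\<dots> \<le> (\<Sum>u\<in>V. \<delta> * w u * (y u)\<^sup>2)"
    using deg by (intro sum_mono mult_right_mono) auto
  also have "\<dots> = \<delta> * ?W" by (simp add: sum_distrib_left mult.assoc)
  finally have P: "?P \<le> 4 * \<delta> * ?W" by simp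
  have "(2 * h * ?W)\<^sup>2 \<le> (\<Sum>u\<in>V. \<Sum>v\<in>V. \<sigma> (u, v) * \<bar>(y u)\<^sup>2 - (y v)\<^sup>2\<bar>)\<^sup>2"
    using 1 h Wnn by (intro power_mono) auto
  also have "\<dots> \<le> ?E * ?P" by (rule 2)
  also have "\<dots> \<le> ?E * (4 * \<delta> * ?W)" using P Enn by (rule mult_left_mono)
  finally have fin: "?W * (h\<^sup>2 * ?W) \<le> ?W * (\<delta> * ?E)"
    by (simp add: power_mult_distrib power2_eq_square algebra_simps)
  show ?thesis
  proof (cases "?W = 0")
    case True
    have "\<delta> * ?E \<ge> 0"
    proof (cases "V = {}")
      case False
      then obtain v where v: "v \<in> V" by auto
      have "0 \<le> (\<Sum>u\<in>V. \<sigma> (u, v))" using \<sigma> v by (intro sum_nonneg) auto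
      then have "0 \<le> \<delta> * w v" using deg[OF v] by linarith
      then have "\<delta> \<ge> 0" using w[OF v] by (simp add: zero_le_mult_iff)
      then show ?thesis using Enn by simp
    qed auto
    then show ?thesis by (simp add: True)
  next
    case False
    then have "?W > 0" using Wnn by simp
    from fin show ?thesis unfolding mult_le_cancel_left_pos[OF \<open>?W > 0\<close>] .
  qed
qed

lemma weighted_median:
  fixes w x :: "'v \<Rightarrow> real"
  assumes V: "finite V" "V \<noteq> {}" and w: "\<And>v. v \<in> V \<Longrightarrow> w v > 0"
  obtains c where "sum w {v\<in>V. x v > c} \<le> sum w {v\<in>V. x v \<le> c}"
    "sum w {v\<in>V. x v < c} \<le> sum w {v\<in>V. x v \<ge> c}"
proof -
  define G where "G = {c \<in> x ` V. sum w {v\<in>V. x v > c} \<le> sum w {v\<in>V. x v \<le> c}}"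
  have fG: "finite G" using V by (simp add: G_def)
  let ?top = "Max (x ` V)"
  have "{v\<in>V. x v > ?top} = {}" using V by (auto simp: not_less)
  then have "sum w {v\<in>V. x v > ?top} = 0" by (simp only: sum.empty)
  also have "0 \<le> sum w {v\<in>V. x v \<le> ?top}" by (intro sum_nonneg less_imp_le[OF w]) auto
  finally have "sum w {v\<in>V. x v > ?top} \<le> sum w {v\<in>V. x v \<le> ?top}" .
  then have "?top \<in> G" using V by (auto simp: G_def)
  then have ne: "G \<noteq> {}" by auto
  define c where "c = Min G"
  have cG: "c \<in> G" unfolding c_def using fG ne by (rule Min_in)
  have "sum w {v\<in>V. x v < c} \<le> sum w {v\<in>V. x v \<ge> c}"
  proof (cases "{v\<in>V. x v < c} = {}")
    case True
    then have "sum w {v\<in>V. x v < c} = 0" by (simp only: sum.empty)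
    also have "0 \<le> sum w {v\<in>V. x v \<ge> c}" by (intro sum_nonneg less_imp_le[OF w]) auto
    finally show ?thesis .
  next
    case False
    define c' where "c' = Max (x ` {v\<in>V. x v < c})"
    have "c' \<in> x ` {v\<in>V. x v < c}" unfolding c'_def using V False by (intro Max_in) auto
    then have c': "c' \<in> x ` V" "c' < c" by auto
    have le: "x v \<le> c'" if "v \<in> V" "x v < c" for v unfolding c'_def using that V by (intro Max_ge) auto
    have "c' \<notin> G" using c'(2) fG unfolding c_def by (meson Min_le not_less)
    then have "sum w {v\<in>V. x v \<le> c'} \<le> sum w {v\<in>V. x v > c'}" using c'(1) by (auto simp: G_def)
    moreover have "{v\<in>V. x v \<le> c'} = {v\<in>V. x v < c}" "{v\<in>V. x v > c'} = {v\<in>V. x v \<ge> c}"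
      using le c'(2) by (force simp: not_less[symmetric])+
    ultimately show ?thesis by simp
  qed
  then show thesis using cG by (intro that[of c]) (auto simp: G_def)
qed

text \<open>With \<open>c\<close> a weighted median, the positive and the negative part of \<open>x - c\<close> are both supported on at most half of the weight. Their
energies add up to at most the energy of \<open>x\<close>.\<close>

lemma cheeger_real:
  fixes \<sigma> :: "'v \<times> 'v \<Rightarrow> real" and w x :: "'v \<Rightarrow> real"
  assumes V: "finite V" "V \<noteq> {}" and w: "\<And>v. v \<in> V \<Longrightarrow> w v > 0"
    and sym: "\<And>u v. u \<in> V \<Longrightarrow> v \<in> V \<Longrightarrow> \<sigma> (u, v) = \<sigma> (v, u)"
    and \<sigma>: "\<And>u v. u \<in> V \<Longrightarrow> v \<in> V \<Longrightarrow> \<sigma> (u, v) \<ge> 0"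
    and h: "h \<ge> 0"
    and deg: "\<And>v. v \<in> V \<Longrightarrow> (\<Sum>u\<in>V. \<sigma> (u, v)) \<le> \<delta> * w v"
    and iso: "\<And>S. S \<noteq> {} \<Longrightarrow> S \<subset> V \<Longrightarrow> 
        h * min (\<Sum>v\<in>S. w v) (\<Sum>v\<in>V - S. w v) \<le> (\<Sum>u\<in>S. \<Sum>v\<in>V - S. \<sigma> (u, v))"
  obtains c where "h\<^sup>2 * (\<Sum>v\<in>V. w v * (x v - c)\<^sup>2) \<le> \<delta> * (\<Sum>u\<in>V. \<Sum>v\<in>V. \<sigma> (u, v) * (x u - x v)\<^sup>2)"
proof -
  obtain c where c: "sum w {v\<in>V. x v > c} \<le> sum w {v\<in>V. x v \<le> c}"
    "sum w {v\<in>V. x v < c} \<le> sum w {v\<in>V. x v \<ge> c}"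
    by (rule weighted_median[OF V w])
  define p where "p v = max (x v - c) 0" for v
  define n where "n v = max (c - x v) 0" for v
  have "{v\<in>V. p v > 0} = {v\<in>V. x v > c}" "{v\<in>V. p v = 0} = {v\<in>V. x v \<le> c}"
       "{v\<in>V. n v > 0} = {v\<in>V. x v < c}" "{v\<in>V. n v = 0} = {v\<in>V. x v \<ge> c}"
    by (auto simp: p_def n_def max_def)
  then have hp: "sum w {v\<in>V. p v > 0} \<le> sum w {v\<in>V. p v = 0}"
    and hn: "sum w {v\<in>V. n v > 0} \<le> sum w {v\<in>V. n v = 0}" using c by auto
  have P: "h\<^sup>2 * (\<Sum>v\<in>V. w v * (p v)\<^sup>2) \<le> \<delta> * (\<Sum>u\<in>V. \<Sum>v\<in>V. \<sigma> (u, v) * (p u - p v)\<^sup>2)"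
    by (rule energy_one_sided[OF V(1) w sym \<sigma> _ h deg iso hp]) (auto simp: p_def)
  have N: "h\<^sup>2 * (\<Sum>v\<in>V. w v * (n v)\<^sup>2) \<le> \<delta> * (\<Sum>u\<in>V. \<Sum>v\<in>V. \<sigma> (u, v) * (n u - n v)\<^sup>2)"
    by (rule energy_one_sided[OF V(1) w sym \<sigma> _ h deg iso hn]) (auto simp: n_def)
  have \<delta>: "\<delta> \<ge> 0"
  proof -
    obtain v where v: "v \<in> V" using V by auto
    have "0 \<le> (\<Sum>u\<in>V. \<sigma> (u, v))" using \<sigma> v by (intro sum_nonneg) auto
    then have "0 \<le> \<delta> * w v" using deg[OF v] by linarith
    then show ?thesis using w[OF v] by (simp add: zero_le_mult_iff)
  qed
  have sq: "(x v - c)\<^sup>2 = (p v)\<^sup>2 + (n v)\<^sup>2" for v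
    by (auto simp: p_def n_def max_def power2_commute)
  have "(p u - p v)\<^sup>2 + (n u - n v)\<^sup>2 \<le> (x u - x v)\<^sup>2" for u v
  proof -
    have "x u - x v = (p u - p v) - (n u - n v)" by (auto simp: p_def n_def max_def)
    \<comment> \<open>Positive and negative part are monotone in opposite directions.\<close>
    moreover have "(p u - p v) * (n u - n v) \<le> 0"
      by (auto simp: p_def n_def max_def mult_le_0_iff)
    ultimately show ?thesis by (simp only: power2_diff)
  qed
  note cross = this
  have "h\<^sup>2 * (\<Sum>v\<in>V. w v * (x v - c)\<^sup>2) = h\<^sup>2 * (\<Sum>v\<in>V. w v * (p v)\<^sup>2) + h\<^sup>2 * (\<Sum>v\<in>V. w v * (n v)\<^sup>2)"
    by (simp add: sq distrib_left sum.distrib)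
  also have "\<dots> \<le> \<delta> * (\<Sum>u\<in>V. \<Sum>v\<in>V. \<sigma> (u, v) * (p u - p v)\<^sup>2) + \<delta> * (\<Sum>u\<in>V. \<Sum>v\<in>V. \<sigma> (u, v) * (n u - n v)\<^sup>2)"
    using P N by linarith
  also have "\<dots> = \<delta> * (\<Sum>u\<in>V. \<Sum>v\<in>V. \<sigma> (u, v) * ((p u - p v)\<^sup>2 + (n u - n v)\<^sup>2))"
    by (simp add: sum.distrib distrib_left)
  also have "\<dots> \<le> \<delta> * (\<Sum>u\<in>V. \<Sum>v\<in>V. \<sigma> (u, v) * (x u - x v)\<^sup>2)"
    using \<sigma> \<delta> cross by (intro mult_left_mono sum_mono) auto
  finally show thesis by (rule that)
qed

text \<open>Real and imaginary part are treated separately, which gives a centre \<open>c\<close> in the plane. The nearest point \<open>\<tau>\<close> of the circle is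
at distance \<open>|1 - |c|| \<le> |x v - c|\<close> from \<open>c\<close>, so replacing \<open>c\<close> by \<open>\<tau>\<close> at most doubles all distances.\<close>

lemma cheeger_circle:
  fixes \<sigma> :: "'v \<times> 'v \<Rightarrow> real" and w :: "'v \<Rightarrow> real" and x :: "'v \<Rightarrow> complex"
  assumes V: "finite V" "V \<noteq> {}" and w: "\<And>v. v \<in> V \<Longrightarrow> w v > 0"
    and sym: "\<And>u v. u \<in> V \<Longrightarrow> v \<in> V \<Longrightarrow> \<sigma> (u, v) = \<sigma> (v, u)"
    and \<sigma>: "\<And>u v. u \<in> V \<Longrightarrow> v \<in> V \<Longrightarrow> \<sigma> (u, v) \<ge> 0"
    and h: "h \<ge> 0"
    and deg: "\<And>v. v \<in> V \<Longrightarrow> (\<Sum>u\<in>V. \<sigma> (u, v)) \<le> \<delta> * w v"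
    and iso: "\<And>S. S \<noteq> {} \<Longrightarrow> S \<subset> V \<Longrightarrow> 
        h * min (\<Sum>v\<in>S. w v) (\<Sum>v\<in>V - S. w v) \<le> (\<Sum>u\<in>S. \<Sum>v\<in>V - S. \<sigma> (u, v))"
    and x: "\<And>v. v \<in> V \<Longrightarrow> cmod (x v) = 1"
  obtains \<tau> where "cmod \<tau> = 1"
    "h\<^sup>2 * (\<Sum>v\<in>V. w v * (cmod (x v - \<tau>))\<^sup>2) \<le> 4 * \<delta> * (\<Sum>u\<in>V. \<Sum>v\<in>V. \<sigma> (u, v) * (cmod (x u - x v))\<^sup>2)"
proof -
  note cr = cheeger_real[OF V w sym \<sigma> h deg iso]
  obtain a where a: "h\<^sup>2 * (\<Sum>v\<in>V. w v * (Re (x v) - a)\<^sup>2) \<le> \<delta> * (\<Sum>u\<in>V. \<Sum>v\<in>V. \<sigma> (u, v) * (Re (x u) - Re (x v))\<^sup>2)"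
    by (rule cr[where x = "\<lambda>v. Re (x v)"])
  obtain b where b: "h\<^sup>2 * (\<Sum>v\<in>V. w v * (Im (x v) - b)\<^sup>2) \<le> \<delta> * (\<Sum>u\<in>V. \<Sum>v\<in>V. \<sigma> (u, v) * (Im (x u) - Im (x v))\<^sup>2)"
    by (rule cr[where x = "\<lambda>v. Im (x v)"])
  define c where "c = Complex a b"
  have "h\<^sup>2 * (\<Sum>v\<in>V. w v * (cmod (x v - c))\<^sup>2)
     = h\<^sup>2 * (\<Sum>v\<in>V. w v * (Re (x v) - a)\<^sup>2) + h\<^sup>2 * (\<Sum>v\<in>V. w v * (Im (x v) - b)\<^sup>2)"
    by (simp add: c_def cmod_power2 distrib_left sum.distrib)
  also have "\<dots> \<le> \<delta> * (\<Sum>u\<in>V. \<Sum>v\<in>V. \<sigma> (u, v) * (Re (x u) - Re (x v))\<^sup>2)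
      + \<delta> * (\<Sum>u\<in>V. \<Sum>v\<in>V. \<sigma> (u, v) * (Im (x u) - Im (x v))\<^sup>2)"
    using a b by linarith
  also have "\<dots> = \<delta> * (\<Sum>u\<in>V. \<Sum>v\<in>V. \<sigma> (u, v) * (cmod (x u - x v))\<^sup>2)"
    by (simp add: cmod_power2 distrib_left sum.distrib)
  finally have C: "h\<^sup>2 * (\<Sum>v\<in>V. w v * (cmod (x v - c))\<^sup>2) \<le> \<delta> * (\<Sum>u\<in>V. \<Sum>v\<in>V. \<sigma> (u, v) * (cmod (x u - x v))\<^sup>2)" .
  define \<tau> where "\<tau> = (if c = 0 then 1 else sgn c)"
  have \<tau>1: "cmod \<tau> = 1" by (simp add: \<tau>_def norm_sgn)
  have c\<tau>: "cmod (c - \<tau>) = \<bar>1 - cmod c\<bar>"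
  proof (cases "c = 0")
    case False
    then have "c - \<tau> = (of_real (cmod c) - 1) * sgn c"
      by (simp add: \<tau>_def sgn_eq field_simps)
    then have "cmod (c - \<tau>) = cmod (of_real (cmod c) - 1)" using False by (simp add: norm_mult norm_sgn)
    also have "of_real (cmod c) - 1 = (of_real (cmod c - 1) :: complex)" by simp
    finally show ?thesis by (simp only: norm_of_real abs_minus_commute)
  qed (simp add: \<tau>_def)
  have near: "(cmod (x v - \<tau>))\<^sup>2 \<le> 4 * (cmod (x v - c))\<^sup>2" if "v \<in> V" for v
  proof -
    have "cmod (c - \<tau>) \<le> cmod (x v - c)"
      unfolding c\<tau> using norm_triangle_ineq3[of "x v" c] x[OF that] by simp
    then have "cmod (x v - \<tau>) \<le> 2 * cmod (x v - c)"
      using norm_triangle_ineq[of "x v - c" "c - \<tau>"] by simp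
    then have "(cmod (x v - \<tau>))\<^sup>2 \<le> (2 * cmod (x v - c))\<^sup>2" by (intro power_mono) auto
    then show ?thesis by (simp add: power_mult_distrib)
  qed
  have "h\<^sup>2 * (\<Sum>v\<in>V. w v * (cmod (x v - \<tau>))\<^sup>2) \<le> h\<^sup>2 * (\<Sum>v\<in>V. w v * (4 * (cmod (x v - c))\<^sup>2))"
    using near w by (intro mult_left_mono sum_mono) (auto intro: less_imp_le)
  also have "\<dots> = 4 * (h\<^sup>2 * (\<Sum>v\<in>V. w v * (cmod (x v - c))\<^sup>2))"
    by (simp add: sum_distrib_left algebra_simps)
  also have "\<dots> \<le> 4 * \<delta> * (\<Sum>u\<in>V. \<Sum>v\<in>V. \<sigma> (u, v) * (cmod (x u - x v))\<^sup>2)" using C by simp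
  finally show thesis using \<tau>1 by (rule that[rotated])
qed

section \<open>Unit squares and local stability\<close>

text \<open>The two orthonormal sides either form a positively oriented basis, or do so after they are interchanged.\<close>

lemma unit_square_chart:
  assumes "unit_square Q"
  obtains a b c d where "c\<^sup>2 + d\<^sup>2 = 1" "Q = (\<lambda>(x, y). square_chart a b c d x y) ` ({-1..1} \<times> {-1..1})"
proof -
  have chart: "{p + s *\<^sub>R (c, d) + t *\<^sub>R (- d, c) | s t. s \<in> {0..1} \<and> t \<in> {0..1}}
     = (\<lambda>(x, y). square_chart (fst p + (c - d) / 2) (snd p + (d + c) / 2) c d x y) ` ({-1..1} \<times> {-1..1})"
    (is "?L = ?R") for p :: "real \<times> real" and c d :: real
  proof (intro set_eqI iffI)
    fix z assume "z \<in> ?L"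
    then obtain s t where st: "s \<in> {0..1}" "t \<in> {0..1}" "z = p + s *\<^sub>R (c, d) + t *\<^sub>R (- d, c)" by auto
    show "z \<in> ?R"
      by (rule image_eqI[of _ _ "(2 * s - 1, 2 * t - 1)"])
        (use st in \<open>auto simp: square_chart_def prod_eq_iff field_simps\<close>)
  next
    fix z assume "z \<in> ?R"
    then obtain x y where xy: "x \<in> {-1..1}" "y \<in> {-1..1}"
      "z = square_chart (fst p + (c - d) / 2) (snd p + (d + c) / 2) c d x y" by auto
    have "z = p + ((x + 1) / 2) *\<^sub>R (c, d) + ((y + 1) / 2) *\<^sub>R (- d, c)"
      by (simp add: xy(3) square_chart_def prod_eq_iff field_simps)
    then show "z \<in> ?L" using xy(1,2) by (intro CollectI exI[of _ "(x + 1) / 2"] exI[of _ "(y + 1) / 2"]) auto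
  qed
  \<comment> \<open>The orientation is reversed by interchanging the two sides.\<close>
  have swap: "{p + s *\<^sub>R u + t *\<^sub>R v | s t. s \<in> {0..1} \<and> t \<in> {0..1}}
     = {p + s *\<^sub>R v + t *\<^sub>R u | s t. s \<in> {0..1} \<and> t \<in> {0..1}}" for p u v :: "real \<times> real"
    by (subst ex_comm) (simp add: add_ac conj_commute)
  obtain p u v where uv: "norm u = 1" "norm v = 1" "u \<bullet> v = 0"
    and Q: "Q = {p + s *\<^sub>R u + t *\<^sub>R v | s t. s \<in> {0..1} \<and> t \<in> {0..1}}"
    using assms by (auto simp: unit_square_def)
  obtain c d where u: "u = (c, d)" by force
  obtain c' d' where v: "v = (c', d')" by force
  have n: "c\<^sup>2 + d\<^sup>2 = 1" "c'\<^sup>2 + d'\<^sup>2 = 1" and o: "c * c' + d * d' = 0"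
    using uv by (auto simp: u v norm_Pair real_sqrt_eq_1_iff inner_Pair)
  \<comment> \<open>By the Lagrange identity the determinant \<open>k\<close> of the sides is \<open>1\<close> or \<open>-1\<close>; it recovers \<open>v\<close> from \<open>u\<close>.\<close>
  define k where "k = c * d' - d * c'"
  have "k\<^sup>2 = (c\<^sup>2 + d\<^sup>2) * (c'\<^sup>2 + d'\<^sup>2) - (c * c' + d * d')\<^sup>2"
    by (simp add: k_def power2_eq_square algebra_simps)
  then have "k = 1 \<or> k = -1" using n o by (simp add: power2_eq_1_iff)
  moreover have c': "c' = - k * d"
  proof -
    have "c' = (c\<^sup>2 + d\<^sup>2) * c'" by (simp add: n)
    also have "\<dots> = c * (c * c' + d * d') - k * d" by (simp add: k_def power2_eq_square algebra_simps)
    finally show ?thesis by (simp add: o)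
  qed
  moreover have d': "d' = k * c"
  proof -
    have "d' = (c\<^sup>2 + d\<^sup>2) * d'" by (simp add: n)
    also have "\<dots> = d * (c * c' + d * d') + k * c" by (simp add: k_def power2_eq_square algebra_simps)
    finally show ?thesis by (simp add: o)
  qed
  ultimately consider "c' = - d" "d' = c" | "c = - d'" "d = c'" by auto
  then show thesis
  proof cases
    case 1
    then have "Q = {p + s *\<^sub>R (c, d) + t *\<^sub>R (- d, c) | s t. s \<in> {0..1} \<and> t \<in> {0..1}}" by (simp add: Q u v)
    with n(1) show thesis unfolding chart by (rule that)
  next
    case 2
    have "Q = {p + s *\<^sub>R (c', d') + t *\<^sub>R (- d', c') | s t. s \<in> {0..1} \<and> t \<in> {0..1}}"
      unfolding Q u v 2(1) by (subst swap) (simp only: 2(2))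
    with n(2) show thesis unfolding chart by (rule that)
  qed
qed

lemma compact_unit_square: assumes "unit_square Q" shows "compact Q"
proof -
  obtain a b c d where Q: "Q = (\<lambda>(x, y). square_chart a b c d x y) ` ({-1..1} \<times> {-1..1})"
    using unit_square_chart[OF assms] by metis
  show ?thesis unfolding Q square_chart_def case_prod_beta
    by (intro compact_continuous_image compact_Times continuous_intros) auto
qed

text \<open>The square lies in the axis-parallel square of side 2 with the same centre. The crude constant suffices and
avoids computing the volume of a rotated square.\<close>

lemma measure_unit_square_le: assumes "unit_square Q" shows "measure lebesgue Q \<le> 4"
proof -
  obtain a b c d where cd: "c\<^sup>2 + d\<^sup>2 = 1" and Q: "Q = (\<lambda>(x, y). square_chart a b c d x y) ` ({-1..1} \<times> {-1..1})"
    using unit_square_chart[OF assms] by metis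
  have "c\<^sup>2 \<le> 1" "d\<^sup>2 \<le> 1" using cd zero_le_power2[of c] zero_le_power2[of d] by linarith+
  then have 1: "\<bar>c\<bar> \<le> 1" "\<bar>d\<bar> \<le> 1" by (simp_all add: abs_square_le_1)
  have m: "\<bar>x * e\<bar> \<le> 1" if "x \<in> {-1..1}" "\<bar>e\<bar> \<le> 1" for x e :: real
    using that mult_mono[of "\<bar>x\<bar>" 1 "\<bar>e\<bar>" 1] by (auto simp: abs_mult)
  have "Q \<subseteq> cbox (a - 1, b - 1) (a + 1, b + 1)"
  proof
    fix z assume "z \<in> Q"
    then obtain x y where xy: "x \<in> {-1..1}" "y \<in> {-1..1}" "z = square_chart a b c d x y" by (auto simp: Q)
    show "z \<in> cbox (a - 1, b - 1) (a + 1, b + 1)"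
      using m[OF xy(1) 1(1)] m[OF xy(1) 1(2)] m[OF xy(2) 1(1)] m[OF xy(2) 1(2)]
      by (auto simp: xy(3) square_chart_def cbox_Pair_eq abs_le_iff field_simps)
  qed
  then have "measure lebesgue Q \<le> measure lebesgue (cbox (a - 1, b - 1) (a + 1, b + 1))"
    using compact_unit_square[OF assms] by (intro measure_mono_fmeasurable) (auto simp: compact_imp_closed)
  also have "\<dots> = 4" by (simp add: measure_completion content_Pair)
  finally show ?thesis .
qed

lemma set_integrable_compact:
  fixes \<phi> :: "real \<times> real \<Rightarrow> real"
  assumes "compact Q" "continuous_on UNIV \<phi>"
  shows "set_integrable lebesgue Q \<phi>"
  unfolding set_integrable_def
  using borel_integrable_compact[OF assms(1) continuous_on_subset[OF assms(2)]]
  by (intro integrable_completion[THEN iffD2]) (auto dest: borel_measurable_integrable)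

lemma nn_integral_compact:
  fixes \<phi> :: "real \<times> real \<Rightarrow> real"
  assumes Q: "compact Q" and \<phi>: "continuous_on UNIV \<phi>" and nn: "\<And>z. \<phi> z \<ge> 0"
  shows "(\<integral>\<^sup>+z. indicator Q z * ennreal (\<phi> z) \<partial>lborel) = ennreal (LINT z:Q|lebesgue. \<phi> z)"
proof -
  have "(\<integral>\<^sup>+z. indicator Q z * ennreal (\<phi> z) \<partial>lborel) = (\<integral>\<^sup>+z. ennreal (indicator Q z *\<^sub>R \<phi> z) \<partial>lebesgue)"
    unfolding nn_integral_completion by (intro nn_integral_cong) (auto split: split_indicator)
  also have "\<dots> = ennreal (LINT z:Q|lebesgue. \<phi> z)"
    unfolding set_lebesgue_integral_def
    using set_integrable_compact[OF Q \<phi>] nn by (intro nn_integral_eq_integral) (auto simp: set_integrable_def)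
  finally show ?thesis .
qed

lemma set_integral_le_measure:
  fixes \<phi> :: "real \<times> real \<Rightarrow> real"
  assumes Q: "compact Q" and \<phi>: "continuous_on UNIV \<phi>" and B: "\<And>z. z \<in> Q \<Longrightarrow> \<phi> z \<le> B"
  shows "(LINT z:Q|lebesgue. \<phi> z) \<le> measure lebesgue Q * B"
proof -
  have "(LINT z:Q|lebesgue. \<phi> z) \<le> (LINT z:Q|lebesgue. B)"
    using set_integrable_compact[OF Q] \<phi> B by (intro set_integral_mono) auto
  also have "\<dots> = measure lebesgue Q * B"
    using Q emeasure_compact_finite[OF Q] by (subst set_integral_const) (auto simp: compact_imp_closed)
  finally show ?thesis .
qed

text \<open>Cauchy-Schwarz, from the nonnegativity of the quadratic polynomial \<open>l \<mapsto> \<integral> (|\<phi>| - l)\<^sup>2\<close>.\<close>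

lemma L1_le_L2_compact:
  fixes \<phi> :: "real \<times> real \<Rightarrow> real"
  assumes Q: "compact Q" and \<phi>: "continuous_on UNIV \<phi>"
  shows "(LINT z:Q|lebesgue. \<bar>\<phi> z\<bar>) \<le> sqrt (measure lebesgue Q) * L2_norm_on Q \<phi>"
proof -
  let ?m = "measure lebesgue Q" and ?I = "LINT z:Q|lebesgue. \<bar>\<phi> z\<bar>" and ?S = "LINT z:Q|lebesgue. (\<phi> z)\<^sup>2"
  have int: "set_integrable lebesgue Q \<psi>" if "continuous_on UNIV \<psi>" for \<psi> :: "real \<times> real \<Rightarrow> real"
    using Q that by (rule set_integrable_compact)
  have S0: "?S \<ge> 0" unfolding set_lebesgue_integral_def by (intro integral_nonneg_AE) auto
  have quad: "0 \<le> ?S - 2 * l * ?I + l\<^sup>2 * ?m" for l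
  proof -
    have "0 \<le> (LINT z:Q|lebesgue. (\<bar>\<phi> z\<bar> - l)\<^sup>2)"
      unfolding set_lebesgue_integral_def by (intro integral_nonneg_AE) auto
    also have "\<dots> = (LINT z:Q|lebesgue. ((\<phi> z)\<^sup>2 - 2 * l * \<bar>\<phi> z\<bar>) + l\<^sup>2)"
      by (rule arg_cong[where f = "set_lebesgue_integral lebesgue Q"]) (auto simp: power2_diff)
    also have "\<dots> = ?S - 2 * l * ?I + l\<^sup>2 * ?m"
    proof -
      have A: "set_integrable lebesgue Q (\<lambda>z. (\<phi> z)\<^sup>2)" and B: "set_integrable lebesgue Q (\<lambda>z. 2 * l * \<bar>\<phi> z\<bar>)"
        and C: "set_integrable lebesgue Q (\<lambda>z. l\<^sup>2)"
        by (intro int continuous_intros \<phi>)+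
      have c: "(LINT z:Q|lebesgue. l\<^sup>2) = ?m * l\<^sup>2"
        using Q emeasure_compact_finite[OF Q] by (subst set_integral_const) (auto simp: compact_imp_closed)
      show ?thesis
        unfolding set_integral_add(2)[OF set_integral_diff(1)[OF A B] C] set_integral_diff(2)[OF A B] c
        by (simp add: mult_ac)
    qed
    finally show ?thesis .
  qed
  have "?I\<^sup>2 \<le> ?m * ?S"
  proof (cases "?m = 0")
    case True
    have "?I \<le> 0"
    proof (rule ccontr)
      assume "\<not> ?I \<le> 0"
      then have "2 * ((?S + 1) / ?I) * ?I = 2 * (?S + 1)" by simp
      with quad[of "(?S + 1) / ?I"] have "0 \<le> ?S - 2 * (?S + 1)" by (simp only: True mult_zero_right add_0_right)
      moreover have "x < 0" if "0 \<le> x - 2 * (x + 1)" for x :: real using that by simp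
      ultimately show False using S0 by (meson not_le)
    qed
    moreover have "?I \<ge> 0" unfolding set_lebesgue_integral_def by (intro integral_nonneg_AE) auto
    ultimately show ?thesis using True by simp
  next
    case False
    then have "?m > 0" by (simp add: less_le)
    then show ?thesis using quad[of "?I / ?m"] by (simp add: field_simps power2_eq_square)
  qed
  then have "?I \<le> sqrt (?m * ?S)" by (rule real_le_rsqrt)
  then show ?thesis by (simp add: L2_norm_on_def real_sqrt_mult)
qed

lemma L2_norm_on_sq:
  "(L2_norm_on Q F)\<^sup>2 = (LINT z:Q|lebesgue. (norm (F z))\<^sup>2)"
proof -
  have "(LINT z:Q|lebesgue. (norm (F z))\<^sup>2) \<ge> 0"
    unfolding set_lebesgue_integral_def by (intro integral_nonneg_AE) auto
  then show ?thesis by (simp add: L2_norm_on_def)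
qed

lemma L2_norm_on_nonneg [simp]: "L2_norm_on Q F \<ge> 0"
proof -
  have "(LINT z:Q|lebesgue. (norm (F z))\<^sup>2) \<ge> 0"
    unfolding set_lebesgue_integral_def by (intro integral_nonneg_AE) auto
  then show ?thesis by (simp add: L2_norm_on_def)
qed

text \<open>The estimate on a single square, with a constant that depends neither on the square nor on the functions: the kernels of \<open>f\<close> and
\<open>g\<close> differ by at most a multiple of the square root of \<open>K\<close> times the \<open>L\<^sup>2\<close> norm of the spectrogram difference, and
\<open>common_phase\<close> turns this into a phase. The weight enters because the maximum of the spectrogram on \<open>Q\<close> is at least a
quarter of its integral.\<close>

lemma local_stability:
  obtains C where "C > 0" "\<And>f g Q K. square_integrable f \<Longrightarrow> square_integrable g \<Longrightarrow> unit_square Q \<Longrightarrow>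
     (\<And>z. spectrogram f z + spectrogram g z \<le> K) \<Longrightarrow>
     \<exists>\<tau>. cmod \<tau> = 1 \<and> (\<forall>z\<in>Q. (cmod (gabor g z - \<tau> * gabor f z))\<^sup>2 * vertex_weight f Q
        \<le> C * K * L2_norm_on Q (\<lambda>z. spectrogram f z - spectrogram g z))"
proof -
  \<comment> \<open>\<open>E K\<close> bounds the extension on the bidisc of radius 625; \<open>200 = 25 * 8\<close> collects the factors in front of \<open>\<eta>\<close>.\<close>
  \<comment> \<open>In \<open>C\<close>, 4 bounds the area of the square, \<open>9 = 3\<^sup>2\<close> comes from \<open>common_phase\<close> and 630 from \<open>balance_powers\<close>.\<close>
  define E :: real where "E = exp (pi / 2 * 1250\<^sup>2)"
  define \<alpha> where "\<alpha> = 200 * E"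
  define C where "C = 4 * 9 * (630 * \<alpha>\<^sup>2)"
  have E1: "E \<ge> 1" by (simp add: E_def)
  have C0: "C > 0" using E1 by (simp add: C_def \<alpha>_def)
  have "\<exists>\<tau>. cmod \<tau> = 1 \<and> (\<forall>z\<in>Q. (cmod (gabor g z - \<tau> * gabor f z))\<^sup>2 * vertex_weight f Q
        \<le> C * K * L2_norm_on Q (\<lambda>z. spectrogram f z - spectrogram g z))"
    if f: "square_integrable f" and g: "square_integrable g" and us: "unit_square Q"
      and K: "\<And>z. spectrogram f z + spectrogram g z \<le> K" for f g Q K
  proof -
    obtain a b c d where cd: "c\<^sup>2 + d\<^sup>2 = 1" and Q: "Q = (\<lambda>(x, y). square_chart a b c d x y) ` ({-1..1} \<times> {-1..1})"
      using unit_square_chart[OF us] by metis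
    let ?T = "square_chart a b c d"
    let ?u = "\<lambda>z. spectrogram f z - spectrogram g z"
    define \<eta> where "\<eta> = L2_norm_on Q ?u"
    have cQ: "compact Q" by (rule compact_unit_square[OF us])
    have m4: "measure lebesgue Q \<le> 4" by (rule measure_unit_square_le[OF us])
    have ne: "Q \<noteq> {}" by (auto simp: Q)
    have cont: "continuous_on UNIV (spectrogram h)" if "square_integrable h" for h
      unfolding spectrogram_def by (intro continuous_intros continuous_on_gabor that)
    have cu: "continuous_on UNIV ?u" by (intro continuous_intros cont f g)
    have sp0: "spectrogram h z \<ge> 0" for h z by (simp add: spectrogram_def)
    have uK: "\<bar>?u z\<bar> \<le> K" for z using sp0[of f z] sp0[of g z] K[of z] by linarith
    have K0: "K \<ge> 0" using uK[of 0] by linarith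
    have \<eta>0: "\<eta> \<ge> 0" by (simp add: \<eta>_def)
    have "\<eta>\<^sup>2 \<le> (2 * K)\<^sup>2"
    proof -
      have "\<eta>\<^sup>2 = (LINT z:Q|lebesgue. (?u z)\<^sup>2)" by (simp add: \<eta>_def L2_norm_on_sq)
      also have "\<dots> \<le> measure lebesgue Q * K\<^sup>2"
        using uK by (intro set_integral_le_measure cQ continuous_intros cont f g) (metis power2_abs power_mono abs_ge_zero)
      also have "\<dots> \<le> 4 * K\<^sup>2" using m4 by (intro mult_right_mono) auto
      finally show ?thesis by (simp add: power_mult_distrib)
    qed
    then have \<eta>K: "\<eta> \<le> 2 * K" by (rule power2_le_imp_le) (use K0 in simp)
    have "(LINT z:Q|lebesgue. \<bar>?u z\<bar>) \<le> sqrt (measure lebesgue Q) * \<eta>"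
      unfolding \<eta>_def by (rule L1_le_L2_compact[OF cQ cu])
    also have "\<dots> \<le> 2 * \<eta>"
      using real_sqrt_le_mono[OF m4] \<eta>0 by (intro mult_right_mono) auto
    finally have L1: "(LINT z:Q|lebesgue. \<bar>?u z\<bar>) \<le> 2 * \<eta>" .
    have eps: "(\<integral>\<^sup>+x. \<integral>\<^sup>+y. indicator {-1..1} x * (indicator {-1..1} y * ennreal \<bar>?u (?T x y)\<bar>) \<partial>lborel \<partial>lborel)
       \<le> ennreal (8 * \<eta>)"
    proof -
      have "(\<integral>\<^sup>+x. \<integral>\<^sup>+y. indicator {-1..1} x * (indicator {-1..1} y * ennreal \<bar>?u (?T x y)\<bar>) \<partial>lborel \<partial>lborel)
         \<le> (\<integral>\<^sup>+x. \<integral>\<^sup>+y. indicator Q (?T x y) * ennreal \<bar>?u (?T x y)\<bar> \<partial>lborel \<partial>lborel)"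
        by (intro nn_integral_mono) (auto simp: Q split: split_indicator)
      also have "\<dots> = 4 * (\<integral>\<^sup>+z. indicator Q z * ennreal \<bar>?u z\<bar> \<partial>lborel)"
      proof -
        have [measurable]: "?u \<in> borel_measurable borel" using cu by (rule borel_measurable_continuous_onI)
        have [measurable]: "Q \<in> sets borel" using cQ by (simp add: compact_imp_closed)
        show ?thesis unfolding square_chart_def
          by (rule nn_integral_rotation[OF _ cd, of "\<lambda>z. indicator Q z * ennreal \<bar>?u z\<bar>"]) measurable
      qed
      also have "(\<integral>\<^sup>+z. indicator Q z * ennreal \<bar>?u z\<bar> \<partial>lborel) = ennreal (LINT z:Q|lebesgue. \<bar>?u z\<bar>)"
        by (intro nn_integral_compact cQ continuous_intros cont f g) simp
      also have "\<dots> \<le> ennreal (2 * \<eta>)" using L1 by (rule ennreal_leI)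
      also have "4 * ennreal (2 * \<eta>) = ennreal (8 * \<eta>)"
        using \<eta>0 ennreal_mult[of 4 "2 * \<eta>"] by simp
      finally show ?thesis by (simp add: mult_left_mono)
    qed
    let ?H = "\<lambda>z z'. cmod (gabor f z * cnj (gabor f z') - gabor g z * cnj (gabor g z'))"
    have H: "(?H z z')\<^sup>2 \<le> 630 * \<alpha>\<^sup>2 * (K * \<eta>)" if z: "z \<in> Q" "z' \<in> Q" for z z'
    proof (rule balance_powers[OF _ norm_ge_zero \<eta>0 \<eta>K])
      fix N
      obtain s1 t1 s2 t2 where st: "s1 \<in> {-1..1}" "t1 \<in> {-1..1}" "s2 \<in> {-1..1}" "t2 \<in> {-1..1}"
        and zz: "z = ?T s1 t1" "z' = ?T s2 t2" using z by (auto simp: Q)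
      have "?H z z' \<le> 25 * (25 ^ N * (8 * \<eta>)) + 11 * (E * K) / 25 ^ N"
        unfolding zz E_def using K \<eta>0 st unfolding spectrogram_def
        by (intro cross_difference_bound[OF f g cd _ eps]) auto
      also have "\<dots> \<le> 200 * E * (25 ^ N * \<eta>) + 200 * E * (K / 25 ^ N)"
      proof (rule add_mono)
        show "25 * (25 ^ N * (8 * \<eta>)) \<le> 200 * E * (25 ^ N * \<eta>)"
          using E1 \<eta>0 mult_right_mono[of 1 E "200 * (25 ^ N * \<eta>)"] by (simp add: mult_ac)
        show "11 * (E * K) / 25 ^ N \<le> 200 * E * (K / 25 ^ N)"
          using E1 K0 by (simp add: divide_right_mono)
      qed
      finally show "?H z z' \<le> \<alpha> * (25 ^ N * \<eta> + K / 25 ^ N)" by (simp add: \<alpha>_def distrib_left)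
    qed
    define e where "e = sqrt (630 * \<alpha>\<^sup>2 * (K * \<eta>))"
    have e2: "e\<^sup>2 = 630 * \<alpha>\<^sup>2 * (K * \<eta>)" using K0 \<eta>0 by (simp add: e_def)
    have He: "?H z z' \<le> e" if "z \<in> Q" "z' \<in> Q" for z z'
      unfolding e_def using H[OF that] by (rule real_le_rsqrt)
    obtain w where w: "w \<in> Q" "\<And>z. z \<in> Q \<Longrightarrow> cmod (gabor f z) \<le> cmod (gabor f w)"
      using continuous_attains_sup[OF cQ ne, of "\<lambda>z. cmod (gabor f z)"] continuous_on_gabor[OF f]
      by (metis continuous_on_norm)
    obtain \<tau> where \<tau>: "cmod \<tau> = 1" "\<And>z. z \<in> Q \<Longrightarrow> cmod (gabor g z - \<tau> * gabor f z) * cmod (gabor f w) \<le> 3 * e"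
      using common_phase[of Q "gabor f" "gabor g" e w] He w by metis
    have vw: "vertex_weight f Q \<le> 4 * (cmod (gabor f w))\<^sup>2"
    proof -
      have "vertex_weight f Q = (LINT z:Q|lebesgue. (cmod (gabor f z))\<^sup>2)"
        by (simp add: vertex_weight_def L2_norm_on_sq)
      also have "\<dots> \<le> measure lebesgue Q * (cmod (gabor f w))\<^sup>2"
        using w(2) by (intro set_integral_le_measure cQ continuous_intros continuous_on_gabor f) (simp add: power_mono)
      also have "\<dots> \<le> 4 * (cmod (gabor f w))\<^sup>2" using m4 by (intro mult_right_mono) auto
      finally show ?thesis .
    qed
    have "(cmod (gabor g z - \<tau> * gabor f z))\<^sup>2 * vertex_weight f Q \<le> C * K * \<eta>" if z: "z \<in> Q" for z
    proof -
      have "(cmod (gabor g z - \<tau> * gabor f z))\<^sup>2 * vertex_weight f Q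
         \<le> (cmod (gabor g z - \<tau> * gabor f z))\<^sup>2 * (4 * (cmod (gabor f w))\<^sup>2)"
        using vw by (intro mult_left_mono) auto
      also have "\<dots> = 4 * (cmod (gabor g z - \<tau> * gabor f z) * cmod (gabor f w))\<^sup>2"
        by (simp add: power_mult_distrib)
      also have "\<dots> \<le> 4 * (3 * e)\<^sup>2" using \<tau>(2)[OF z] by (intro mult_left_mono power_mono) auto
      also have "\<dots> = C * K * \<eta>" by (simp add: power_mult_distrib e2 C_def)
      finally show ?thesis .
    qed
    then show ?thesis using \<tau>(1) unfolding \<eta>_def by blast
  qed
  then show thesis by (rule that[OF C0])
qed

section \<open>Gluing the local phases\<close>

lemma Linf_norm_nonneg:
  fixes F :: "real \<times> real \<Rightarrow> 'b::real_normed_vector"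
  assumes "F \<in> borel_measurable lebesgue" "\<And>z. norm (F z) \<le> B"
  shows "Linf_norm F \<ge> 0"
proof (rule ccontr)
  assume neg: "\<not> ?thesis"
  have "AE z in lebesgue. (\<lambda>_::real \<times> real. False) z"
    using AE_le_Linf_norm[OF assms]
  proof eventually_elim
    case (elim z)
    then show False using neg norm_ge_zero[of "F z"] by linarith
  qed
  then have "emeasure lebesgue (UNIV :: (real \<times> real) set) = 0"
    by (simp add: AE_iff_measurable[OF _ refl])
  then show False by simp
qed

lemma set_integral_nonneg_real:
  fixes \<phi> :: "'a \<Rightarrow> real"
  assumes "\<And>z. \<phi> z \<ge> 0" shows "(LINT z:A|M. \<phi> z) \<ge> 0"
  unfolding set_lebesgue_integral_def using assms by (intro integral_nonneg_AE) auto

lemma set_integral_Union_le_sum: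
  fixes \<phi> :: "real \<times> real \<Rightarrow> real"
  assumes fin: "finite \<Q>" and cQ: "\<And>Q. Q \<in> \<Q> \<Longrightarrow> compact Q" and \<phi>: "continuous_on UNIV \<phi>" and nn: "\<And>z. \<phi> z \<ge> 0"
  shows "(LINT z:\<Union>\<Q>|lebesgue. \<phi> z) \<le> (\<Sum>Q\<in>\<Q>. LINT z:Q|lebesgue. \<phi> z)"
proof -
  have cU: "compact (\<Union>\<Q>)" using fin cQ by (rule compact_Union)
  have int: "integrable lebesgue (\<lambda>z. indicator Q z *\<^sub>R \<phi> z)" if "compact Q" for Q
    using set_integrable_compact[OF that \<phi>] by (simp add: set_integrable_def)
  have "(LINT z:\<Union>\<Q>|lebesgue. \<phi> z) \<le> (LINT z|lebesgue. (\<Sum>Q\<in>\<Q>. indicator Q z *\<^sub>R \<phi> z))"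
    unfolding set_lebesgue_integral_def
  proof (rule integral_mono)
    fix z
    show "indicator (\<Union>\<Q>) z *\<^sub>R \<phi> z \<le> (\<Sum>Q\<in>\<Q>. indicator Q z *\<^sub>R \<phi> z)"
    proof (cases "z \<in> \<Union>\<Q>")
      case True
      then obtain Q where Q: "Q \<in> \<Q>" "z \<in> Q" by auto
      then have "indicator (\<Union>\<Q>) z *\<^sub>R \<phi> z = indicator Q z *\<^sub>R \<phi> z" using True by simp
      also have "\<dots> \<le> (\<Sum>Q\<in>\<Q>. indicator Q z *\<^sub>R \<phi> z)"
        using fin Q(1) nn by (intro member_le_sum) auto
      finally show ?thesis .
    qed (use nn in \<open>simp add: sum_nonneg\<close>)
  qed (use int cU cQ in auto)
  also have "\<dots> = (\<Sum>Q\<in>\<Q>. LINT z:Q|lebesgue. \<phi> z)"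
    unfolding set_lebesgue_integral_def by (intro Bochner_Integration.integral_sum int cQ)
  finally show ?thesis .
qed

lemma sum_indicator_measurable:
  assumes "finite \<Q>" "\<And>Q. Q \<in> \<Q> \<Longrightarrow> compact (Q :: (real \<times> real) set)"
  shows "(\<lambda>z. \<Sum>Q\<in>\<Q>. indicator Q z :: real) \<in> borel_measurable lebesgue"
  using assms by (intro borel_measurable_sum borel_measurable_indicator) (auto simp: compact_imp_closed)

lemma sum_indicator_bound: "norm (\<Sum>Q\<in>\<Q>. indicator Q z :: real) \<le> real (card \<Q>)"
  using sum_bounded_above[of \<Q> "\<lambda>Q. indicator Q z :: real" 1]
  by (simp add: sum_nonneg indicator_le_1)

lemma sum_set_integral_le_overlap:
  fixes \<phi> :: "real \<times> real \<Rightarrow> real"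
  assumes fin: "finite \<Q>" and cQ: "\<And>Q. Q \<in> \<Q> \<Longrightarrow> compact Q" and \<phi>: "continuous_on UNIV \<phi>" and nn: "\<And>z. \<phi> z \<ge> 0"
  shows "(\<Sum>Q\<in>\<Q>. LINT z:Q|lebesgue. \<phi> z) \<le> Linf_norm (\<lambda>z. \<Sum>Q\<in>\<Q>. indicator Q z :: real) * (LINT z:\<Union>\<Q>|lebesgue. \<phi> z)"
proof -
  let ?L = "Linf_norm (\<lambda>z. \<Sum>Q\<in>\<Q>. indicator Q z :: real)"
  have cU: "compact (\<Union>\<Q>)" using fin cQ by (rule compact_Union)
  have int: "integrable lebesgue (\<lambda>z. indicator Q z *\<^sub>R \<phi> z)" if "compact Q" for Q
    using set_integrable_compact[OF that \<phi>] by (simp add: set_integrable_def)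
  have "(\<Sum>Q\<in>\<Q>. LINT z:Q|lebesgue. \<phi> z) = (LINT z|lebesgue. (\<Sum>Q\<in>\<Q>. indicator Q z *\<^sub>R \<phi> z))"
    unfolding set_lebesgue_integral_def by (intro Bochner_Integration.integral_sum[symmetric] int cQ)
  also have "\<dots> \<le> (LINT z|lebesgue. ?L * (indicator (\<Union>\<Q>) z *\<^sub>R \<phi> z))"
  proof (rule integral_mono_AE)
    show "integrable lebesgue (\<lambda>z. \<Sum>Q\<in>\<Q>. indicator Q z *\<^sub>R \<phi> z)"
      by (intro Bochner_Integration.integrable_sum int cQ)
    show "integrable lebesgue (\<lambda>z. ?L * (indicator (\<Union>\<Q>) z *\<^sub>R \<phi> z))"
      by (intro integrable_mult_right int cU)
    have "AE z in lebesgue. norm (\<Sum>Q\<in>\<Q>. indicator Q z :: real) \<le> ?L"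
      by (rule AE_le_Linf_norm[OF sum_indicator_measurable[OF fin cQ] sum_indicator_bound])
    then show "AE z in lebesgue. (\<Sum>Q\<in>\<Q>. indicator Q z *\<^sub>R \<phi> z) \<le> ?L * (indicator (\<Union>\<Q>) z *\<^sub>R \<phi> z)"
    proof eventually_elim
      case (elim z)
      show ?case
      proof (cases "z \<in> \<Union>\<Q>")
        case True
        have "(\<Sum>Q\<in>\<Q>. indicator Q z *\<^sub>R \<phi> z) = (\<Sum>Q\<in>\<Q>. indicator Q z) * \<phi> z"
          by (simp add: sum_distrib_right)
        also have "\<dots> \<le> ?L * \<phi> z" using elim nn by (intro mult_right_mono) auto
        finally show ?thesis using True by simp
      next
        case False
        then have "(\<Sum>Q\<in>\<Q>. indicator Q z *\<^sub>R \<phi> z) = 0" by (intro sum.neutral) auto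
        then show ?thesis using False by simp
      qed
    qed
  qed
  also have "\<dots> = ?L * (LINT z:\<Union>\<Q>|lebesgue. \<phi> z)" by (simp add: set_lebesgue_integral_def)
  finally show ?thesis .
qed

text \<open>Expanding the square exhibits the distance as a continuous function of \<open>\<tau>\<close> on the compact unit circle.\<close>

lemma arg_min_phase_exists:
  assumes f: "square_integrable f" and g: "square_integrable g" and \<Omega>: "compact \<Omega>"
  shows "\<exists>\<tau>. is_arg_min (\<lambda>\<tau>. L2_norm_on \<Omega> (\<lambda>z. gabor g z - \<tau> * gabor f z)) (\<lambda>\<tau>. cmod \<tau> = 1) \<tau>"
proof -
  let ?D = "\<lambda>\<tau>. L2_norm_on \<Omega> (\<lambda>z. gabor g z - \<tau> * gabor f z)"
  define p where "p z = Re (gabor f z * cnj (gabor g z))" for z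
  define q where "q z = Im (gabor f z * cnj (gabor g z))" for z
  have int: "set_integrable lebesgue \<Omega> \<psi>" if "continuous_on UNIV \<psi>" for \<psi> :: "real \<times> real \<Rightarrow> real"
    using \<Omega> that by (rule set_integrable_compact)
  have c: "continuous_on UNIV (gabor f)" "continuous_on UNIV (gabor g)" using f g by (auto intro: continuous_on_gabor)
  have i: "set_integrable lebesgue \<Omega> (\<lambda>z. (cmod (gabor g z))\<^sup>2)" "set_integrable lebesgue \<Omega> (\<lambda>z. k * (cmod (gabor f z))\<^sup>2)"
    "set_integrable lebesgue \<Omega> (\<lambda>z. k * p z)" "set_integrable lebesgue \<Omega> (\<lambda>z. k * q z)" for k
    unfolding p_def q_def by (intro int continuous_intros c)+
  have expand: "(cmod (gabor g z - \<tau> * gabor f z))\<^sup>2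
      = (cmod (gabor g z))\<^sup>2 + (cmod \<tau>)\<^sup>2 * (cmod (gabor f z))\<^sup>2 - 2 * Re \<tau> * p z + 2 * Im \<tau> * q z" for \<tau> z
    unfolding cmod_power2 p_def q_def by (simp add: power2_eq_square algebra_simps)
  have "(?D \<tau>) = sqrt ((LINT z:\<Omega>|lebesgue. (cmod (gabor g z))\<^sup>2) + (cmod \<tau>)\<^sup>2 * (LINT z:\<Omega>|lebesgue. (cmod (gabor f z))\<^sup>2)
      - 2 * Re \<tau> * (LINT z:\<Omega>|lebesgue. p z) + 2 * Im \<tau> * (LINT z:\<Omega>|lebesgue. q z))" for \<tau>
    unfolding L2_norm_on_def expand
    using i by (subst set_integral_add(2) set_integral_diff(2), (intro set_integral_add(1) set_integral_diff(1) i)+)+ simp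
  then have "continuous_on (sphere 0 1) ?D" by (simp only:) (intro continuous_intros)
  then obtain \<tau> where "\<tau> \<in> sphere 0 1" "\<forall>\<tau>'\<in>sphere 0 1. ?D \<tau> \<le> ?D \<tau>'"
    using continuous_attains_inf[of "sphere 0 1" ?D] by (auto simp: compact_sphere)
  then show ?thesis by (intro exI[of _ \<tau>]) (auto simp: is_arg_min_def not_less)
qed

lemma cheeger_constant_nonneg:
  assumes "\<And>v. v \<in> V \<Longrightarrow> w v \<ge> 0" "\<And>u v. u \<in> V \<Longrightarrow> v \<in> V \<Longrightarrow> \<sigma> (u, v) \<ge> 0"
  shows "cheeger_constant V w \<sigma> \<ge> 0"
  unfolding cheeger_constant_def
proof (rule INF_greatest)
  fix S assume "S \<in> {S. S \<noteq> {} \<and> S \<subset> V}"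
  then have S: "S \<subseteq> V" by auto
  have "0 \<le> (\<Sum>u\<in>S. \<Sum>v\<in>V - S. \<sigma> (u, v))" using S assms(2) by (intro sum_nonneg) auto
  moreover have "0 \<le> min (\<Sum>v\<in>S. w v) (\<Sum>v\<in>V - S. w v)" using S assms(1) by (auto intro!: sum_nonneg)
  ultimately show "0 \<le> ereal ((\<Sum>u\<in>S. \<Sum>v\<in>V - S. \<sigma> (u, v)) / min (\<Sum>v\<in>S. w v) (\<Sum>v\<in>V - S. w v))" by simp
qed

text \<open>A vertex of weight zero, taken as the set \<open>S\<close>, makes the denominator in the definition of the Cheeger constant
zero, and the quotient is then zero as well.\<close>

lemma weight_pos_of_cheeger_constant:
  assumes w: "\<And>v. v \<in> V \<Longrightarrow> w v \<ge> 0" and \<sigma>: "\<And>u v. u \<in> V \<Longrightarrow> v \<in> V \<Longrightarrow> \<sigma> (u, v) \<ge> 0"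
    and h: "cheeger_constant V w \<sigma> \<noteq> 0" and v: "v \<in> V" "V \<noteq> {v}"
  shows "w v > 0"
proof (rule ccontr)
  assume "\<not> w v > 0"
  then have 0: "w v = 0" using w[OF v(1)] by simp
  have "cheeger_constant V w \<sigma> \<le> ereal ((\<Sum>u\<in>{v}. \<Sum>x\<in>V - {v}. \<sigma> (u, x)) / min (\<Sum>x\<in>{v}. w x) (\<Sum>x\<in>V - {v}. w x))"
    unfolding cheeger_constant_def using v by (intro INF_lower) auto
  also have "min (\<Sum>x\<in>{v}. w x) (\<Sum>x\<in>V - {v}. w x) = 0"
    using 0 w by (auto simp: min_def intro!: sum_nonneg)
  finally have "cheeger_constant V w \<sigma> \<le> 0" by (simp add: zero_ereal_def)
  then show False using h cheeger_constant_nonneg[of V w \<sigma>] w \<sigma> by (meson antisym)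
qed

lemma cheeger_constant_cut:
  assumes fin: "finite V" and w: "\<And>v. v \<in> V \<Longrightarrow> w v > 0" and h: "cheeger_constant V w \<sigma> = ereal h"
    and S: "S \<noteq> {}" "S \<subset> V"
  shows "h * min (\<Sum>v\<in>S. w v) (\<Sum>v\<in>V - S. w v) \<le> (\<Sum>u\<in>S. \<Sum>v\<in>V - S. \<sigma> (u, v))"
proof -
  let ?m = "min (\<Sum>v\<in>S. w v) (\<Sum>v\<in>V - S. w v)"
  have "ereal h \<le> ereal ((\<Sum>u\<in>S. \<Sum>v\<in>V - S. \<sigma> (u, v)) / ?m)"
    unfolding h[symmetric] cheeger_constant_def using S by (intro INF_lower) auto
  moreover have "?m > 0" using fin S w finite_subset[of S V] by (auto intro!: sum_pos)
  ultimately show ?thesis by (simp add: field_simps)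
qed

lemma cheeger_constant_finite:
  assumes "v \<in> V" "V \<noteq> {v}" shows "cheeger_constant V w \<sigma> \<noteq> \<infinity>"
proof -
  have "cheeger_constant V w \<sigma> \<le> ereal ((\<Sum>u\<in>{v}. \<Sum>x\<in>V - {v}. \<sigma> (u, x)) / min (\<Sum>x\<in>{v}. w x) (\<Sum>x\<in>V - {v}. w x))"
    unfolding cheeger_constant_def using assms by (intro INF_lower) auto
  then show ?thesis by auto
qed

text \<open>Cheeger's inequality in terms of \<^const>\<open>cheeger_constant\<close>. For a single vertex the Cheeger constant is infinite and
\<open>\<kappa> = 0\<close>, in agreement with the choice \<open>\<tau> = x v\<close>.\<close>

lemma cheeger_constant_synchronization:
  fixes \<sigma> :: "'v \<times> 'v \<Rightarrow> real" and w :: "'v \<Rightarrow> real" and x :: "'v \<Rightarrow> complex"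
  assumes V: "finite V" "V \<noteq> {}" and w: "\<And>v. v \<in> V \<Longrightarrow> w v > 0"
    and sym: "\<And>u v. u \<in> V \<Longrightarrow> v \<in> V \<Longrightarrow> \<sigma> (u, v) = \<sigma> (v, u)"
    and \<sigma>: "\<And>u v. u \<in> V \<Longrightarrow> v \<in> V \<Longrightarrow> \<sigma> (u, v) \<ge> 0"
    and h: "cheeger_constant V w \<sigma> \<noteq> 0"
    and x: "\<And>v. v \<in> V \<Longrightarrow> cmod (x v) = 1"
  defines "\<delta> \<equiv> Max ((\<lambda>v. weighted_degree V \<sigma> v / w v) ` V)"
    and "\<kappa> \<equiv> real_of_ereal (inverse ((cheeger_constant V w \<sigma>)\<^sup>2))"
  obtains \<tau> where "cmod \<tau> = 1"
    "(\<Sum>v\<in>V. w v * (cmod (x v - \<tau>))\<^sup>2) \<le> 4 * \<kappa> * \<delta> * (\<Sum>u\<in>V. \<Sum>v\<in>V. \<sigma> (u, v) * (cmod (x u - x v))\<^sup>2)"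
proof -
  obtain v where v: "v \<in> V" using V by auto
  show thesis
  proof (cases "V = {v}")
    case True
    have "cheeger_constant V w \<sigma> = \<infinity>"
    proof -
      have "{S. S \<noteq> {} \<and> S \<subset> V} = {}" using True by auto
      then show ?thesis by (simp only: cheeger_constant_def image_empty Inf_empty top_ereal_def)
    qed
    then have "\<kappa> = 0" by (simp add: \<kappa>_def)
    then show thesis using True x[OF v] by (intro that[of "x v"]) auto
  next
    case False
    let ?h = "cheeger_constant V w \<sigma>"
    have "?h \<ge> 0" using w \<sigma> by (intro cheeger_constant_nonneg) (auto intro: less_imp_le)
    moreover have "?h \<noteq> \<infinity>" using v False by (rule cheeger_constant_finite)
    ultimately obtain h' where h': "?h = ereal h'" "h' > 0" using h by (cases ?h) auto
    have \<kappa>: "\<kappa> = 1 / h'\<^sup>2" using h'(2) by (simp add: \<kappa>_def h'(1) power2_eq_square divide_inverse)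
    have deg: "(\<Sum>u\<in>V. \<sigma> (u, v)) \<le> \<delta> * w v" if "v \<in> V" for v
    proof -
      have "weighted_degree V \<sigma> v / w v \<le> \<delta>" unfolding \<delta>_def using V that by (intro Max_ge) auto
      then show ?thesis using w[OF that] by (simp add: weighted_degree_def field_simps)
    qed
    obtain \<tau> where \<tau>: "cmod \<tau> = 1"
      "h'\<^sup>2 * (\<Sum>v\<in>V. w v * (cmod (x v - \<tau>))\<^sup>2) \<le> 4 * \<delta> * (\<Sum>u\<in>V. \<Sum>v\<in>V. \<sigma> (u, v) * (cmod (x u - x v))\<^sup>2)"
      by (rule cheeger_circle[OF V w sym \<sigma> less_imp_le[OF h'(2)] deg cheeger_constant_cut[OF V(1) w h'(1)] x])
    show thesis
      using \<tau> h'(2) by (intro that[of \<tau>]) (auto simp: \<kappa> field_simps)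
  qed
qed


text \<open>Two phases that both fit \<open>G\<close> on their squares can differ only where \<open>F\<close> is small on the overlap. Integrating over the overlap produces one factor
\<open>s = \<parallel>F\<parallel>\<^sup>2\<close>; the second factor \<open>s\<close> in the edge weight is at most the weight of either square and cancels the
denominators of the local estimates.\<close>

lemma overlap_phase_bound:
  assumes f: "square_integrable f" and u: "compact u" and v: "compact v" and m4: "measure lebesgue (u \<inter> v) \<le> 4"
    and a: "\<And>z. z \<in> u \<Longrightarrow> (cmod (G z - \<alpha> * gabor f z))\<^sup>2 * vertex_weight f u \<le> A"
    and b: "\<And>z. z \<in> v \<Longrightarrow> (cmod (G z - \<beta> * gabor f z))\<^sup>2 * vertex_weight f v \<le> B"
    and w: "vertex_weight f u > 0" "vertex_weight f v > 0" and AB: "A \<ge> 0" "B \<ge> 0"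
  shows "edge_weight f (u, v) * (cmod (\<alpha> - \<beta>))\<^sup>2 \<le> 8 * (A + B)"
proof -
  let ?F = "gabor f"
  define s where "s = (LINT z:u \<inter> v|lebesgue. (cmod (?F z))\<^sup>2)"
  have c: "continuous_on UNIV (\<lambda>z. k * (cmod (?F z))\<^sup>2)" for k :: real
    by (intro continuous_intros continuous_on_gabor f)
  have cuv: "compact (u \<inter> v)" using u v by (rule compact_Int)
  have s0: "s \<ge> 0" unfolding s_def by (intro set_integral_nonneg_real) simp
  have mono: "s \<le> vertex_weight f x" if "compact x" "u \<inter> v \<subseteq> x" for x
    unfolding s_def vertex_weight_def L2_norm_on_sq set_lebesgue_integral_def
    using set_integrable_compact[OF cuv c[of 1]] set_integrable_compact[OF that(1) c[of 1]] that(2)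
    by (intro integral_mono) (auto simp: set_integrable_def split: split_indicator)
  have su: "s \<le> vertex_weight f u" and sv: "s \<le> vertex_weight f v" using mono u v by auto
  have "(cmod (\<alpha> - \<beta>))\<^sup>2 * s = (LINT z:u \<inter> v|lebesgue. (cmod (\<alpha> - \<beta>))\<^sup>2 * (cmod (?F z))\<^sup>2)"
    by (simp add: s_def)
  also have "\<dots> \<le> measure lebesgue (u \<inter> v) * (2 * (A / vertex_weight f u) + 2 * (B / vertex_weight f v))"
  proof (rule set_integral_le_measure[OF cuv c])
    fix z assume z: "z \<in> u \<inter> v"
    have A: "(cmod (G z - \<alpha> * ?F z))\<^sup>2 \<le> A / vertex_weight f u" using a[of z] z w by (simp add: pos_le_divide_eq)
    have B: "(cmod (G z - \<beta> * ?F z))\<^sup>2 \<le> B / vertex_weight f v" using b[of z] z w by (simp add: pos_le_divide_eq)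
    have "cmod (\<alpha> - \<beta>) * cmod (?F z) = cmod ((G z - \<beta> * ?F z) - (G z - \<alpha> * ?F z))"
      by (simp add: norm_mult[symmetric] algebra_simps)
    also have "\<dots> \<le> cmod (G z - \<beta> * ?F z) + cmod (G z - \<alpha> * ?F z)" by (rule norm_triangle_ineq4)
    finally have "(cmod (\<alpha> - \<beta>) * cmod (?F z))\<^sup>2 \<le> (cmod (G z - \<beta> * ?F z) + cmod (G z - \<alpha> * ?F z))\<^sup>2"
      by (intro power_mono) auto
    also have "\<dots> \<le> 2 * (cmod (G z - \<alpha> * ?F z))\<^sup>2 + 2 * (cmod (G z - \<beta> * ?F z))\<^sup>2"
      using sum_squares_bound[of "cmod (G z - \<beta> * ?F z)" "cmod (G z - \<alpha> * ?F z)"] by (simp add: power2_sum)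
    finally show "(cmod (\<alpha> - \<beta>))\<^sup>2 * (cmod (?F z))\<^sup>2 \<le> 2 * (A / vertex_weight f u) + 2 * (B / vertex_weight f v)"
      using A B by (simp add: power_mult_distrib)
  qed
  also have "\<dots> \<le> 4 * (2 * (A / vertex_weight f u) + 2 * (B / vertex_weight f v))"
    using m4 AB w by (intro mult_right_mono) auto
  finally have "s * ((cmod (\<alpha> - \<beta>))\<^sup>2 * s) \<le> s * (4 * (2 * (A / vertex_weight f u) + 2 * (B / vertex_weight f v)))"
    using s0 by (rule mult_left_mono)
  also have "\<dots> = 8 * (s * (A / vertex_weight f u) + s * (B / vertex_weight f v))" by (simp add: algebra_simps)
  also have "\<dots> \<le> 8 * (A + B)"
  proof -
    have "s * (A / vertex_weight f u) \<le> vertex_weight f u * (A / vertex_weight f u)"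
      using su w AB by (intro mult_right_mono) auto
    moreover have "s * (B / vertex_weight f v) \<le> vertex_weight f v * (B / vertex_weight f v)"
      using sv w AB by (intro mult_right_mono) auto
    ultimately show ?thesis using w by simp
  qed
  moreover have "edge_weight f (u, v) = s\<^sup>2"
    unfolding edge_weight_def s_def L2_norm_on_sq[symmetric] by (simp flip: power_mult)
  ultimately show ?thesis by (simp add: power2_eq_square mult_ac)
qed

text \<open>If \<open>F\<close> vanishes almost everywhere on \<open>Q\<close>, then \<open>|G|\<^sup>2\<close> is the difference of the spectrograms. Its integral
over \<open>Q\<close> is then controlled by the \<open>L\<^sup>2\<close> norm of that difference and the volume of \<open>Q\<close>.\<close>

lemma degenerate_square_bound:
  assumes f: "square_integrable f" and g: "square_integrable g" and Q: "compact Q" and w: "vertex_weight f Q = 0"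
    and \<tau>: "cmod \<tau> = 1"
  shows "(L2_norm_on Q (\<lambda>z. gabor g z - \<tau> * gabor f z))\<^sup>2
     \<le> 2 * (sqrt (measure lebesgue Q) * L2_norm_on Q (\<lambda>z. spectrogram f z - spectrogram g z))"
proof -
  let ?u = "\<lambda>z. spectrogram f z - spectrogram g z"
  have c: "continuous_on UNIV (gabor f)" "continuous_on UNIV (gabor g)" using f g by (auto intro: continuous_on_gabor)
  have cu: "continuous_on UNIV ?u" unfolding spectrogram_def by (intro continuous_intros c)
  have i: "set_integrable lebesgue Q (\<lambda>z. 2 * \<bar>?u z\<bar>)" "set_integrable lebesgue Q (\<lambda>z. 4 * (cmod (gabor f z))\<^sup>2)"
    by (intro set_integrable_compact Q continuous_intros cu c)+
  have "(L2_norm_on Q (\<lambda>z. gabor g z - \<tau> * gabor f z))\<^sup>2 = (LINT z:Q|lebesgue. (cmod (gabor g z - \<tau> * gabor f z))\<^sup>2)"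
    by (rule L2_norm_on_sq)
  also have "\<dots> \<le> (LINT z:Q|lebesgue. 2 * \<bar>?u z\<bar> + 4 * (cmod (gabor f z))\<^sup>2)"
  proof (rule set_integral_mono)
    show "set_integrable lebesgue Q (\<lambda>z. (cmod (gabor g z - \<tau> * gabor f z))\<^sup>2)"
      by (intro set_integrable_compact Q continuous_intros c)
    show "set_integrable lebesgue Q (\<lambda>z. 2 * \<bar>?u z\<bar> + 4 * (cmod (gabor f z))\<^sup>2)"
      by (intro set_integral_add(1) i)
    fix z
    have "cmod (gabor g z - \<tau> * gabor f z) \<le> cmod (gabor g z) + cmod (gabor f z)"
      using norm_triangle_ineq4[of "gabor g z" "\<tau> * gabor f z"] by (simp add: norm_mult \<tau>)
    then have "(cmod (gabor g z - \<tau> * gabor f z))\<^sup>2 \<le> (cmod (gabor g z) + cmod (gabor f z))\<^sup>2"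
      by (intro power_mono) auto
    also have "\<dots> \<le> 2 * spectrogram g z + 2 * spectrogram f z"
      using sum_squares_bound[of "cmod (gabor g z)" "cmod (gabor f z)"] by (simp add: power2_sum spectrogram_def)
    also have "\<dots> \<le> 2 * \<bar>?u z\<bar> + 4 * spectrogram f z"
      using abs_ge_minus_self[of "?u z"] by simp
    finally show "(cmod (gabor g z - \<tau> * gabor f z))\<^sup>2 \<le> 2 * \<bar>?u z\<bar> + 4 * (cmod (gabor f z))\<^sup>2"
      by (simp only: spectrogram_def)
  qed
  also have "\<dots> = 2 * (LINT z:Q|lebesgue. \<bar>?u z\<bar>)"
    using w unfolding set_integral_add(2)[OF i] by (simp add: vertex_weight_def L2_norm_on_sq)
  also have "\<dots> \<le> 2 * (sqrt (measure lebesgue Q) * L2_norm_on Q ?u)"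
    using L1_le_L2_compact[OF Q cu] by simp
  finally show ?thesis .
qed

text \<open>Replacing the local phases \<open>x Q\<close> by a common \<open>\<tau>\<close> costs \<open>w(Q) |x Q - \<tau>|\<^sup>2\<close> on each square.\<close>

lemma glued_phase_bound:
  assumes f: "square_integrable f" and g: "square_integrable g"
    and fin: "finite \<Q>" and cQ: "\<And>Q. Q \<in> \<Q> \<Longrightarrow> compact Q" and m4: "\<And>Q. Q \<in> \<Q> \<Longrightarrow> measure lebesgue Q \<le> 4"
    and w: "\<And>Q. Q \<in> \<Q> \<Longrightarrow> vertex_weight f Q > 0"
    and A: "\<And>Q z. Q \<in> \<Q> \<Longrightarrow> z \<in> Q \<Longrightarrow> (cmod (gabor g z - x Q * gabor f z))\<^sup>2 * vertex_weight f Q \<le> A Q"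
    and A0: "\<And>Q. Q \<in> \<Q> \<Longrightarrow> A Q \<ge> 0"
  shows "(L2_norm_on (\<Union>\<Q>) (\<lambda>z. gabor g z - \<tau> * gabor f z))\<^sup>2
     \<le> 8 * (\<Sum>Q\<in>\<Q>. A Q / vertex_weight f Q) + 2 * (\<Sum>Q\<in>\<Q>. vertex_weight f Q * (cmod (x Q - \<tau>))\<^sup>2)"
proof -
  have c: "continuous_on UNIV (gabor f)" "continuous_on UNIV (gabor g)" using f g by (auto intro: continuous_on_gabor)
  have "(L2_norm_on (\<Union>\<Q>) (\<lambda>z. gabor g z - \<tau> * gabor f z))\<^sup>2
     \<le> (\<Sum>Q\<in>\<Q>. LINT z:Q|lebesgue. (cmod (gabor g z - \<tau> * gabor f z))\<^sup>2)"
    unfolding L2_norm_on_sq by (intro set_integral_Union_le_sum fin cQ continuous_intros c) auto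
  also have "\<dots> \<le> (\<Sum>Q\<in>\<Q>. 8 * (A Q / vertex_weight f Q) + 2 * (vertex_weight f Q * (cmod (x Q - \<tau>))\<^sup>2))"
  proof (rule sum_mono)
    fix Q assume Q: "Q \<in> \<Q>"
    let ?a = "2 * (A Q / vertex_weight f Q)" and ?b = "2 * (cmod (x Q - \<tau>))\<^sup>2"
    have i: "set_integrable lebesgue Q (\<lambda>z. ?a)" "set_integrable lebesgue Q (\<lambda>z. ?b * (cmod (gabor f z))\<^sup>2)"
      by (intro set_integrable_compact cQ Q continuous_intros c)+
    have "(LINT z:Q|lebesgue. (cmod (gabor g z - \<tau> * gabor f z))\<^sup>2) \<le> (LINT z:Q|lebesgue. ?a + ?b * (cmod (gabor f z))\<^sup>2)"
    proof (rule set_integral_mono)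
      show "set_integrable lebesgue Q (\<lambda>z. (cmod (gabor g z - \<tau> * gabor f z))\<^sup>2)"
        by (intro set_integrable_compact cQ Q continuous_intros c)
      show "set_integrable lebesgue Q (\<lambda>z. ?a + ?b * (cmod (gabor f z))\<^sup>2)" by (intro set_integral_add(1) i)
      fix z assume z: "z \<in> Q"
      have "cmod (gabor g z - \<tau> * gabor f z) \<le> cmod (gabor g z - x Q * gabor f z) + cmod (x Q - \<tau>) * cmod (gabor f z)"
      proof -
        have "gabor g z - \<tau> * gabor f z = (gabor g z - x Q * gabor f z) + (x Q - \<tau>) * gabor f z"
          by (simp add: algebra_simps)
        then show ?thesis using norm_triangle_ineq[of "gabor g z - x Q * gabor f z" "(x Q - \<tau>) * gabor f z"]
          by (simp only: norm_mult)
      qed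
      then have "(cmod (gabor g z - \<tau> * gabor f z))\<^sup>2
          \<le> (cmod (gabor g z - x Q * gabor f z) + cmod (x Q - \<tau>) * cmod (gabor f z))\<^sup>2"
        by (intro power_mono) auto
      also have "\<dots> \<le> 2 * (cmod (gabor g z - x Q * gabor f z))\<^sup>2 + 2 * (cmod (x Q - \<tau>) * cmod (gabor f z))\<^sup>2"
        using sum_squares_bound[of "cmod (gabor g z - x Q * gabor f z)" "cmod (x Q - \<tau>) * cmod (gabor f z)"]
        by (simp add: power2_sum)
      also have "(cmod (gabor g z - x Q * gabor f z))\<^sup>2 \<le> A Q / vertex_weight f Q"
        using A[OF Q z] w[OF Q] by (simp add: pos_le_divide_eq)
      finally show "(cmod (gabor g z - \<tau> * gabor f z))\<^sup>2 \<le> ?a + ?b * (cmod (gabor f z))\<^sup>2"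
        by (simp add: power_mult_distrib)
    qed
    also have "\<dots> = measure lebesgue Q * ?a + ?b * vertex_weight f Q"
    proof -
      have "(LINT z:Q|lebesgue. ?a) = measure lebesgue Q * ?a"
        using cQ[OF Q] emeasure_compact_finite[OF cQ[OF Q]] by (subst set_integral_const) (auto simp: compact_imp_closed)
      then show ?thesis unfolding set_integral_add(2)[OF i] by (simp add: vertex_weight_def L2_norm_on_sq)
    qed
    also have "measure lebesgue Q * ?a \<le> 4 * ?a"
      using m4[OF Q] A0[OF Q] w[OF Q] by (intro mult_right_mono) auto
    finally show "(LINT z:Q|lebesgue. (cmod (gabor g z - \<tau> * gabor f z))\<^sup>2)
       \<le> 8 * (A Q / vertex_weight f Q) + 2 * (vertex_weight f Q * (cmod (x Q - \<tau>))\<^sup>2)" by (simp add: mult_ac)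
  qed
  also have "\<dots> = 8 * (\<Sum>Q\<in>\<Q>. A Q / vertex_weight f Q) + 2 * (\<Sum>Q\<in>\<Q>. vertex_weight f Q * (cmod (x Q - \<tau>))\<^sup>2)"
    by (simp add: sum.distrib sum_distrib_left)
  finally show ?thesis .
qed

theorem theorem2p15:
  shows "\<exists>C::real. C > 0 \<and>
    (\<forall>(f :: real \<Rightarrow> complex) (\<Q> :: (real \<times> real) set set).
      square_integrable f \<longrightarrow> \<not> (AE t in lebesgue. f t = 0) \<longrightarrow>
      finite \<Q> \<longrightarrow> \<Q> \<noteq> {} \<longrightarrow> (\<forall>Q\<in>\<Q>. unit_square Q) \<longrightarrow>
      cheeger_constant \<Q> (vertex_weight f) (edge_weight f) \<noteq> 0 \<longrightarrow>
      (\<forall>g :: real \<Rightarrow> complex. square_integrable g \<longrightarrow>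
        (let \<Omega> = \<Union>\<Q>;
             h = cheeger_constant \<Q> (vertex_weight f) (edge_weight f);
             \<delta>\<^sub>0 = Max ((\<lambda>v. weighted_degree \<Q> (edge_weight f) v / vertex_weight f v) ` \<Q>);
             \<nu> = real (card \<Q>);
             M = (\<Sum>Q\<in>\<Q>. 1 / (L1_norm_on Q (spectrogram f))\<^sup>2);
             L = Linf_norm (\<lambda>z. \<Sum>Q\<in>\<Q>. indicator Q z :: real);
             K = Linf_norm (spectrogram f) + Linf_norm (spectrogram g);
             D = (\<lambda>\<tau>::complex. L2_norm_on \<Omega> (\<lambda>z. gabor g z - \<tau> * gabor f z))
         in \<exists>\<tau>. is_arg_min D (\<lambda>\<tau>. cmod \<tau> = 1) \<tau> \<and>
              D \<tau> \<le> C * sqrt (K * sqrt M * sqrt L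
                              + real_of_ereal (inverse (h\<^sup>2)) * \<delta>\<^sub>0 * K * \<nu> powr (3/2) * sqrt L
                              + sqrt (measure lebesgue \<Omega>))
                      * sqrt (L2_norm_on \<Omega> (\<lambda>z. spectrogram f z - spectrogram g z)))))"
proof -
  obtain C\<^sub>1 where C\<^sub>1: "C\<^sub>1 > 0" and loc: "\<And>f g Q K. square_integrable f \<Longrightarrow> square_integrable g \<Longrightarrow> unit_square Q \<Longrightarrow>
     (\<And>z. spectrogram f z + spectrogram g z \<le> K) \<Longrightarrow>
     \<exists>\<tau>. cmod \<tau> = 1 \<and> (\<forall>z\<in>Q. (cmod (gabor g z - \<tau> * gabor f z))\<^sup>2 * vertex_weight f Q
        \<le> C\<^sub>1 * K * L2_norm_on Q (\<lambda>z. spectrogram f z - spectrogram g z))"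
    using local_stability by blast
  define C\<^sub>2 where "C\<^sub>2 = 128 * C\<^sub>1 + 2"
  have C\<^sub>2: "C\<^sub>2 > 0" using C\<^sub>1 by (simp add: C\<^sub>2_def)
  show ?thesis
  proof (intro exI[of _ "sqrt C\<^sub>2"] conjI allI impI)
    show "sqrt C\<^sub>2 > 0" using C\<^sub>2 by simp
    fix f g :: "real \<Rightarrow> complex" and \<Q> :: "(real \<times> real) set set"
    assume f: "square_integrable f" and g: "square_integrable g" and fin: "finite \<Q>" and ne: "\<Q> \<noteq> {}"
      and us: "\<forall>Q\<in>\<Q>. unit_square Q" and h0: "cheeger_constant \<Q> (vertex_weight f) (edge_weight f) \<noteq> 0"
    define \<Omega> where "\<Omega> = \<Union>\<Q>"
    define \<kappa> where "\<kappa> = real_of_ereal (inverse ((cheeger_constant \<Q> (vertex_weight f) (edge_weight f))\<^sup>2))"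
    define \<delta> where "\<delta> = Max ((\<lambda>v. weighted_degree \<Q> (edge_weight f) v / vertex_weight f v) ` \<Q>)"
    define \<nu> where "\<nu> = real (card \<Q>)"
    define M where "M = (\<Sum>Q\<in>\<Q>. 1 / (L1_norm_on Q (spectrogram f))\<^sup>2)"
    define L where "L = Linf_norm (\<lambda>z. \<Sum>Q\<in>\<Q>. indicator Q z :: real)"
    define K where "K = Linf_norm (spectrogram f) + Linf_norm (spectrogram g)"
    define D where "D = (\<lambda>\<tau>::complex. L2_norm_on \<Omega> (\<lambda>z. gabor g z - \<tau> * gabor f z))"
    define u where "u z = spectrogram f z - spectrogram g z" for z
    define \<eta> where "\<eta> = L2_norm_on \<Omega> u"
    define A where "A = K * sqrt M * sqrt L + \<kappa> * \<delta> * K * \<nu> powr (3/2) * sqrt L + sqrt (measure lebesgue \<Omega>)"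
    let ?w = "vertex_weight f" and ?\<sigma> = "edge_weight f"
    have cQ: "compact Q" if "Q \<in> \<Q>" for Q using us that by (auto intro: compact_unit_square)
    have m4: "measure lebesgue Q \<le> 4" if "Q \<in> \<Q>" for Q using us that by (auto intro: measure_unit_square_le)
    have c\<Omega>: "compact \<Omega>" unfolding \<Omega>_def using fin cQ by (rule compact_Union)
    have cont: "continuous_on UNIV (spectrogram k)" if "square_integrable k" for k
      unfolding spectrogram_def by (intro continuous_intros continuous_on_gabor that)
    have cu: "continuous_on UNIV u" unfolding u_def by (intro continuous_intros cont f g)
    have sup: "0 \<le> spectrogram k z" "spectrogram k z \<le> Linf_norm (spectrogram k)" if k: "square_integrable k" for k z
    proof -
      show "0 \<le> spectrogram k z" by (simp add: spectrogram_def)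
      obtain B where B: "\<And>z. cmod (gabor k z) \<le> B" using gabor_bounded[OF k] by blast
      have "norm (spectrogram k z) \<le> Linf_norm (spectrogram k)"
        by (rule le_Linf_norm[OF cont[OF k], of "B\<^sup>2"]) (auto simp: spectrogram_def intro!: power_mono B)
      then show "spectrogram k z \<le> Linf_norm (spectrogram k)" by simp
    qed
    have K: "spectrogram f z + spectrogram g z \<le> K" for z
      unfolding K_def using sup(2)[OF f] sup(2)[OF g] by (intro add_mono)
    have K0: "K \<ge> 0" using K[of 0] sup(1)[OF f, of 0] sup(1)[OF g, of 0] by linarith
    have L0: "L \<ge> 0" unfolding L_def
      by (rule Linf_norm_nonneg[OF sum_indicator_measurable[OF fin cQ] sum_indicator_bound])
    have M0: "M \<ge> 0" unfolding M_def by (intro sum_nonneg) auto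
    have w0: "?w Q \<ge> 0" for Q by (simp add: vertex_weight_def)
    have \<sigma>0: "?\<sigma> e \<ge> 0" for e by (cases e) (simp add: edge_weight_def)
    have \<sigma>sym: "?\<sigma> (Q, Q') = ?\<sigma> (Q', Q)" for Q Q' by (simp add: edge_weight_def Int_commute)
    have \<eta>0: "\<eta> \<ge> 0" by (simp add: \<eta>_def)
    have \<delta>0: "\<delta> \<ge> 0"
    proof -
      obtain Q where Q: "Q \<in> \<Q>" using ne by auto
      have "0 \<le> weighted_degree \<Q> ?\<sigma> Q / ?w Q"
        unfolding weighted_degree_def using \<sigma>0 w0 by (intro divide_nonneg_nonneg sum_nonneg)
      also have "\<dots> \<le> \<delta>" unfolding \<delta>_def using fin Q by (intro Max_ge) auto
      finally show ?thesis .
    qed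
    have \<kappa>0: "\<kappa> \<ge> 0"
    proof -
      have "cheeger_constant \<Q> ?w ?\<sigma> \<ge> 0" using w0 \<sigma>0 by (intro cheeger_constant_nonneg)
      then show ?thesis unfolding \<kappa>_def
        by (intro real_of_ereal_pos) (cases "cheeger_constant \<Q> ?w ?\<sigma>", auto simp: power2_eq_square)
    qed
    have terms: "0 \<le> K * sqrt M * sqrt L" "0 \<le> \<kappa> * \<delta> * K * \<nu> powr (3/2) * sqrt L" "0 \<le> sqrt (measure lebesgue \<Omega>)"
      using K0 M0 L0 \<kappa>0 \<delta>0 by auto
    have A0: "A \<ge> 0" using terms by (simp add: A_def)
    have "\<exists>\<tau>. cmod \<tau> = 1 \<and> (D \<tau>)\<^sup>2 \<le> C\<^sub>2 * A * \<eta>"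
    proof (cases "\<forall>Q\<in>\<Q>. ?w Q > 0")
      case False
      then obtain Q where Q: "Q \<in> \<Q>" "?w Q = 0" using w0 by (force simp: less_le)
      have "\<Q> = {Q}"
        using weight_pos_of_cheeger_constant[of \<Q> ?w ?\<sigma> Q] fin w0 \<sigma>0 h0 Q by force
      then have \<Omega>: "\<Omega> = Q" by (simp add: \<Omega>_def)
      have "(D 1)\<^sup>2 \<le> 2 * (sqrt (measure lebesgue \<Omega>) * \<eta>)"
        unfolding D_def \<eta>_def u_def \<Omega> using degenerate_square_bound[OF f g cQ[OF Q(1)] Q(2), of 1] by simp
      also have "\<dots> \<le> 2 * (A * \<eta>)"
        using terms \<eta>0 by (intro mult_left_mono mult_right_mono) (auto simp: A_def)
      also have "\<dots> \<le> C\<^sub>2 * (A * \<eta>)" using C\<^sub>1 A0 \<eta>0 by (intro mult_right_mono) (auto simp: C\<^sub>2_def)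
      finally show ?thesis by (intro exI[of _ 1]) (simp add: mult.assoc)
    next
      case True
      then have wpos: "?w Q > 0" if "Q \<in> \<Q>" for Q using that by blast
      define \<epsilon> where "\<epsilon> Q = L2_norm_on Q u" for Q
      have \<epsilon>0: "\<epsilon> Q \<ge> 0" for Q by (simp add: \<epsilon>_def)
      have "\<forall>Q\<in>\<Q>. \<exists>\<tau>. cmod \<tau> = 1 \<and> (\<forall>z\<in>Q. (cmod (gabor g z - \<tau> * gabor f z))\<^sup>2 * ?w Q \<le> C\<^sub>1 * K * \<epsilon> Q)"
        using loc[OF f g _ K] us unfolding \<epsilon>_def u_def by blast
      then obtain x where x: "\<And>Q. Q \<in> \<Q> \<Longrightarrow> cmod (x Q) = 1"
        and xb: "\<And>Q z. Q \<in> \<Q> \<Longrightarrow> z \<in> Q \<Longrightarrow> (cmod (gabor g z - x Q * gabor f z))\<^sup>2 * ?w Q \<le> C\<^sub>1 * K * \<epsilon> Q"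
        by metis
      have ab0: "C\<^sub>1 * K * \<epsilon> Q \<ge> 0" for Q using C\<^sub>1 K0 \<epsilon>0 by simp
      obtain \<tau> where \<tau>: "cmod \<tau> = 1" and sync: "(\<Sum>Q\<in>\<Q>. ?w Q * (cmod (x Q - \<tau>))\<^sup>2)
          \<le> 4 * \<kappa> * \<delta> * (\<Sum>Q\<in>\<Q>. \<Sum>Q'\<in>\<Q>. ?\<sigma> (Q, Q') * (cmod (x Q - x Q'))\<^sup>2)"
        unfolding \<kappa>_def \<delta>_def
        by (rule cheeger_constant_synchronization[OF fin ne wpos \<sigma>sym \<sigma>0 h0 x])
      have sq: "(\<Sum>Q\<in>\<Q>. (\<epsilon> Q)\<^sup>2) \<le> L * \<eta>\<^sup>2"
        unfolding \<epsilon>_def \<eta>_def \<Omega>_def L_def L2_norm_on_sq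
        by (intro sum_set_integral_le_overlap fin cQ continuous_intros cu) auto
      have \<epsilon>2: "sqrt (\<Sum>Q\<in>\<Q>. (\<epsilon> Q)\<^sup>2) \<le> sqrt L * \<eta>"
        using real_sqrt_le_mono[OF sq] \<eta>0 by (simp add: real_sqrt_mult)
      \<comment> \<open>Applied with \<open>a = 1 / w\<close> for the local errors and with \<open>a = 1\<close> for the edges.\<close>
      have CS: "(\<Sum>Q\<in>\<Q>. a Q * \<epsilon> Q) \<le> sqrt (\<Sum>Q\<in>\<Q>. (a Q)\<^sup>2) * (sqrt L * \<eta>)" for a
      proof -
        have "(\<Sum>Q\<in>\<Q>. a Q * \<epsilon> Q) \<le> sqrt ((\<Sum>Q\<in>\<Q>. (a Q)\<^sup>2) * (\<Sum>Q\<in>\<Q>. (\<epsilon> Q)\<^sup>2))"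
          by (intro real_le_rsqrt Cauchy_Schwarz_ineq_sum)
        also have "\<dots> \<le> sqrt (\<Sum>Q\<in>\<Q>. (a Q)\<^sup>2) * (sqrt L * \<eta>)"
          unfolding real_sqrt_mult using \<epsilon>2 by (intro mult_left_mono) (auto intro: sum_nonneg)
        finally show ?thesis .
      qed
      have loc_sum: "(\<Sum>Q\<in>\<Q>. C\<^sub>1 * K * \<epsilon> Q / ?w Q) \<le> C\<^sub>1 * (K * sqrt M * sqrt L) * \<eta>"
      proof -
        have "L1_norm_on Q (spectrogram f) = ?w Q" for Q
          by (simp add: L1_norm_on_def vertex_weight_def L2_norm_on_sq spectrogram_def)
        then have M: "M = (\<Sum>Q\<in>\<Q>. (1 / ?w Q)\<^sup>2)" by (simp add: M_def power_divide)
        have "(\<Sum>Q\<in>\<Q>. C\<^sub>1 * K * \<epsilon> Q / ?w Q) = C\<^sub>1 * K * (\<Sum>Q\<in>\<Q>. 1 / ?w Q * \<epsilon> Q)"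
          by (simp add: sum_distrib_left)
        also have "\<dots> \<le> C\<^sub>1 * K * (sqrt M * (sqrt L * \<eta>))"
          unfolding M using C\<^sub>1 K0 by (intro mult_left_mono CS) auto
        finally show ?thesis by (simp add: mult_ac)
      qed
      have edge_sum: "(\<Sum>Q\<in>\<Q>. \<Sum>Q'\<in>\<Q>. ?\<sigma> (Q, Q') * (cmod (x Q - x Q'))\<^sup>2) \<le> 16 * C\<^sub>1 * (K * \<nu> powr (3/2) * sqrt L) * \<eta>"
      proof -
        have "(\<Sum>Q\<in>\<Q>. \<Sum>Q'\<in>\<Q>. ?\<sigma> (Q, Q') * (cmod (x Q - x Q'))\<^sup>2)
            \<le> (\<Sum>Q\<in>\<Q>. \<Sum>Q'\<in>\<Q>. 8 * (C\<^sub>1 * K * \<epsilon> Q + C\<^sub>1 * K * \<epsilon> Q'))"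
        proof (intro sum_mono)
          fix Q Q' assume Q: "Q \<in> \<Q>" "Q' \<in> \<Q>"
          have "measure lebesgue (Q \<inter> Q') \<le> measure lebesgue Q"
            using cQ Q by (intro measure_mono_fmeasurable) (auto simp: compact_imp_closed intro: lmeasurable_compact)
          also have "\<dots> \<le> 4" by (rule m4[OF Q(1)])
          finally show "?\<sigma> (Q, Q') * (cmod (x Q - x Q'))\<^sup>2 \<le> 8 * (C\<^sub>1 * K * \<epsilon> Q + C\<^sub>1 * K * \<epsilon> Q')"
            using Q by (intro overlap_phase_bound[OF f, where G = "gabor g"] cQ xb wpos ab0)
        qed
        also have "\<dots> = 16 * C\<^sub>1 * K * \<nu> * (\<Sum>Q\<in>\<Q>. \<epsilon> Q)"
          by (simp add: sum.distrib \<nu>_def flip: sum_distrib_left)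
        also have "\<dots> \<le> 16 * C\<^sub>1 * K * \<nu> * (sqrt \<nu> * (sqrt L * \<eta>))"
          using CS[of "\<lambda>_. 1"] C\<^sub>1 K0 by (intro mult_left_mono) (auto simp: \<nu>_def)
        also have "\<dots> = 16 * C\<^sub>1 * (K * (\<nu> * sqrt \<nu>) * sqrt L) * \<eta>" by (simp add: mult_ac)
        also have "\<nu> * sqrt \<nu> = \<nu> powr (3/2)"
        proof -
          have "\<nu> > 0" using fin ne by (simp add: \<nu>_def card_gt_0_iff)
          then have "\<nu> powr (1 + 1/2) = \<nu> * sqrt \<nu>" by (subst powr_add) (simp add: powr_half_sqrt)
          then show ?thesis by simp
        qed
        finally show ?thesis .
      qed
      have "(D \<tau>)\<^sup>2 \<le> 8 * (\<Sum>Q\<in>\<Q>. C\<^sub>1 * K * \<epsilon> Q / ?w Q) + 2 * (\<Sum>Q\<in>\<Q>. ?w Q * (cmod (x Q - \<tau>))\<^sup>2)"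
        unfolding D_def \<Omega>_def by (rule glued_phase_bound[OF f g fin cQ m4 wpos xb ab0])
      also have "\<dots> \<le> 8 * (C\<^sub>1 * (K * sqrt M * sqrt L) * \<eta>)
          + 2 * (4 * \<kappa> * \<delta> * (16 * C\<^sub>1 * (K * \<nu> powr (3/2) * sqrt L) * \<eta>))"
        using loc_sum order_trans[OF sync mult_left_mono[OF edge_sum]] \<kappa>0 \<delta>0 by (intro add_mono mult_left_mono) auto
      also have "\<dots> = (8 * C\<^sub>1) * (K * sqrt M * sqrt L * \<eta>) + (128 * C\<^sub>1) * (\<kappa> * \<delta> * K * \<nu> powr (3/2) * sqrt L * \<eta>)"
        by (simp add: mult_ac)
      also have "\<dots> \<le> C\<^sub>2 * (K * sqrt M * sqrt L * \<eta>) + C\<^sub>2 * (\<kappa> * \<delta> * K * \<nu> powr (3/2) * sqrt L * \<eta>)"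
        using C\<^sub>1 mult_nonneg_nonneg[OF terms(1) \<eta>0] mult_nonneg_nonneg[OF terms(2) \<eta>0]
        by (intro add_mono mult_right_mono) (auto simp: C\<^sub>2_def)
      also have "\<dots> = C\<^sub>2 * (A - sqrt (measure lebesgue \<Omega>)) * \<eta>" by (simp add: A_def algebra_simps)
      also have "\<dots> \<le> C\<^sub>2 * A * \<eta>" using C\<^sub>2 \<eta>0 by (intro mult_right_mono mult_left_mono) auto
      finally show ?thesis using \<tau> by blast
    qed
    then obtain \<tau>\<^sub>0 where \<tau>\<^sub>0: "cmod \<tau>\<^sub>0 = 1" "(D \<tau>\<^sub>0)\<^sup>2 \<le> C\<^sub>2 * A * \<eta>" by blast
    obtain \<tau> where \<tau>: "is_arg_min D (\<lambda>\<tau>. cmod \<tau> = 1) \<tau>"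
      using arg_min_phase_exists[OF f g c\<Omega>] unfolding D_def by blast
    have "D \<tau> \<le> D \<tau>\<^sub>0" using \<tau> \<tau>\<^sub>0(1) by (auto simp: is_arg_min_def not_less)
    also have "\<dots> \<le> sqrt (C\<^sub>2 * A * \<eta>)" using \<tau>\<^sub>0(2) by (rule real_le_rsqrt)
    also have "\<dots> = sqrt C\<^sub>2 * sqrt A * sqrt \<eta>" by (simp add: real_sqrt_mult)
    finally have "\<exists>\<tau>. is_arg_min D (\<lambda>\<tau>. cmod \<tau> = 1) \<tau> \<and> D \<tau> \<le> sqrt C\<^sub>2 * sqrt A * sqrt \<eta>" using \<tau> by blast
    then show "let \<Omega> = \<Union>\<Q>;
             h = cheeger_constant \<Q> (vertex_weight f) (edge_weight f);
             \<delta>\<^sub>0 = Max ((\<lambda>v. weighted_degree \<Q> (edge_weight f) v / vertex_weight f v) ` \<Q>);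
             \<nu> = real (card \<Q>);
             M = (\<Sum>Q\<in>\<Q>. 1 / (L1_norm_on Q (spectrogram f))\<^sup>2);
             L = Linf_norm (\<lambda>z. \<Sum>Q\<in>\<Q>. indicator Q z :: real);
             K = Linf_norm (spectrogram f) + Linf_norm (spectrogram g);
             D = (\<lambda>\<tau>::complex. L2_norm_on \<Omega> (\<lambda>z. gabor g z - \<tau> * gabor f z))
         in \<exists>\<tau>. is_arg_min D (\<lambda>\<tau>. cmod \<tau> = 1) \<tau> \<and>
              D \<tau> \<le> sqrt C\<^sub>2 * sqrt (K * sqrt M * sqrt L
                              + real_of_ereal (inverse (h\<^sup>2)) * \<delta>\<^sub>0 * K * \<nu> powr (3/2) * sqrt L
                              + sqrt (measure lebesgue \<Omega>))
                      * sqrt (L2_norm_on \<Omega> (\<lambda>z. spectrogram f z - spectrogram g z))"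
      unfolding Let_def A_def \<eta>_def u_def[abs_def] D_def K_def L_def M_def \<nu>_def \<delta>_def \<kappa>_def \<Omega>_def .
  qed
qed

end
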